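(* Let $H(K)$ be a separable reproducing kernel Hilbert space of complex-valued functions on a subset $D\subset\mathbb{R}^d$. Let $\varrho_D$ be a non-trivial $\sigma$-finite measure on $D$ and assume that the positive semidefinite kernel $K:D\times D\to\mathbb{C}$ satisfies $$\int_DK(\mathbf{x},\mathbf{x})\,\varrho_D(\mathrm{d}\mathbf{x})<\infty.$$ For $n\in\mathbb{N}$ and $\delta\in(0,1/3)$ put $$m:=\left\lfloor\frac{n}{96(\sqrt{2}\log(2n)-\log\delta)}\right\rfloor,$$ and assume that $n$ is large enough that $m\ge2$. Let the $n$ nodes of $\mathbf{X}=(\mathbf{x}^1,\dots,\mathbf{x}^n)$ be drawn i.i.d. according to the probability measure $\mu_m$ on $D$ given by $\mu_m(A)=\int_A\varrho_m(\mathbf{x})\,\varrho_D(\mathrm{d}\mathbf{x})$ with $$\varrho_m(\mathbf{x}):=\frac12\Bigg(\frac{1}{m-1}\sum_{j=1}^{m-1}|\eta_j(\mathbf{x})|^2+\Big(\sum_{j=m}^\infty\lambda_j\Big)^{-1}\Big(K(\mathbf{x},\mathbf{x})-\sum_{j=1}^{m-1}|e_j(\mathbf{x})|^2\Big)\Bigg).$$ Then the weighted least squares reconstruction operator $\widetilde{S}^m_{\mathbf{X}}$ satisfies $$\mathbb{P}\left(\sup_{\|f\|_{H(K)}\le1}\|f-\widetilde{S}^m_{\mathbf{X}}f\|^2_{L_2(D,\varrho_D)}\le\frac{50}{\delta}\max\Big\{\sigma_m^2,\frac{\log(8n)}{n}\sum_{j=m}^\infty\sigma_j^2\Big\}\r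ight)\ge1-3\delta.$$
   Context: $\log$ is the natural logarithm. $H(K)$ is the Hilbert space with $f(\mathbf{x})=\langle f,K(\cdot,\mathbf{x})\rangle_{H(K)}$; its elements are assumed measurable so that the embedding $\mathrm{Id}:H(K)\to L_2(D,\varrho_D)$ is defined (it is compact under the assumptions). Standing assumption: $H(K)$ is infinite dimensional. $\lambda_1\ge\lambda_2\ge\dots>0$ denote the positive eigenvalues of $\mathrm{Id}^*\circ\mathrm{Id}:H(K)\to H(K)$ (an infinite sequence, as in the paper's notation), $(e_k)_{k\in\mathbb{N}}$ the corresponding eigenfunctions, orthonormal in $H(K)$, and $\sigma_k:=\sqrt{\lambda_k}$ the singular numbers of $\mathrm{Id}$. Put $\eta_k:=\lambda_k^{-1/2}e_k$; $(\eta_k)_k$ is orthonormal in $L_2(D,\varrho_D)$. Weighted least squares operator: for nodes $\mathbf{X}=(\mathbf{x}^1,\dots,\mathbf{x}^n)$ let $\widetilde{\mathbf{L}}_m=(l_{k,j})\in\mathbb{C}^{n\times(m-1)}$ with $l_{k,j}:=\eta_j(\mathbf{x}^k)/\sqrt{\varrho_m(\mathbf{x}^k)}$ if $\varrho_m(\mathbf{x}^k)\ne0$ and $l_{k,j}:=0$ otherwise, and let $\mathbf{g}=(g_k)_{k=1}^n$ with $g_k:=f(\mathbf{x}^k)/\sqrt{\varrho_m(\mathbf{x}^k)}$ if $\varrho_m(\mathbf{x}^k)\neq0$ and $g_k:=0$ otherwise. If $\widetilde{\mathbf{L}}_m$ has full column rank, set $(\tilde c_1,\dots,\tilde c_{m-1})^\top:=(\widetilde{\mathbf{L}}_m^*\widetilde{\mathbf{L}}_m)^{-1}\widetilde{\mathbf{L}}_m^*\mathbf{g}$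 and $\widetilde{S}^m_{\mathbf{X}}f:=\sum_{j=1}^{m-1}\tilde c_j\eta_j$. The event in the probability is understood to include that $\widetilde{\mathbf{L}}_m$ has full column rank. *)

theory Defs
  imports
    "HOL-Probability.Probability"
    "HOL-Library.Function_Algebras"
    "Jordan_Normal_Form.Gauss_Jordan_Elimination"
    "Jordan_Normal_Form.Schur_Decomposition"
    "Jordan_Normal_Form.DL_Rank"
begin

definition fscale :: "complex \<Rightarrow> ('a \<Rightarrow> complex) \<Rightarrow> 'a \<Rightarrow> complex" where
  "fscale c f = (\<lambda>x. c * f x)"

interpretation cfun: vector_space "fscale :: complex \<Rightarrow> ('a \<Rightarrow> complex) \<Rightarrow> 'a \<Rightarrow> complex"
  by unfold_locales (auto simp: fscale_def fun_eq_iff algebra_simps)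

text \<open>Functions on a set \<open>D\<close> are total functions that vanish outside \<open>D\<close>, so that HOL equality of
  such functions is equality on \<open>D\<close>. Inner products are linear in the first argument.
  A Hilbert space of functions is given by its carrier \<open>H\<close> and its inner product \<open>ip\<close>, whose
  values are only relevant on \<open>H\<close>.\<close>

definition hnorm :: "(('a \<Rightarrow> complex) \<Rightarrow> ('a \<Rightarrow> complex) \<Rightarrow> complex) \<Rightarrow> ('a \<Rightarrow> complex) \<Rightarrow> real" where
  "hnorm ip f = sqrt (Re (ip f f))"

definition kernel_section :: "'a set \<Rightarrow> ('a \<Rightarrow> 'a \<Rightarrow> complex) \<Rightarrow> 'a \<Rightarrow> 'a \<Rightarrow> complex" where
  "kernel_section D K x = (\<lambda>y. if y \<in> D then K y x else 0)"

definition positive_semidefinite_kernel :: "'a set \<Rightarrow> ('a \<Rightarrow> 'a \<Rightarrow> complex) \<Rightarrow> bool" where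
  "positive_semidefinite_kernel D K \<longleftrightarrow>
    (\<forall>F c. finite F \<and> F \<subseteq> D \<longrightarrow> (\<Sum>x\<in>F. \<Sum>y\<in>F. cnj (c x) * c y * K x y) \<in> \<real>\<^sub>\<ge>\<^sub>0)"

locale function_hilbert_space =
  fixes D :: "'a set"
    and H :: "('a \<Rightarrow> complex) set"
    and ip :: "('a \<Rightarrow> complex) \<Rightarrow> ('a \<Rightarrow> complex) \<Rightarrow> complex"
  assumes vanish_outside: "\<And>f x. f \<in> H \<Longrightarrow> x \<notin> D \<Longrightarrow> f x = 0"
    and subspace: "cfun.subspace H"
    and ip_add_left: "\<And>f g h. f \<in> H \<Longrightarrow> g \<in> H \<Longrightarrow> h \<in> H \<Longrightarrow> ip (f + g) h = ip f h + ip g h"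
    and ip_scale_left: "\<And>c f g. f \<in> H \<Longrightarrow> g \<in> H \<Longrightarrow> ip (fscale c f) g = c * ip f g"
    and ip_commute: "\<And>f g. f \<in> H \<Longrightarrow> g \<in> H \<Longrightarrow> ip g f = cnj (ip f g)"
    and ip_pos: "\<And>f. f \<in> H \<Longrightarrow> f \<noteq> 0 \<Longrightarrow> 0 < Re (ip f f)"
    and complete: "\<And>s :: nat \<Rightarrow> 'a \<Rightarrow> complex.
      (\<forall>i. s i \<in> H) \<Longrightarrow> (\<forall>\<epsilon>>0. \<exists>N. \<forall>i\<ge>N. \<forall>j\<ge>N. hnorm ip (s i - s j) < \<epsilon>) \<Longrightarrow>
      \<exists>f\<in>H. (\<lambda>i. hnorm ip (s i - f)) \<longlonglongrightarrow> 0"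

locale reproducing_kernel_hilbert_space = function_hilbert_space D H ip
  for D :: "'a set" and K :: "'a \<Rightarrow> 'a \<Rightarrow> complex" and H ip +
  assumes section_in: "\<And>x. x \<in> D \<Longrightarrow> kernel_section D K x \<in> H"
    and reproducing: "\<And>f x. f \<in> H \<Longrightarrow> x \<in> D \<Longrightarrow> f x = ip f (kernel_section D K x)"

definition separable_hilbert ::
    "('a \<Rightarrow> complex) set \<Rightarrow> (('a \<Rightarrow> complex) \<Rightarrow> ('a \<Rightarrow> complex) \<Rightarrow> complex) \<Rightarrow> bool" where
  "separable_hilbert H ip \<longleftrightarrow>
    (\<exists>C. countable C \<and> C \<subseteq> H \<and> (\<forall>f\<in>H. \<forall>\<epsilon>>0. \<exists>g\<in>C. hnorm ip (f - g) < \<epsilon>))"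

definition infinite_dimensional :: "('a \<Rightarrow> complex) set \<Rightarrow> bool" where
  "infinite_dimensional H \<longleftrightarrow> \<not> (\<exists>B. finite B \<and> H \<subseteq> cfun.span B)"

definition L2_inner :: "'a measure \<Rightarrow> ('a \<Rightarrow> complex) \<Rightarrow> ('a \<Rightarrow> complex) \<Rightarrow> complex" where
  "L2_inner M f g = (LINT x|M. f x * cnj (g x))"

definition L2_norm_sq :: "'a measure \<Rightarrow> ('a \<Rightarrow> complex) \<Rightarrow> ennreal" where
  "L2_norm_sq M f = (\<integral>\<^sup>+x. ennreal ((cmod (f x))\<^sup>2) \<partial>M)"

text \<open>The adjoint \<open>Id\<^sup>* : L\<^sub>2(M) \<rightarrow> H\<close> of the embedding \<open>Id : H \<rightarrow> L\<^sub>2(M)\<close>: the unique \<open>u \<in> H\<close> with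
  \<open>\<langle>u, h\<rangle> = \<langle>g, Id h\<rangle>\<close> for all \<open>h \<in> H\<close>. As \<open>Id\<close> maps a function to itself (up to null sets),
  \<open>Id\<^sup>* \<circ> Id\<close> is the restriction of this map to \<open>H\<close>.\<close>

definition embedding_adjoint ::
    "'a measure \<Rightarrow> ('a \<Rightarrow> complex) set \<Rightarrow> (('a \<Rightarrow> complex) \<Rightarrow> ('a \<Rightarrow> complex) \<Rightarrow> complex)
      \<Rightarrow> ('a \<Rightarrow> complex) \<Rightarrow> 'a \<Rightarrow> complex" where
  "embedding_adjoint M H ip g = (THE u. u \<in> H \<and> (\<forall>h\<in>H. ip u h = L2_inner M g h))"

text \<open>\<open>(lam k, e k)\<close>, \<open>k \<ge> 1\<close>, is the sequence of positive eigenvalues of \<open>Id\<^sup>* \<circ> Id\<close> in nonincreasing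
  order, each repeated according to its multiplicity, with \<open>H\<close>-orthonormal eigenfunctions; the last
  conjunct says that no positive eigenvalue and no part of its eigenspace is left out.
  The values at index \<open>0\<close> are irrelevant.\<close>

definition positive_eigensystem ::
    "'a measure \<Rightarrow> ('a \<Rightarrow> complex) set \<Rightarrow> (('a \<Rightarrow> complex) \<Rightarrow> ('a \<Rightarrow> complex) \<Rightarrow> complex)
      \<Rightarrow> (nat \<Rightarrow> real) \<Rightarrow> (nat \<Rightarrow> 'a \<Rightarrow> complex) \<Rightarrow> bool" where
  "positive_eigensystem M H ip lam e \<longleftrightarrow>
    (\<forall>k\<ge>1. lam k > 0 \<and> lam (Suc k) \<le> lam k) \<and>
    (\<forall>k\<ge>1. e k \<in> H \<and> embedding_adjoint M H ip (e k) = fscale (complex_of_real (lam k)) (e k)) \<and>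
    (\<forall>j\<ge>1. \<forall>k\<ge>1. ip (e j) (e k) = (if j = k then 1 else 0)) \<and>
    (\<forall>\<mu>>0. \<forall>f\<in>H. embedding_adjoint M H ip f = fscale (complex_of_real \<mu>) f \<longrightarrow>
       f \<in> cfun.span {e k |k. k \<ge> 1 \<and> lam k = \<mu>})"

definition sing_num :: "(nat \<Rightarrow> real) \<Rightarrow> nat \<Rightarrow> real" where
  "sing_num lam k = sqrt (lam k)"

definition eta :: "(nat \<Rightarrow> real) \<Rightarrow> (nat \<Rightarrow> 'a \<Rightarrow> complex) \<Rightarrow> nat \<Rightarrow> 'a \<Rightarrow> complex" where
  "eta lam e k = fscale (complex_of_real (1 / sqrt (lam k))) (e k)"

definition sampling_density ::
    "('a \<Rightarrow> 'a \<Rightarrow> complex) \<Rightarrow> (nat \<Rightarrow> real) \<Rightarrow> (nat \<Rightarrow> 'a \<Rightarrow> complex) \<Rightarrow> nat \<Rightarrow> 'a \<Rightarrow> real" where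
  "sampling_density K lam e m x =
    1 / 2 * (1 / (real m - 1) * (\<Sum>j=1..m-1. (cmod (eta lam e j x))\<^sup>2)
      + inverse (\<Sum>j. lam (m + j)) * (Re (K x x) - (\<Sum>j=1..m-1. (cmod (e j x))\<^sup>2)))"

definition sampling_measure ::
    "'a measure \<Rightarrow> ('a \<Rightarrow> 'a \<Rightarrow> complex) \<Rightarrow> (nat \<Rightarrow> real) \<Rightarrow> (nat \<Rightarrow> 'a \<Rightarrow> complex) \<Rightarrow> nat \<Rightarrow> 'a measure"
  where
  "sampling_measure M K lam e m = density M (\<lambda>x. ennreal (sampling_density K lam e m x))"

text \<open>Matrices and vectors of \<open>Jordan_Normal_Form\<close> are indexed from \<open>0\<close>: row \<open>k < n\<close> belongs to the
  node \<open>X k\<close> and column \<open>j < m - 1\<close> to the function \<open>\<eta> (j + 1)\<close>. The argument \<open>\<rho>\<close> is the density and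
  \<open>\<eta>\<close> the orthonormal system.\<close>

definition wls_matrix ::
    "('a \<Rightarrow> real) \<Rightarrow> (nat \<Rightarrow> 'a \<Rightarrow> complex) \<Rightarrow> nat \<Rightarrow> nat \<Rightarrow> (nat \<Rightarrow> 'a) \<Rightarrow> complex Matrix.mat" where
  "wls_matrix \<rho> \<eta> n m X = Matrix.mat n (m - 1)
    (\<lambda>(k, j). if \<rho> (X k) \<noteq> 0 then \<eta> (Suc j) (X k) / complex_of_real (sqrt (\<rho> (X k))) else 0)"

definition wls_data ::
    "('a \<Rightarrow> real) \<Rightarrow> nat \<Rightarrow> (nat \<Rightarrow> 'a) \<Rightarrow> ('a \<Rightarrow> complex) \<Rightarrow> complex Matrix.vec" where
  "wls_data \<rho> n X f = Matrix.vec n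
    (\<lambda>k. if \<rho> (X k) \<noteq> 0 then f (X k) / complex_of_real (sqrt (\<rho> (X k))) else 0)"

definition full_column_rank :: "complex Matrix.mat \<Rightarrow> bool" where
  "full_column_rank A \<longleftrightarrow> vec_space.rank (dim_row A) A = dim_col A"

definition wls_coeffs ::
    "('a \<Rightarrow> real) \<Rightarrow> (nat \<Rightarrow> 'a \<Rightarrow> complex) \<Rightarrow> nat \<Rightarrow> nat \<Rightarrow> (nat \<Rightarrow> 'a) \<Rightarrow> ('a \<Rightarrow> complex)
      \<Rightarrow> complex Matrix.vec" where
  "wls_coeffs \<rho> \<eta> n m X f =
    (let L = wls_matrix \<rho> \<eta> n m X
     in (the (mat_inverse (mat_adjoint L * L)) * mat_adjoint L) *\<^sub>v wls_data \<rho> n X f)"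

definition wls_operator ::
    "('a \<Rightarrow> real) \<Rightarrow> (nat \<Rightarrow> 'a \<Rightarrow> complex) \<Rightarrow> nat \<Rightarrow> nat \<Rightarrow> (nat \<Rightarrow> 'a) \<Rightarrow> ('a \<Rightarrow> complex)
      \<Rightarrow> 'a \<Rightarrow> complex" where
  "wls_operator \<rho> \<eta> n m X f =
    (\<lambda>x. \<Sum>j<m-1. vec_index (wls_coeffs \<rho> \<eta> n m X f) j * \<eta> (Suc j) x)"

end

theory Submission
  imports Defs
begin

text \<open>
  Let \<open>f\<^sub>m\<close> be the orthogonal projection of \<open>f\<close> to the span of \<open>e\<^sub>1, \<dots>, e\<^sub>m\<^sub>-\<^sub>1\<close>. It is at most \<open>\<sigma>\<^sub>m |f|\<close> away
  from \<open>f\<close> in \<open>L\<^sub>2\<close> (\<open>residual_l2_le\<close>). Least squares reproduces the functions in this span, so the rest of the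
  error comes from the residual \<open>f - f\<^sub>m\<close> in the data. It is small if the design matrix \<open>L\<close> satisfies
  \<open>L\<^sup>* L \<ge> n/4\<close> and the weighted values of \<open>f - f\<^sub>m\<close> at the nodes have a small sum of squares \<open>u\<close>: the
  squared error is then at most \<open>2 \<sigma>\<^sub>m\<^sup>2 + 8 u / n\<close> on the unit ball (\<open>reconstruction_error_le\<close>).

  Both conditions concern sums of independent rank-one operators \<open>Y = y y\<^sup>*\<close> with bounded \<open>|y|\<^sup>2 \<le> R\<close>. For the
  first condition \<open>y\<close> consists of the weighted values of \<open>\<eta>\<^sub>1, \<dots>, \<eta>\<^sub>m\<^sub>-\<^sub>1\<close> at a node; the first half of the
  density gives \<open>R = 2 (m - 1)\<close>, and the mean of \<open>Y\<close> is the identity. For the second one \<open>y\<close> consists of the weighted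
  values of \<open>e\<^sub>m, e\<^sub>m\<^sub>+\<^sub>1, \<dots>\<close>; the other half gives \<open>R = 2 (\<lambda>\<^sub>m + \<lambda>\<^sub>m\<^sub>+\<^sub>1 + \<dots>)\<close>, and the mean of \<open>Y\<close> is diagonal with
  entries \<open>\<lambda>\<^sub>m, \<lambda>\<^sub>m\<^sub>+\<^sub>1, \<dots>\<close>.

  Such a sum \<open>W\<close>, centred in the first case, is controlled by the moments \<open>E (tr W\<^sup>2\<^sup>p)\<close> with \<open>p\<close> of
  logarithmic order and Markov's inequality (\<open>sample_gram_lower_bound\<close>, \<open>sample_gram_upper_bound\<close>). The
  moments obey a recursion: one factor of \<open>W\<^sup>2\<^sup>s\<^sup>+\<^sup>2\<close> is expanded into its summands, and from the other factors
  \<open>W\<^sup>2\<^sup>s\<^sup>+\<^sup>1\<close> the same summand is removed, which makes the two parts independent. The price of the removal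
  is bounded by an elementary trace inequality (\<open>mean_value_trace_inequality\<close>), an operator version of
  the bound for the mean of the convex function \<open>x\<^sup>2\<^sup>s\<close> on an interval by its end values. The upper bound must not
  depend on the number of functions, which is infinite; there the trace of the covariance takes the place
  of the dimension.

  The passage from \<open>H\<close> to these vectors needs that the positive eigenfunctions exhaust \<open>H\<close> up to
  functions of \<open>L\<^sub>2\<close> norm zero, which follows from compactness (\<open>perp_l2_norm_sq_eq_0\<close>), and that almost
  all points are zeros of all these null functions at once, which follows from separability
  (\<open>AE_vanishing_point\<close>). As a consequence \<open>K(x, x)\<close> is the sum of the \<open>|e\<^sub>k(x)|\<^sup>2\<close> for almost all \<open>x\<close>, the
  trace of the kernel is the sum of the eigenvalues, the density has integral one, and at almost all nodes
  \<open>f - f\<^sub>m\<close> is the sum of its expansion.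

  Finally the set of good nodes is measurable. Full rank means that the Gram determinant does not vanish,
  and the supremum over the unit ball is a supremum over a countable set, because the error is lower
  semicontinuous under pointwise convergence (\<open>success_event_measurable\<close>).
\<close>

section \<open>Operators and traces\<close>

text \<open>Operators act on all complex sequences. In this way one type, which is a ring, serves every
  dimension, and the powers, sums and distributive laws of the type class apply to it. The dimension
  \<open>d\<close> enters through the sequences supported below \<open>d\<close> and through the trace of the leading block.\<close>
typedef linop = "{f :: (nat \<Rightarrow> complex) \<Rightarrow> nat \<Rightarrow> complex.
    (\<forall>u v. f (\<lambda>i. u i + v i) = (\<lambda>i. f u i + f v i)) \<and> (\<forall>c u. f (\<lambda>i. c * u i) = (\<lambda>i. c * f u i))}"
  morphisms app Linop
  by (rule exI[of _ "\<lambda>u. u"]) simp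

setup_lifting type_definition_linop

instantiation linop :: ring_1
begin
lift_definition zero_linop :: linop is "\<lambda>u i. 0" by simp
lift_definition one_linop :: linop is "\<lambda>u. u" by simp
lift_definition plus_linop :: "linop \<Rightarrow> linop \<Rightarrow> linop" is "\<lambda>f g u i. f u i + g u i"
  by (simp add: algebra_simps)
lift_definition minus_linop :: "linop \<Rightarrow> linop \<Rightarrow> linop" is "\<lambda>f g u i. f u i - g u i"
  by (simp add: algebra_simps)
lift_definition uminus_linop :: "linop \<Rightarrow> linop" is "\<lambda>f u i. - f u i"
  by (simp add: algebra_simps)
lift_definition times_linop :: "linop \<Rightarrow> linop \<Rightarrow> linop" is "\<lambda>f g u. f (g u)"
  by simp
instance
proof
  fix a b c :: linop
  show "a * b * c = a * (b * c)" by transfer simp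
  show "(a + b) * c = a * c + b * c" by transfer simp
  show "a * (b + c) = a * b + a * c" by transfer simp
  show "a + b + c = a + (b + c)" by transfer (simp add: add.assoc)
  show "a + b = b + a" by transfer (simp add: add.commute)
  show "0 + a = a" by transfer simp
  show "- a + a = 0" by transfer simp
  show "a - b = a + - b" by transfer simp
  show "1 * a = a" by transfer simp
  show "a * 1 = a" by transfer simp
  show "0 \<noteq> (1::linop)" 
  proof (transfer, rule notI)
    assume "(\<lambda>u i. 0) = (\<lambda>u :: nat \<Rightarrow> complex. u)"
    from arg_cong[OF this, of "\<lambda>f. f (\<lambda>_. 1) 0"] show False by simp
  qed
qed
end

lemma app_add: "app A (\<lambda>i. u i + v i) = (\<lambda>i. app A u i + app A v i)" by transfer simp
lemma app_scale: "app A (\<lambda>i. c * u i) = (\<lambda>i. c * app A u i)" by transfer simp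
lemma app_zero_vec: "app A (\<lambda>i. 0) = (\<lambda>i. 0)" using app_scale[of A 0 "\<lambda>_. 0"] by simp
lemma app_sum: "finite S \<Longrightarrow> app A (\<lambda>i. \<Sum>j\<in>S. u j i) = (\<lambda>i. \<Sum>j\<in>S. app A (u j) i)"
  by (induction S rule: finite_induct) (simp_all add: app_zero_vec app_add)
lemma app_plus [simp]: "app (A + B) u i = app A u i + app B u i" by transfer simp
lemma app_minus [simp]: "app (A - B) u i = app A u i - app B u i" by transfer simp
lemma app_times [simp]: "app (A * B) u = app A (app B u)" by transfer simp
lemma app_zero [simp]: "app 0 u i = 0" by transfer simp
lemma app_one [simp]: "app 1 u = u" by transfer simp

definition supp_below :: "nat \<Rightarrow> (nat \<Rightarrow> complex) \<Rightarrow> bool" where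
  "supp_below d v \<longleftrightarrow> (\<forall>i\<ge>d. v i = 0)"
definition unit_vector :: "nat \<Rightarrow> nat \<Rightarrow> complex" where
  "unit_vector j i = (if i = j then 1 else 0)"
definition preserves :: "nat \<Rightarrow> linop \<Rightarrow> bool" where
  "preserves d A \<longleftrightarrow> (\<forall>v. supp_below d v \<longrightarrow> supp_below d (app A v))"
definition entry :: "linop \<Rightarrow> nat \<Rightarrow> nat \<Rightarrow> complex" where
  "entry A i j = app A (unit_vector j) i"
definition tr :: "nat \<Rightarrow> linop \<Rightarrow> complex" where
  "tr d A = (\<Sum>i<d. entry A i i)"

text \<open>The adjoint is a relation: a linear map on all sequences may have no adjoint, and only the leading
  \<open>d \<times> d\<close> block matters.\<close>
definition adjoint_pair :: "nat \<Rightarrow> linop \<Rightarrow> linop \<Rightarrow> bool" where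
  "adjoint_pair d A A' \<longleftrightarrow> preserves d A \<and> preserves d A' \<and>
     (\<forall>i<d. \<forall>j<d. entry A' i j = cnj (entry A j i))"
abbreviation hermitian_on :: "nat \<Rightarrow> linop \<Rightarrow> bool" where
  "hermitian_on d A \<equiv> adjoint_pair d A A"

lemma app_eq_entries:
  assumes "supp_below d v"
  shows "app A v i = (\<Sum>j<d. entry A i j * v j)"
proof -
  have "v = (\<lambda>i. \<Sum>j<d. v j * unit_vector j i)"
  proof
    fix i show "v i = (\<Sum>j<d. v j * unit_vector j i)"
    proof (cases "i < d")
      case True
      then have "(\<Sum>j<d. v j * unit_vector j i) = (\<Sum>j\<in>{i}. v j * unit_vector j i)"
        by (intro sum.mono_neutral_right) (auto simp: unit_vector_def)
      then show ?thesis by (simp add: unit_vector_def)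
    next
      case False
      then show ?thesis using assms by (auto simp: supp_below_def unit_vector_def intro!: sum.neutral[symmetric])
    qed
  qed
  then have "app A v i = app A (\<lambda>i. \<Sum>j<d. v j * unit_vector j i) i" by (rule arg_cong)
  also have "\<dots> = (\<Sum>j<d. entry A i j * v j)"
    by (subst app_sum) (auto simp: app_scale entry_def mult.commute)
  finally show ?thesis .
qed

lemma supp_below_unit: "j < d \<Longrightarrow> supp_below d (unit_vector j)"
  by (auto simp: supp_below_def unit_vector_def)

lemma entry_plus [simp]: "entry (A + B) i j = entry A i j + entry B i j" by (simp add: entry_def)
lemma entry_minus [simp]: "entry (A - B) i j = entry A i j - entry B i j" by (simp add: entry_def)
lemma entry_zero [simp]: "entry 0 i j = 0" by (simp add: entry_def)
lemma entry_one: "entry 1 i j = (if i = j then 1 else 0)" by (simp add: entry_def unit_vector_def)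
lemma entry_sum: "entry (\<Sum>k\<in>S. A k) i j = (\<Sum>k\<in>S. entry (A k) i j)"
  by (induction S rule: infinite_finite_induct) simp_all
lemma entry_times:
  assumes "preserves d B" "j < d"
  shows "entry (A * B) i j = (\<Sum>k<d. entry A i k * entry B k j)"
proof -
  have "supp_below d (app B (unit_vector j))"
    using assms supp_below_unit by (auto simp: preserves_def)
  from app_eq_entries[OF this, of A i] show ?thesis by (simp add: entry_def)
qed

lemma preserves_plus [intro!]: "preserves d A \<Longrightarrow> preserves d B \<Longrightarrow> preserves d (A + B)"
  by (auto simp: preserves_def supp_below_def)
lemma preserves_minus [intro!]: "preserves d A \<Longrightarrow> preserves d B \<Longrightarrow> preserves d (A - B)"
  by (auto simp: preserves_def supp_below_def)
lemma preserves_times [intro!]: "preserves d A \<Longrightarrow> preserves d B \<Longrightarrow> preserves d (A * B)"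
  by (auto simp: preserves_def)
lemma preserves_one [intro!]: "preserves d 1" by (auto simp: preserves_def)
lemma preserves_zero [intro!]: "preserves d 0" by (auto simp: preserves_def supp_below_def)
lemma preserves_power [intro!]: "preserves d A \<Longrightarrow> preserves d (A ^ k)"
  by (induction k) auto
lemma preserves_sum [intro!]: "(\<And>k. k \<in> S \<Longrightarrow> preserves d (A k)) \<Longrightarrow> preserves d (\<Sum>k\<in>S. A k)"
  by (induction S rule: infinite_finite_induct) auto

lemma tr_plus: "tr d (A + B) = tr d A + tr d B" by (simp add: tr_def sum.distrib)
lemma tr_minus: "tr d (A - B) = tr d A - tr d B" by (simp add: tr_def sum_subtractf)
lemma tr_sum: "tr d (\<Sum>k\<in>S. A k) = (\<Sum>k\<in>S. tr d (A k))"
  unfolding tr_def entry_sum by (rule sum.swap)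

lemma tr_times:
  assumes "preserves d B" shows "tr d (A * B) = (\<Sum>i<d. \<Sum>j<d. entry A i j * entry B j i)"
  using assms by (simp add: tr_def entry_times)

lemma tr_commute:
  assumes "preserves d A" "preserves d B" shows "tr d (A * B) = tr d (B * A)"
  by (simp add: tr_times assms mult.commute) (rule sum.swap)

lemma adjoint_pair_preserves:
  assumes "adjoint_pair d A A'" shows "preserves d A" "preserves d A'"
  using assms by (auto simp: adjoint_pair_def)
lemma adjoint_pair_times [intro]:
  "adjoint_pair d A A' \<Longrightarrow> adjoint_pair d B B' \<Longrightarrow> adjoint_pair d (A * B) (B' * A')"
  by (auto simp: adjoint_pair_def entry_times mult.commute)
lemma adjoint_pair_plus [intro]:
  "adjoint_pair d A A' \<Longrightarrow> adjoint_pair d B B' \<Longrightarrow> adjoint_pair d (A + B) (A' + B')"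
  by (auto simp: adjoint_pair_def)
lemma adjoint_pair_minus [intro]:
  "adjoint_pair d A A' \<Longrightarrow> adjoint_pair d B B' \<Longrightarrow> adjoint_pair d (A - B) (A' - B')"
  by (auto simp: adjoint_pair_def)
lemma hermitian_on_one [intro]: "hermitian_on d 1"
  by (auto simp: adjoint_pair_def entry_one)
lemma hermitian_on_zero [intro]: "hermitian_on d 0"
  by (auto simp: adjoint_pair_def)
lemma hermitian_on_power [intro]: "hermitian_on d A \<Longrightarrow> hermitian_on d (A ^ k)"
proof (induction k)
  case (Suc k)
  then have "adjoint_pair d (A * A ^ k) (A ^ k * A)" by (intro adjoint_pair_times)
  then show ?case by (simp add: power_commutes)
qed auto
lemma hermitian_on_sum [intro]: "(\<And>k. k \<in> S \<Longrightarrow> hermitian_on d (A k)) \<Longrightarrow> hermitian_on d (\<Sum>k\<in>S. A k)"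
  by (induction S rule: infinite_finite_induct) auto

lemma tr_adjoint_times:
  assumes "adjoint_pair d X X'" "adjoint_pair d Z Z'"
  shows "tr d (X' * Z) = (\<Sum>i<d. \<Sum>j<d. cnj (entry X j i) * entry Z j i)"
  using assms by (simp add: tr_times adjoint_pair_def)

lemma Re_tr_square:
  assumes "adjoint_pair d X X'"
  shows "Re (tr d (X' * X)) = (\<Sum>i<d. \<Sum>j<d. (cmod (entry X j i))\<^sup>2)"
proof -
  have "tr d (X' * X) = (\<Sum>i<d. \<Sum>j<d. cnj (entry X j i) * entry X j i)"
    using tr_adjoint_times[OF assms assms] .
  also have "\<dots> = of_real (\<Sum>i<d. \<Sum>j<d. (cmod (entry X j i))\<^sup>2)"
    by (simp only: of_real_sum complex_norm_square mult.commute)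
  finally show ?thesis by simp
qed

lemma Re_tr_square_nonneg: "adjoint_pair d X X' \<Longrightarrow> 0 \<le> Re (tr d (X' * X))"
  by (simp add: Re_tr_square sum_nonneg)

lemma Re_tr_power_even_nonneg: "hermitian_on d A \<Longrightarrow> 0 \<le> Re (tr d (A ^ (2 * k)))"
  using Re_tr_square_nonneg[of d "A ^ k" "A ^ k"] hermitian_on_power[of d A k]
  by (simp add: power_add[symmetric] mult_2)

section \<open>Trace inequalities\<close>

lemma weighted_AMGM_complex:
  assumes "a > (0::real)"
  shows "2 * Re (cnj x * z) \<le> a * (cmod x)\<^sup>2 + (cmod z)\<^sup>2 / a"
proof -
  have "2 * (cmod x * cmod z) \<le> a * (cmod x)\<^sup>2 + (cmod z)\<^sup>2 / a"
  proof -
    have "0 \<le> (a * cmod x - cmod z)\<^sup>2 / a" using assms by simp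
    also have "\<dots> = a * (cmod x)\<^sup>2 + (cmod z)\<^sup>2 / a - 2 * (cmod x * cmod z)"
      using assms by (simp add: field_simps power2_eq_square)
    finally show ?thesis by simp
  qed
  moreover have "Re (cnj x * z) \<le> cmod x * cmod z"
    using complex_Re_le_cmod[of "cnj x * z"] by (simp add: norm_mult)
  ultimately show ?thesis by linarith
qed

text \<open>\<open>tr (X' Z)\<close> is the entrywise inner product of the blocks of \<open>X\<close> and \<open>Z\<close>.\<close>
lemma tr_AMGM:
  assumes "adjoint_pair d X X'" "adjoint_pair d Z Z'" "a > 0"
  shows "2 * Re (tr d (X' * Z)) \<le> a * Re (tr d (X' * X)) + Re (tr d (Z' * Z)) / a"
proof -
  have "2 * Re (tr d (X' * Z)) = (\<Sum>i<d. \<Sum>j<d. 2 * Re (cnj (entry X j i) * entry Z j i))"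
    unfolding tr_adjoint_times[OF assms(1,2)] Re_sum by (simp only: sum_distrib_left)
  also have "\<dots> \<le> (\<Sum>i<d. \<Sum>j<d. a * (cmod (entry X j i))\<^sup>2 + (cmod (entry Z j i))\<^sup>2 / a)"
    by (intro sum_mono weighted_AMGM_complex assms)
  also have "\<dots> = a * Re (tr d (X' * X)) + Re (tr d (Z' * Z)) / a"
    by (simp add: Re_tr_square[OF assms(1)] Re_tr_square[OF assms(2)] sum.distrib sum_distrib_left sum_divide_distrib)
  finally show ?thesis .
qed

text \<open>The odd powers of a Hermitian operator have no sign; this bounds them by the neighbouring even
  ones.\<close>
lemma tr_odd_power_AMGM:
  assumes "hermitian_on d A" "a > 0"
  shows "2 * Re (tr d (A ^ (2 * s+1))) \<le> a * Re (tr d (A ^ (2 * s))) + Re (tr d (A ^ (2 * s+2))) / a"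
proof -
  have "2 * Re (tr d (A^s * A^(s+1))) \<le> a * Re (tr d (A^s * A^s)) + Re (tr d (A^(s+1) * A^(s+1))) / a"
    using assms by (intro tr_AMGM hermitian_on_power)
  moreover have "s + (s + 1) = 2 * s + 1" "s + s = 2 * s" "s + 1 + (s + 1) = 2 * s + 2" by auto
  ultimately show ?thesis by (simp only: power_add[symmetric])
qed

lemma power_diff_telescope:
  fixes A B :: "'a::ring_1"
  shows "A ^ q - B ^ q = (\<Sum>i<q. A ^ i * (A - B) * B ^ (q - 1 - i))"
proof (induction q)
  case (Suc q)
  have "A ^ Suc q - B ^ Suc q = (A ^ q - B ^ q) * B + A ^ q * (A - B)"
    by (simp add: algebra_simps power_commutes)
  also have "(A ^ q - B ^ q) * B = (\<Sum>i<q. A ^ i * (A - B) * B ^ (q - i))"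
    unfolding Suc sum_distrib_right
  proof (rule sum.cong[OF refl])
    fix i assume "i \<in> {..<q}"
    then have "q - i = Suc (q - 1 - i)" by auto
    then show "A ^ i * (A - B) * B ^ (q - 1 - i) * B = A ^ i * (A - B) * B ^ (q - i)"
      by (simp only: power_Suc2 mult.assoc)
  qed
  finally show ?case by simp
qed simp

text \<open>At the even indices \<open>g\<close> is a convex sequence, so that \<open>g i + g (2s - i)\<close> is largest at the ends; at
  an odd index \<open>g\<close> lies below the mean of its two even neighbours. Hence the pairs \<open>i\<close>, \<open>2s - i\<close> give the
  bound. Convexity at all indices would be too much to ask: in the application below the midpoint
  inequality comes from the Cauchy-Schwarz inequality for vectors indexed by \<open>t \<le> s\<close> and \<open>u \<le> s\<close>.\<close>
lemma midpoint_convex_sum_le: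
  fixes g :: "nat \<Rightarrow> real"
  assumes mid: "\<And>t u. t \<le> s \<Longrightarrow> u \<le> s \<Longrightarrow> 2 * g (t + u) \<le> g (2 * t) + g (2 * u)"
  shows "2 * (\<Sum>i<2 * s+1. g i) \<le> (2 * real s + 1) * (g 0 + g (2 * s))"
proof -
  define a where "a t = g (2 * t)" for t
  define \<Delta> where "\<Delta> t = a (Suc t) - a t" for t
  have step: "\<Delta> t \<le> \<Delta> (Suc t)" if "Suc (Suc t) \<le> s" for t
  proof -
    have "t + Suc (Suc t) = 2 * Suc t" by simp
    moreover have "t \<le> s" using that by simp
    ultimately have "2 * g (2 * Suc t) \<le> g (2 * t) + g (2 * Suc (Suc t))"
      using mid[of t "Suc (Suc t)"] that by (simp only: simp_thms)
    then show ?thesis unfolding \<Delta>_def a_def by linarith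
  qed
  have mono: "\<Delta> t \<le> \<Delta> (t + k)" if "t + k < s" for t k
    using that
  proof (induction k)
    case (Suc k)
    then show ?case using step[of "t + k"] by simp
  qed simp
  have tele: "(\<Sum>i<k. \<Delta> (j + i)) = a (j + k) - a j" for j k
    by (induction k) (simp_all add: \<Delta>_def)
  have pair: "a t + a (s - t) \<le> a 0 + a s" if "t \<le> s" for t
  proof -
    have "a t - a 0 = (\<Sum>i<t. \<Delta> (0 + i))" using tele[where k=t and j=0] by simp
    also have "\<dots> \<le> (\<Sum>i<t. \<Delta> (s - t + i))"
    proof (rule sum_mono)
      fix i assume "i \<in> {..<t}"
      then show "\<Delta> (0 + i) \<le> \<Delta> (s - t + i)"
        using mono[of i "s - t"] that by (simp add: add.commute)
    qed
    also have "\<dots> = a s - a (s - t)" using tele[where k=t and j="s - t"] that by simp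
    finally show ?thesis by simp
  qed
  have sym: "g i + g (2 * s - i) \<le> g 0 + g (2 * s)" if "i \<le> 2 * s" for i
  proof (cases "even i")
    case True
    then obtain t where t: "i = 2 * t" by (auto elim: evenE)
    then show ?thesis using pair[of t] that by (simp add: a_def diff_mult_distrib2)
  next
    case False
    then obtain t where t: "i = 2 * t + 1" by (auto elim: oddE)
    then have ts: "Suc t \<le> s" using that by simp
    have "2 * g i \<le> a t + a (Suc t)"
    proof -
      have e: "i = t + Suc t" using t by simp
      show ?thesis using mid[of t "Suc t"] ts unfolding e a_def by simp
    qed
    moreover have "2 * g (2 * s - i) \<le> a (s - Suc t) + a (s - t)"
    proof -
      have e: "2 * s - i = (s - Suc t) + (s - t)" using t ts by simp
      show ?thesis using mid[of "s - Suc t" "s - t"] ts unfolding e a_def by simp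
    qed
    ultimately show ?thesis using pair[of t] pair[of "Suc t"] ts by (simp add: a_def)
  qed
  have "(\<Sum>i<2 * s+1. g i) = (\<Sum>i<2 * s+1. g (2 * s + 1 - Suc i))"
    by (rule sum.nat_diff_reindex[symmetric])
  also have "\<dots> = (\<Sum>i<2 * s+1. g (2 * s - i))" by simp
  finally have "(\<Sum>i<2 * s+1. g i) = (\<Sum>i<2 * s+1. g (2 * s - i))" .
  then have "2 * (\<Sum>i<2 * s+1. g i) = (\<Sum>i<2 * s+1. g i + g (2 * s - i))"
    by (simp add: sum.distrib)
  also have "\<dots> \<le> (\<Sum>i<2 * s+1. g 0 + g (2 * s))" by (intro sum_mono sym) auto
  finally show ?thesis by (simp add: algebra_simps)
qed

text \<open>For numbers this bounds the mean of the derivative of \<open>x\<^sup>2\<^sup>s\<^sup>+\<^sup>1\<close> between \<open>B\<close> and \<open>A\<close> by the average of its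
  end values, which is convexity. For operators put \<open>\<Delta> = A - B\<close> and \<open>g i = tr (\<Delta> A\<^sup>i \<Delta> B\<^sup>2\<^sup>s\<^sup>-\<^sup>i)\<close>. By
  telescoping, the left-hand side is the sum of the \<open>g i\<close> over \<open>i \<le> 2s\<close>. As \<open>g (t + u)\<close> is the trace
  inner product of \<open>A\<^sup>t \<Delta> B\<^sup>s\<^sup>-\<^sup>t\<close> and \<open>A\<^sup>u \<Delta> B\<^sup>s\<^sup>-\<^sup>u\<close>, the sequence \<open>g\<close> is midpoint convex.\<close>
lemma mean_value_trace_inequality:
  assumes A: "hermitian_on d A" and B: "hermitian_on d B"
  shows "Re (tr d ((A - B) * (A ^ (2 * s+1) - B ^ (2 * s+1)))) \<le>
    (2 * real s + 1) / 2 * (Re (tr d ((A - B) * (A - B) * A ^ (2 * s))) + Re (tr d ((A - B) * (A - B) * B ^ (2 * s))))"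
proof -
  define \<Delta> where "\<Delta> = A - B"
  have \<Delta>: "hermitian_on d \<Delta>" unfolding \<Delta>_def using A B by blast
  note pres = adjoint_pair_preserves(1)[OF A] adjoint_pair_preserves(1)[OF B] adjoint_pair_preserves(1)[OF \<Delta>]
  define g where "g i = Re (tr d (\<Delta> * (A ^ i * \<Delta> * B ^ (2 * s - i))))" for i
  define X where "X t = A ^ t * \<Delta> * B ^ (s - t)" for t
  define X' where "X' t = B ^ (s - t) * \<Delta> * A ^ t" for t
  have X: "adjoint_pair d (X t) (X' t)" for t
  proof -
    have "adjoint_pair d (A ^ t * \<Delta> * B ^ (s - t)) (B ^ (s - t) * (\<Delta> * A ^ t))"
      using A B \<Delta> by (intro adjoint_pair_times hermitian_on_power)
    then show ?thesis by (simp add: X_def X'_def mult.assoc)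
  qed
  have gX: "Re (tr d (X' t * X u)) = g (t + u)" if "t \<le> s" "u \<le> s" for t u
  proof -
    have "tr d (X' t * X u) = tr d (B ^ (s - t) * (\<Delta> * A ^ t * A ^ u * \<Delta> * B ^ (s - u)))"
      by (simp add: X_def X'_def mult.assoc)
    also have "\<dots> = tr d ((\<Delta> * A ^ t * A ^ u * \<Delta> * B ^ (s - u)) * B ^ (s - t))"
      using pres by (intro tr_commute) auto
    also have "(\<Delta> * A ^ t * A ^ u * \<Delta> * B ^ (s - u)) * B ^ (s - t)
        = \<Delta> * (A ^ (t + u) * \<Delta> * B ^ ((s - u) + (s - t)))"
      by (simp add: power_add mult.assoc)
    also have "(s - u) + (s - t) = 2 * s - (t + u)" using that by simp
    finally show ?thesis by (simp add: g_def)
  qed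
  have "2 * g (t + u) \<le> g (2 * t) + g (2 * u)" if "t \<le> s" "u \<le> s" for t u
    using tr_AMGM[OF X[of t] X[of u], of 1] gX[of t u] gX[of t t] gX[of u u] that by (simp flip: mult_2)
  from midpoint_convex_sum_le[of s g, OF this]
  have main: "2 * (\<Sum>i<2 * s+1. g i) \<le> (2 * real s + 1) * (g 0 + g (2 * s))" by simp
  have "Re (tr d (\<Delta> * (A ^ (2 * s+1) - B ^ (2 * s+1)))) = (\<Sum>i<2 * s+1. g i)"
    unfolding power_diff_telescope[of A "2 * s+1" B] \<Delta>_def[symmetric] sum_distrib_left tr_sum Re_sum
    by (simp add: g_def)
  moreover have "g 0 = Re (tr d (\<Delta> * \<Delta> * B ^ (2 * s)))" by (simp add: g_def mult.assoc)
  moreover have "g (2 * s) = Re (tr d (\<Delta> * \<Delta> * A ^ (2 * s)))"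
  proof -
    have "tr d (\<Delta> * (A ^ (2 * s) * \<Delta>)) = tr d ((A ^ (2 * s) * \<Delta>) * \<Delta>)"
      using pres by (intro tr_commute) auto
    also have "\<dots> = tr d (A ^ (2 * s) * (\<Delta> * \<Delta>))" by (simp add: mult.assoc)
    also have "\<dots> = tr d ((\<Delta> * \<Delta>) * A ^ (2 * s))" using pres by (intro tr_commute) auto
    finally show ?thesis by (simp add: g_def)
  qed
  moreover have "2 * x \<le> c * (a + b) \<Longrightarrow> x \<le> c / 2 * (b + a)" for x a b c :: real
    by (simp add: algebra_simps)
  ultimately show ?thesis using main by (simp only: \<Delta>_def)
qed

section \<open>Rank-one operators\<close>

lift_definition rank_one :: "nat \<Rightarrow> (nat \<Rightarrow> complex) \<Rightarrow> linop" is
  "\<lambda>d y v i. if i < d then y i * (\<Sum>j<d. cnj (y j) * v j) else 0"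
  by (auto simp: fun_eq_iff algebra_simps sum.distrib sum_distrib_left)

lemma app_rank_one: "app (rank_one d y) v i = (if i < d then y i * (\<Sum>j<d. cnj (y j) * v j) else 0)"
  by transfer simp

lemma preserves_rank_one [intro!]: "preserves d (rank_one d y)"
  by (auto simp: preserves_def supp_below_def app_rank_one)

lemma entry_rank_one: "i < d \<Longrightarrow> j < d \<Longrightarrow> entry (rank_one d y) i j = y i * cnj (y j)"
proof -
  assume "i < d" "j < d"
  moreover from \<open>j < d\<close> have "(\<Sum>k<d. cnj (y k) * unit_vector j k) = (\<Sum>k\<in>{j}. cnj (y k) * unit_vector j k)"
    by (intro sum.mono_neutral_right) (auto simp: unit_vector_def)
  ultimately show ?thesis by (simp add: entry_def app_rank_one unit_vector_def)
qed

lemma hermitian_rank_one [intro]: "hermitian_on d (rank_one d y)"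
  unfolding adjoint_pair_def by (intro conjI preserves_rank_one allI impI) (simp add: entry_rank_one)

lemma tr_rank_one_times:
  assumes "preserves d Z"
  shows "tr d (rank_one d y * Z) = (\<Sum>i<d. \<Sum>j<d. y i * cnj (y j) * entry Z j i)"
  using assms by (simp add: tr_times entry_rank_one)

text \<open>\<open>(y y\<^sup>*)\<^sup>2 = |y|\<^sup>2 y y\<^sup>*\<close>.\<close>
lemma tr_rank_one_square:
  assumes "preserves d Z"
  shows "Re (tr d (rank_one d y * rank_one d y * Z)) = (\<Sum>j<d. (cmod (y j))\<^sup>2) * Re (tr d (rank_one d y * Z))"
proof -
  have r: "(\<Sum>j<d. cnj (y j) * y j) = of_real (\<Sum>j<d. (cmod (y j))\<^sup>2)"
    by (simp only: of_real_sum complex_norm_square mult.commute)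
  have "entry (rank_one d y * rank_one d y) i j = of_real (\<Sum>j<d. (cmod (y j))\<^sup>2) * entry (rank_one d y) i j"
    if "i < d" "j < d" for i j
  proof -
    have "entry (rank_one d y * rank_one d y) i j = (\<Sum>k<d. y i * cnj (y j) * (cnj (y k) * y k))"
      using that by (simp add: entry_times[OF preserves_rank_one] entry_rank_one mult_ac)
    also have "\<dots> = y i * cnj (y j) * (\<Sum>k<d. cnj (y k) * y k)" by (simp only: sum_distrib_left)
    finally show ?thesis using that unfolding r by (simp add: entry_rank_one mult_ac)
  qed
  then have "tr d (rank_one d y * rank_one d y * Z) = of_real (\<Sum>j<d. (cmod (y j))\<^sup>2) * tr d (rank_one d y * Z)"
    unfolding tr_times[OF assms] by (simp add: sum_distrib_left mult_ac)
  then show ?thesis by simp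
qed

text \<open>The trace is \<open>|X y|\<^sup>2\<close>.\<close>
lemma tr_rank_one_psd:
  assumes "adjoint_pair d X X'"
  shows "0 \<le> Re (tr d (rank_one d y * (X' * X)))"
proof -
  note p = adjoint_pair_preserves[OF assms]
  have "tr d (rank_one d y * (X' * X)) = (\<Sum>i<d. \<Sum>j<d. \<Sum>k<d. cnj (entry X k j * y j) * (entry X k i * y i))"
    unfolding tr_rank_one_times[OF preserves_times[OF p(2,1)]]
    using assms p by (auto simp: entry_times sum_distrib_left adjoint_pair_def mult_ac intro!: sum.cong)
  also have "\<dots> = (\<Sum>i<d. \<Sum>k<d. \<Sum>j<d. cnj (entry X k j * y j) * (entry X k i * y i))"
    by (intro sum.cong refl sum.swap)
  also have "\<dots> = (\<Sum>k<d. \<Sum>i<d. \<Sum>j<d. cnj (entry X k j * y j) * (entry X k i * y i))"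
    by (rule sum.swap)
  also have "\<dots> = (\<Sum>k<d. cnj (\<Sum>j<d. entry X k j * y j) * (\<Sum>i<d. entry X k i * y i))"
    by (simp add: sum_distrib_left sum_distrib_right)
  also have "\<dots> = of_real (\<Sum>k<d. (cmod (\<Sum>i<d. entry X k i * y i))\<^sup>2)"
    by (simp only: of_real_sum complex_norm_square mult.commute)
  finally show ?thesis by (simp add: sum_nonneg)
qed

lemma tr_rank_one_psd_even_power:
  assumes "hermitian_on d A"
  shows "0 \<le> Re (tr d (rank_one d y * A ^ (2 * s)))"
  using tr_rank_one_psd[OF hermitian_on_power[OF assms, of s], of y]
  by (simp add: power_add[symmetric] flip: mult_2)

section \<open>Quadratic forms and traces of powers\<close>

definition vec_norm_sq :: "nat \<Rightarrow> (nat \<Rightarrow> complex) \<Rightarrow> real" where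
  "vec_norm_sq d v = (\<Sum>i<d. (cmod (v i))\<^sup>2)"
definition vec_inner :: "nat \<Rightarrow> (nat \<Rightarrow> complex) \<Rightarrow> (nat \<Rightarrow> complex) \<Rightarrow> complex" where
  "vec_inner d u v = (\<Sum>i<d. u i * cnj (v i))"

lemma vec_norm_sq_nonneg [simp]: "0 \<le> vec_norm_sq d v" by (simp add: vec_norm_sq_def sum_nonneg)
lemma vec_inner_self: "vec_inner d v v = of_real (vec_norm_sq d v)"
  by (simp only: vec_inner_def vec_norm_sq_def of_real_sum complex_norm_square)

lemma sum_Cauchy_Schwarz:
  fixes f g :: "'i \<Rightarrow> complex"
  shows "(cmod (\<Sum>i\<in>S. f i * g i))\<^sup>2 \<le> (\<Sum>i\<in>S. (cmod (f i))\<^sup>2) * (\<Sum>i\<in>S. (cmod (g i))\<^sup>2)"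
proof -
  have "cmod (\<Sum>i\<in>S. f i * g i) \<le> (\<Sum>i\<in>S. \<bar>cmod (f i)\<bar> * \<bar>cmod (g i)\<bar>)"
    by (rule order_trans[OF norm_sum]) (simp add: norm_mult)
  also have "\<dots> \<le> L2_set (\<lambda>i. cmod (f i)) S * L2_set (\<lambda>i. cmod (g i)) S"
    by (rule L2_set_mult_ineq)
  finally have "(cmod (\<Sum>i\<in>S. f i * g i))\<^sup>2 \<le> (L2_set (\<lambda>i. cmod (f i)) S * L2_set (\<lambda>i. cmod (g i)) S)\<^sup>2"
    by (intro power_mono) auto
  then show ?thesis by (simp add: power_mult_distrib L2_set_def sum_nonneg)
qed

lemma vec_Cauchy_Schwarz: "(cmod (vec_inner d u v))\<^sup>2 \<le> vec_norm_sq d u * vec_norm_sq d v"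
  using sum_Cauchy_Schwarz[of u "\<lambda>i. cnj (v i)" "{..<d}"] by (simp add: vec_inner_def vec_norm_sq_def)

lemma vec_inner_adjoint:
  assumes "adjoint_pair d A A'" "supp_below d u" "supp_below d v"
  shows "vec_inner d (app A u) v = vec_inner d u (app A' v)"
proof -
  have "vec_inner d (app A u) v = (\<Sum>i<d. \<Sum>j<d. entry A i j * u j * cnj (v i))"
    by (simp add: vec_inner_def app_eq_entries[OF assms(2)] sum_distrib_right)
  also have "\<dots> = (\<Sum>j<d. \<Sum>i<d. entry A i j * u j * cnj (v i))" by (rule sum.swap)
  also have "\<dots> = vec_inner d u (app A' v)"
    using assms(1) by (auto simp: vec_inner_def app_eq_entries[OF assms(3)] sum_distrib_left adjoint_pair_def mult_ac intro!: sum.cong)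
  finally show ?thesis .
qed

lemma vec_norm_sq_app_le:
  assumes "adjoint_pair d X X'" "supp_below d v"
  shows "vec_norm_sq d (app X v) \<le> Re (tr d (X' * X)) * vec_norm_sq d v"
proof -
  have "vec_norm_sq d (app X v) = (\<Sum>i<d. (cmod (\<Sum>j<d. entry X i j * v j))\<^sup>2)"
    by (simp add: vec_norm_sq_def app_eq_entries[OF assms(2)])
  also have "\<dots> \<le> (\<Sum>i<d. (\<Sum>j<d. (cmod (entry X i j))\<^sup>2) * vec_norm_sq d v)"
    unfolding vec_norm_sq_def by (intro sum_mono sum_Cauchy_Schwarz)
  also have "\<dots> = (\<Sum>i<d. \<Sum>j<d. (cmod (entry X i j))\<^sup>2) * vec_norm_sq d v"
    by (simp add: sum_distrib_right)
  also have "(\<Sum>i<d. \<Sum>j<d. (cmod (entry X i j))\<^sup>2) = Re (tr d (X' * X))"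
    unfolding Re_tr_square[OF assms(1)] by (rule sum.swap)
  finally show ?thesis .
qed

text \<open>Suppose that \<open>\<langle>W v, v\<rangle>\<close> exceeds \<open>a |v|\<^sup>2\<close> in absolute value, and let \<open>t k = |W\<^sup>k v|\<^sup>2\<close>. The
  Cauchy-Schwarz inequality gives \<open>a\<^sup>2 t 0 \<le> t 1\<close>. As \<open>t (k + 1) = \<langle>W\<^sup>k v, W\<^sup>k\<^sup>+\<^sup>2 v\<rangle>\<close>, the
  arithmetic-geometric mean inequality propagates this to \<open>a\<^sup>2 t k \<le> t (k + 1)\<close>. Hence \<open>t p\<close> is at least
  \<open>a\<^sup>2\<^sup>p |v|\<^sup>2\<close>, whereas it is at most \<open>tr W\<^sup>2\<^sup>p |v|\<^sup>2\<close>. The argument uses traces of powers only and no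
  eigenvalues of \<open>W\<close>.\<close>
lemma quadratic_form_le_of_tr_power:
  assumes W: "hermitian_on d W" and "0 < a" and v: "supp_below d v"
    and tr: "Re (tr d (W ^ (2 * p))) < a ^ (2 * p)"
  shows "\<bar>Re (vec_inner d (app W v) v)\<bar> \<le> a * vec_norm_sq d v"
proof (rule ccontr)
  assume "\<not> ?thesis"
  then have gt: "a * vec_norm_sq d v < \<bar>Re (vec_inner d (app W v) v)\<bar>" by simp
  define t where "t k = vec_norm_sq d (app (W ^ k) v)" for k
  have t0: "t 0 = vec_norm_sq d v" by (simp add: t_def)
  have tnn: "0 \<le> t k" for k by (simp add: t_def)
  have supp: "supp_below d (app (W ^ k) v)" for k
    using preserves_power[OF adjoint_pair_preserves(1)[OF W], of k] v by (simp add: preserves_def)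
  have "(a * t 0)\<^sup>2 < \<bar>Re (vec_inner d (app W v) v)\<bar>\<^sup>2"
    using gt \<open>0 < a\<close> by (intro power_strict_mono) (auto simp: t0)
  also have "\<dots> \<le> (cmod (vec_inner d (app W v) v))\<^sup>2"
    by (intro power_mono abs_Re_le_cmod) auto
  also have "\<dots> \<le> t 1 * t 0" using vec_Cauchy_Schwarz[of d "app W v" v] by (simp add: t_def)
  finally have strict: "a\<^sup>2 * t 0 * t 0 < t 1 * t 0" by (simp add: power2_eq_square mult_ac)
  then have pos: "0 < t 0" using tnn[of 0] by (cases "t 0 = 0") auto
  have base: "a\<^sup>2 * t 0 \<le> t 1" using strict pos by (simp add: mult_less_cancel_right)
  \<comment> \<open>log-convexity of \<open>t\<close> in linearised form\<close>
  have conv: "2 * t (Suc k) \<le> a\<^sup>2 * t k + t (Suc (Suc k)) / a\<^sup>2" for k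
  proof -
    let ?u = "app (W ^ k) v"
    have "complex_of_real (t (Suc k)) = vec_inner d (app W ?u) (app W ?u)"
      unfolding t_def vec_inner_self[symmetric] by simp
    also have "\<dots> = vec_inner d ?u (app W (app W ?u))"
      using supp[of k] supp[of "Suc k"] by (intro vec_inner_adjoint[OF W]) auto
    finally have "complex_of_real (t (Suc k)) = (\<Sum>i<d. ?u i * cnj (app W (app W ?u) i))"
      by (simp add: vec_inner_def)
    then have "t (Suc k) = Re (\<Sum>i<d. ?u i * cnj (app W (app W ?u) i))"
      by (metis Re_complex_of_real)
    then have "2 * t (Suc k) = (\<Sum>i<d. 2 * Re (cnj (?u i) * app W (app W ?u) i))"
      by (simp add: Re_sum sum_distrib_left)
    also have "\<dots> \<le> (\<Sum>i<d. a\<^sup>2 * (cmod (?u i))\<^sup>2 + (cmod (app W (app W ?u) i))\<^sup>2 / a\<^sup>2)"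
      using \<open>0 < a\<close> by (intro sum_mono weighted_AMGM_complex) simp
    also have "\<dots> = a\<^sup>2 * t k + t (Suc (Suc k)) / a\<^sup>2"
      by (simp add: t_def vec_norm_sq_def sum.distrib sum_distrib_left sum_divide_distrib)
    finally show ?thesis .
  qed
  have grow: "a\<^sup>2 * t k \<le> t (Suc k)" for k
  proof (induction k)
    case (Suc k)
    from conv[of k] Suc have "t (Suc k) \<le> t (Suc (Suc k)) / a\<^sup>2" by linarith
    then show ?case using \<open>0 < a\<close> by (simp add: field_simps)
  qed (use base in simp)
  have "a ^ (2 * k) * t 0 \<le> t k" for k
  proof (induction k)
    case (Suc k)
    have "a ^ (2 * Suc k) * t 0 = a\<^sup>2 * (a ^ (2 * k) * t 0)" by (simp add: power2_eq_square)
    also have "\<dots> \<le> a\<^sup>2 * t k" using Suc by (intro mult_left_mono) auto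
    also have "\<dots> \<le> t (Suc k)" by (rule grow)
    finally show ?case .
  qed simp
  moreover have "t p \<le> Re (tr d (W ^ (2 * p))) * t 0"
    using vec_norm_sq_app_le[OF hermitian_on_power[OF W] v, of p]
    by (simp add: t_def t0 power_add[symmetric] flip: mult_2)
  ultimately have "a ^ (2 * p) * t 0 \<le> Re (tr d (W ^ (2 * p))) * t 0" by (rule order_trans)
  then show False using pos tr by simp
qed

lemma vec_inner_rank_one:
  assumes "supp_below d v"
  shows "vec_inner d (app (rank_one d y) v) v = of_real ((cmod (\<Sum>j<d. cnj (y j) * v j))\<^sup>2)"
proof -
  let ?s = "\<Sum>j<d. cnj (y j) * v j"
  have "vec_inner d (app (rank_one d y) v) v = ?s * (\<Sum>i<d. y i * cnj (v i))"
    by (simp add: vec_inner_def app_rank_one sum_distrib_left mult_ac)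
  also have "(\<Sum>i<d. y i * cnj (v i)) = cnj ?s" by simp
  finally show ?thesis by (simp only: complex_norm_square)
qed

section \<open>Traces of powers of a sum\<close>

text \<open>One factor of \<open>W\<^sup>2\<^sup>s\<^sup>+\<^sup>2\<close> is expanded into the summands \<open>Y i\<close>. In the remaining factor \<open>W\<^sup>2\<^sup>s\<^sup>+\<^sup>1\<close> the summand
  \<open>Y i\<close> is removed, so that for independent summands the two factors become independent; the mean
  value inequality for \<open>A = W\<close> and \<open>B = W - Y i\<close> bounds the price.\<close>
lemma tr_power_split_le:
  fixes Y :: "'i \<Rightarrow> linop"
  assumes I: "finite I" and Y: "\<And>i. i \<in> I \<Longrightarrow> hermitian_on d (Y i)"
  defines "W \<equiv> \<lambda>J. \<Sum>i\<in>J. Y i"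
  shows "Re (tr d (W I ^ (2 * s+2))) \<le> (\<Sum>i\<in>I. Re (tr d (Y i * W (I - {i}) ^ (2 * s+1)))
    + (2 * real s + 1) / 2 * (Re (tr d (Y i * Y i * W I ^ (2 * s))) + Re (tr d (Y i * Y i * W (I - {i}) ^ (2 * s)))))"
proof -
  have "Re (tr d (W I ^ (2 * s+2))) = Re (tr d ((\<Sum>i\<in>I. Y i) * W I ^ (2 * s+1)))"
    by (simp add: W_def)
  also have "\<dots> = (\<Sum>i\<in>I. Re (tr d (Y i * W I ^ (2 * s+1))))"
    by (simp only: sum_distrib_right tr_sum Re_sum)
  also have "\<dots> \<le> (\<Sum>i\<in>I. Re (tr d (Y i * W (I - {i}) ^ (2 * s+1)))
    + (2 * real s + 1) / 2 * (Re (tr d (Y i * Y i * W I ^ (2 * s))) + Re (tr d (Y i * Y i * W (I - {i}) ^ (2 * s)))))"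
  proof (rule sum_mono)
    fix i assume i: "i \<in> I"
    have W: "hermitian_on d (W J)" if "J \<subseteq> I" for J
      unfolding W_def using Y that by (intro hermitian_on_sum) auto
    have eq: "W I - W (I - {i}) = Y i"
      unfolding W_def using I i by (simp add: sum.remove)
    have "Re (tr d (Y i * (W I ^ (2 * s+1) - W (I - {i}) ^ (2 * s+1)))) \<le>
      (2 * real s + 1) / 2 * (Re (tr d (Y i * Y i * W I ^ (2 * s))) + Re (tr d (Y i * Y i * W (I - {i}) ^ (2 * s))))"
      using mean_value_trace_inequality[OF W[of I] W[of "I - {i}"], of s] unfolding eq by blast
    then show "Re (tr d (Y i * W I ^ (2 * s+1))) \<le> Re (tr d (Y i * W (I - {i}) ^ (2 * s+1)))
      + (2 * real s + 1) / 2 * (Re (tr d (Y i * Y i * W I ^ (2 * s))) + Re (tr d (Y i * Y i * W (I - {i}) ^ (2 * s))))"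
      unfolding right_diff_distrib tr_minus minus_complex.sel by linarith
  qed
  finally show ?thesis .
qed

section \<open>Moments of sums of independent rank-one operators\<close>

lemma borel_measurable_cnj [measurable (raw)]:
  "f \<in> borel_measurable M \<Longrightarrow> (\<lambda>x. cnj (f x)) \<in> borel_measurable M"
  by (rule borel_measurable_continuous_on[OF continuous_on_cnj[OF continuous_on_id]])

text \<open>Bounded measurable entries in the leading block: this class is closed under the ring operations, and
  on a finite measure space all traces of its members are integrable.\<close>
definition bounded_random_linop :: "nat \<Rightarrow> 'b measure \<Rightarrow> ('b \<Rightarrow> linop) \<Rightarrow> bool" where
  "bounded_random_linop d P F \<longleftrightarrow> (\<forall>x\<in>space P. preserves d (F x)) \<and>
     (\<forall>i<d. \<forall>j<d. (\<lambda>x. entry (F x) i j) \<in> borel_measurable P \<and>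
        (\<exists>B. \<forall>x\<in>space P. cmod (entry (F x) i j) \<le> B))"

lemma bounded_random_linopI:
  assumes "\<And>x. x \<in> space P \<Longrightarrow> preserves d (F x)"
    and "\<And>i j. i < d \<Longrightarrow> j < d \<Longrightarrow> (\<lambda>x. entry (F x) i j) \<in> borel_measurable P"
    and "\<And>i j. i < d \<Longrightarrow> j < d \<Longrightarrow> \<exists>B. \<forall>x\<in>space P. cmod (entry (F x) i j) \<le> B"
  shows "bounded_random_linop d P F"
  using assms by (auto simp: bounded_random_linop_def)

lemma bounded_random_linopD:
  assumes "bounded_random_linop d P F"
  shows "x \<in> space P \<Longrightarrow> preserves d (F x)"
    and "i < d \<Longrightarrow> j < d \<Longrightarrow> (\<lambda>x. entry (F x) i j) \<in> borel_measurable P"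
    and "i < d \<Longrightarrow> j < d \<Longrightarrow> \<exists>B. \<forall>x\<in>space P. cmod (entry (F x) i j) \<le> B"
  using assms by (auto simp: bounded_random_linop_def)

lemma bounded_random_linop_one: "bounded_random_linop d P (\<lambda>_. 1)"
  by (rule bounded_random_linopI) auto

lemma bounded_random_linop_zero: "bounded_random_linop d P (\<lambda>_. 0)"
  by (rule bounded_random_linopI) auto

lemma bounded_random_linop_plus:
  assumes F: "bounded_random_linop d P F" and G: "bounded_random_linop d P G"
  shows "bounded_random_linop d P (\<lambda>x. F x + G x)"
proof (rule bounded_random_linopI)
  fix i j assume ij: "i < d" "j < d"
  obtain B C where B: "\<And>x. x \<in> space P \<Longrightarrow> cmod (entry (F x) i j) \<le> B"
    and C: "\<And>x. x \<in> space P \<Longrightarrow> cmod (entry (G x) i j) \<le> C"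
    using bounded_random_linopD(3)[OF F ij] bounded_random_linopD(3)[OF G ij] by blast
  have "cmod (entry (F x + G x) i j) \<le> B + C" if "x \<in> space P" for x
    using norm_triangle_ineq[of "entry (F x) i j" "entry (G x) i j"] B[OF that] C[OF that] by simp
  then show "\<exists>B. \<forall>x\<in>space P. cmod (entry (F x + G x) i j) \<le> B" by blast
qed (use bounded_random_linopD[OF F] bounded_random_linopD[OF G] in auto)

lemma bounded_random_linop_minus:
  assumes F: "bounded_random_linop d P F" and G: "bounded_random_linop d P G"
  shows "bounded_random_linop d P (\<lambda>x. F x - G x)"
proof (rule bounded_random_linopI)
  fix i j assume ij: "i < d" "j < d"
  obtain B C where B: "\<And>x. x \<in> space P \<Longrightarrow> cmod (entry (F x) i j) \<le> B"
    and C: "\<And>x. x \<in> space P \<Longrightarrow> cmod (entry (G x) i j) \<le> C"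
    using bounded_random_linopD(3)[OF F ij] bounded_random_linopD(3)[OF G ij] by blast
  have "cmod (entry (F x - G x) i j) \<le> B + C" if "x \<in> space P" for x
    using norm_triangle_ineq4[of "entry (F x) i j" "entry (G x) i j"] B[OF that] C[OF that] by simp
  then show "\<exists>B. \<forall>x\<in>space P. cmod (entry (F x - G x) i j) \<le> B" by blast
qed (use bounded_random_linopD[OF F] bounded_random_linopD[OF G] in auto)

lemma bounded_random_linop_times:
  assumes F: "bounded_random_linop d P F" and G: "bounded_random_linop d P G"
  shows "bounded_random_linop d P (\<lambda>x. F x * G x)"
proof (rule bounded_random_linopI)
  fix i j assume ij: "i < d" "j < d"
  have eq: "entry (F x * G x) i j = (\<Sum>k<d. entry (F x) i k * entry (G x) k j)" if "x \<in> space P" for x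
    using entry_times[OF bounded_random_linopD(1)[OF G that] ij(2)] .
  show "(\<lambda>x. entry (F x * G x) i j) \<in> borel_measurable P"
    using bounded_random_linopD(2)[OF F] bounded_random_linopD(2)[OF G] ij
    by (subst measurable_cong[OF eq]) (auto intro!: borel_measurable_sum borel_measurable_times)
  have "\<forall>k. \<exists>B. k < d \<longrightarrow> (\<forall>x\<in>space P. cmod (entry (F x) i k) \<le> B)"
    using bounded_random_linopD(3)[OF F] ij by blast
  then obtain B where B: "\<And>k x. k < d \<Longrightarrow> x \<in> space P \<Longrightarrow> cmod (entry (F x) i k) \<le> B k" by metis
  have "\<forall>k. \<exists>B. k < d \<longrightarrow> (\<forall>x\<in>space P. cmod (entry (G x) k j) \<le> B)"
    using bounded_random_linopD(3)[OF G] ij by blast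
  then obtain C where C: "\<And>k x. k < d \<Longrightarrow> x \<in> space P \<Longrightarrow> cmod (entry (G x) k j) \<le> C k" by metis
  have "cmod (entry (F x * G x) i j) \<le> (\<Sum>k<d. B k * C k)" if x: "x \<in> space P" for x
    unfolding eq[OF x]
  proof (rule order_trans[OF norm_sum sum_mono])
    fix k assume "k \<in> {..<d}"
    then have "cmod (entry (F x) i k) \<le> B k" "cmod (entry (G x) k j) \<le> C k"
      using B[OF _ x] C[OF _ x] by auto
    moreover from this(1) have "0 \<le> B k" using norm_ge_zero order_trans by blast
    ultimately show "cmod (entry (F x) i k * entry (G x) k j) \<le> B k * C k"
      unfolding norm_mult by (intro mult_mono) auto
  qed
  then show "\<exists>B. \<forall>x\<in>space P. cmod (entry (F x * G x) i j) \<le> B" by blast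
qed (use bounded_random_linopD[OF F] bounded_random_linopD[OF G] in auto)

lemma bounded_random_linop_power:
  assumes F: "bounded_random_linop d P F"
  shows "bounded_random_linop d P (\<lambda>x. F x ^ k)"
  by (induction k) (simp_all add: bounded_random_linop_one bounded_random_linop_times F)

lemma bounded_random_linop_sum:
  assumes "\<And>i. i \<in> S \<Longrightarrow> bounded_random_linop d P (F i)"
  shows "bounded_random_linop d P (\<lambda>x. \<Sum>i\<in>S. F i x)"
  using assms
  by (induction S rule: infinite_finite_induct)
     (simp_all add: bounded_random_linop_zero bounded_random_linop_plus)

lemma integrable_Re_entry:
  assumes "finite_measure P" and F: "bounded_random_linop d P F" and "i < d" "j < d"
  shows "integrable P (\<lambda>x. Re (entry (F x) i j))"
proof -
  obtain B where "\<forall>x\<in>space P. cmod (entry (F x) i j) \<le> B"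
    using bounded_random_linopD(3)[OF F \<open>i < d\<close> \<open>j < d\<close>] by blast
  then have "\<forall>x\<in>space P. norm (Re (entry (F x) i j)) \<le> B"
    using abs_Re_le_cmod order_trans by (metis real_norm_def)
  moreover have "(\<lambda>x. Re (entry (F x) i j)) \<in> borel_measurable P"
    using bounded_random_linopD(2)[OF F assms(3,4)] by measurable
  ultimately show ?thesis
    using assms(1) by (intro finite_measure.integrable_const_bound[where B=B]) auto
qed

lemma integrable_Re_tr:
  assumes "finite_measure P" "bounded_random_linop d P F"
  shows "integrable P (\<lambda>x. Re (tr d (F x)))"
  unfolding tr_def Re_sum by (intro Bochner_Integration.integrable_sum integrable_Re_entry[OF assms]) auto

lemma integral_sum_plus_sum:
  fixes f g :: "'i \<Rightarrow> 'b \<Rightarrow> real"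
  assumes "\<And>i. i \<in> I \<Longrightarrow> integrable M (f i)" "\<And>i. i \<in> I \<Longrightarrow> integrable M (g i)" "integrable M h"
  shows "(\<integral>x. (\<Sum>i\<in>I. f i x) + c * (h x + (\<Sum>i\<in>I. g i x)) \<partial>M)
    = (\<Sum>i\<in>I. \<integral>x. f i x \<partial>M) + c * ((\<integral>x. h x \<partial>M) + (\<Sum>i\<in>I. \<integral>x. g i x \<partial>M))"
  using assms by simp

lemma integral_add_mult_add_sum:
  fixes f h :: "'b \<Rightarrow> real"
  assumes "integrable M f" "\<And>i. i \<in> I \<Longrightarrow> integrable M (g i)" "integrable M h"
  shows "(\<integral>x. f x + c * (h x + (\<Sum>i\<in>I. g i x)) \<partial>M)
    = (\<integral>x. f x \<partial>M) + c * ((\<integral>x. h x \<partial>M) + (\<Sum>i\<in>I. \<integral>x. g i x \<partial>M))"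
  using assms by simp

text \<open>The summands are \<open>y x (y x)\<^sup>*\<close> for independent points \<open>x\<close> with distribution \<open>\<mu>\<close>. Their mean is the
  diagonal operator with entries \<open>l\<close>.\<close>
locale independent_vectors = prob_space \<mu> for \<mu> :: "'a measure" +
  fixes y :: "'a \<Rightarrow> nat \<Rightarrow> complex" and d :: nat and R :: real and l :: "nat \<Rightarrow> real"
  assumes vec_measurable: "\<And>j. j < d \<Longrightarrow> (\<lambda>x. y x j) \<in> borel_measurable \<mu>"
    and vec_bound: "\<And>x. x \<in> space \<mu> \<Longrightarrow> vec_norm_sq d (y x) \<le> R"
    and covariance: "\<And>i j. i < d \<Longrightarrow> j < d \<Longrightarrow>
      (\<integral>x. y x i * cnj (y x j) \<partial>\<mu>) = (if i = j then of_real (l i) else 0)"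
    and R_pos: "0 < R"
begin

abbreviation P :: "nat set \<Rightarrow> (nat \<Rightarrow> 'a) measure" where
  "P I \<equiv> Pi\<^sub>M I (\<lambda>_. \<mu>)"

abbreviation Y :: "'a \<Rightarrow> linop" where
  "Y x \<equiv> rank_one d (y x)"

sublocale Q: product_prob_space "\<lambda>_::nat. \<mu>" by unfold_locales

lemma finite_measure_P: "finite_measure (P I)"
proof -
  interpret I: prob_space "P I" by (intro prob_space_PiM prob_space_axioms)
  show ?thesis by unfold_locales
qed

lemma component_bound: "x \<in> space \<mu> \<Longrightarrow> j < d \<Longrightarrow> cmod (y x j) \<le> sqrt R"
proof -
  assume "x \<in> space \<mu>" "j < d"
  then have "(cmod (y x j))\<^sup>2 \<le> R"
    using vec_bound[of x] member_le_sum[of j "{..<d}" "\<lambda>j. (cmod (y x j))\<^sup>2"] by (simp add: vec_norm_sq_def)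
  then show ?thesis by (rule real_le_rsqrt)
qed

lemma entry_Y_bound:
  assumes "x \<in> space \<mu>" "i < d" "j < d" shows "cmod (y x i * cnj (y x j)) \<le> R"
proof -
  have "cmod (y x i) * cmod (y x j) \<le> sqrt R * sqrt R"
    using component_bound assms R_pos by (intro mult_mono) auto
  then show ?thesis using R_pos by (simp add: norm_mult)
qed

lemma bounded_random_linop_Y:
  assumes "i \<in> I" shows "bounded_random_linop d (P I) (\<lambda>X. Y (X i))"
proof (rule bounded_random_linopI)
  fix a b assume ab: "a < d" "b < d"
  have X: "(\<lambda>X. X i) \<in> measurable (P I) \<mu>" using assms by (rule measurable_component_singleton)
  have "(\<lambda>X. y (X i) a * cnj (y (X i) b)) \<in> borel_measurable (P I)"
    using measurable_compose[OF X vec_measurable[OF ab(1)]] measurable_compose[OF X vec_measurable[OF ab(2)]]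
    by measurable
  then show "(\<lambda>X. entry (Y (X i)) a b) \<in> borel_measurable (P I)" using ab by (simp add: entry_rank_one)
  have "X i \<in> space \<mu>" if "X \<in> space (P I)" for X using that assms by (auto simp: space_PiM)
  then show "\<exists>B. \<forall>X\<in>space (P I). cmod (entry (Y (X i)) a b) \<le> B"
    using entry_Y_bound ab by (intro exI[of _ R]) (simp add: entry_rank_one)
qed auto

lemma integral_insert_unused:
  assumes "finite I" "i \<notin> I" and F: "bounded_random_linop d (P (insert i I)) F"
    and unused: "\<And>X x. F (X(i := x)) = F X"
  shows "(\<integral>X. Re (tr d (F X)) \<partial>P (insert i I)) = (\<integral>X. Re (tr d (F X)) \<partial>P I)"
  using Q.product_integral_insert[OF assms(1,2) integrable_Re_tr[OF finite_measure_P F]]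
  by (simp add: unused prob_space)

text \<open>\<open>F\<close> depends only on the coordinates in \<open>I\<close>. Hence the coordinate \<open>i\<close> can be integrated first, which
  replaces \<open>Y (X i)\<close> by its mean.\<close>
lemma integral_insert_rank_one:
  assumes "finite I" "i \<notin> I" and F: "bounded_random_linop d (P (insert i I)) F"
    and unused: "\<And>X x. F (X(i := x)) = F X"
    and pres: "\<And>X. X \<in> space (P I) \<Longrightarrow> preserves d (F X)"
  shows "(\<integral>X. Re (tr d (Y (X i) * F X)) \<partial>P (insert i I)) = (\<integral>X. (\<Sum>a<d. l a * Re (entry (F X) a a)) \<partial>P I)"
proof -
  have int: "integrable (P (insert i I)) (\<lambda>X. Re (tr d (Y (X i) * F X)))"
    by (intro integrable_Re_tr finite_measure_P bounded_random_linop_times F bounded_random_linop_Y) auto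
  have inty: "integrable \<mu> (\<lambda>x. y x a * cnj (y x b))" if "a < d" "b < d" for a b
  proof -
    have "(\<lambda>x. y x a * cnj (y x b)) \<in> borel_measurable \<mu>"
      using vec_measurable[OF that(1)] vec_measurable[OF that(2)] by measurable
    then show ?thesis
      using entry_Y_bound that
      by (intro integrable_const_bound[where B=R]) auto
  qed
  have "(\<integral>x. Re (tr d (Y x * Z)) \<partial>\<mu>) = (\<Sum>a<d. l a * Re (entry Z a a))" if Z: "preserves d Z" for Z
  proof -
    have i1: "integrable \<mu> (\<lambda>x. y x a * cnj (y x b) * entry Z b a)" if "a < d" "b < d" for a b
      using inty[OF that] by simp
    have "(\<integral>x. Re (tr d (Y x * Z)) \<partial>\<mu>) = Re (\<integral>x. (\<Sum>a<d. \<Sum>b<d. y x a * cnj (y x b) * entry Z b a) \<partial>\<mu>)"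
      unfolding tr_rank_one_times[OF Z]
      by (intro integral_Re Bochner_Integration.integrable_sum i1) auto
    also have "(\<integral>x. (\<Sum>a<d. \<Sum>b<d. y x a * cnj (y x b) * entry Z b a) \<partial>\<mu>)
        = (\<Sum>a<d. \<integral>x. (\<Sum>b<d. y x a * cnj (y x b) * entry Z b a) \<partial>\<mu>)"
      by (intro Bochner_Integration.integral_sum Bochner_Integration.integrable_sum i1) auto
    also have "\<dots> = (\<Sum>a<d. \<Sum>b<d. \<integral>x. y x a * cnj (y x b) * entry Z b a \<partial>\<mu>)"
      by (intro sum.cong refl Bochner_Integration.integral_sum i1) auto
    also have "\<dots> = (\<Sum>a<d. \<Sum>b<d. if b = a then of_real (l a) * entry Z a a else 0)"
    proof (intro sum.cong refl)
      fix a b assume "a \<in> {..<d}" "b \<in> {..<d}"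
      then show "(\<integral>x. y x a * cnj (y x b) * entry Z b a \<partial>\<mu>) = (if b = a then of_real (l a) * entry Z a a else 0)"
        using covariance[of a b] by simp
    qed
    also have "\<dots> = (\<Sum>a<d. of_real (l a) * entry Z a a)" by (simp add: sum.delta)
    finally show ?thesis by (simp add: Re_sum)
  qed
  then show ?thesis
    unfolding Q.product_integral_insert[OF assms(1,2) int]
    by (intro Bochner_Integration.integral_cong refl) (simp add: unused pres)
qed

text \<open>The summands are used uncentred (\<open>c = 0\<close>) to bound the sum from above, and centred (\<open>c = 1\<close>, for
  identity covariance) to bound it from below.\<close>
definition W :: "linop \<Rightarrow> nat set \<Rightarrow> (nat \<Rightarrow> 'a) \<Rightarrow> linop" where
  "W c I X = (\<Sum>i\<in>I. Y (X i) - c)"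

definition moment :: "linop \<Rightarrow> nat set \<Rightarrow> nat \<Rightarrow> real" where
  "moment c I k = (\<integral>X. Re (tr d (W c I X ^ k)) \<partial>P I)"

lemma W_unused: "i \<notin> I \<Longrightarrow> W c I (X(i := x)) = W c I X"
  unfolding W_def by (intro sum.cong) auto

lemma hermitian_W: "hermitian_on d c \<Longrightarrow> hermitian_on d (W c I X)"
  unfolding W_def by (intro hermitian_on_sum adjoint_pair_minus hermitian_rank_one)

lemma bounded_random_linop_const: "hermitian_on d c \<Longrightarrow> bounded_random_linop d Q (\<lambda>_. c)"
  by (rule bounded_random_linopI) (auto dest: adjoint_pair_preserves)

lemma bounded_random_linop_W_power:
  assumes "hermitian_on d c" "J \<subseteq> I"
  shows "bounded_random_linop d (P I) (\<lambda>X. W c J X ^ k)"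
  unfolding W_def using assms
  by (intro bounded_random_linop_power bounded_random_linop_sum bounded_random_linop_minus
      bounded_random_linop_Y bounded_random_linop_const) auto

lemma moment_even_nonneg: "hermitian_on d c \<Longrightarrow> 0 \<le> moment c I (2 * k)"
  unfolding moment_def by (intro integral_nonneg_AE AE_I2 Re_tr_power_even_nonneg hermitian_W)

lemma integrable_tr_W_power:
  "hermitian_on d c \<Longrightarrow> J \<subseteq> I \<Longrightarrow> integrable (P I) (\<lambda>X. Re (tr d (W c J X ^ k)))"
  by (intro integrable_Re_tr finite_measure_P bounded_random_linop_W_power)

lemma moment_odd_le:
  assumes "hermitian_on d c" "0 < a"
  shows "2 * moment c I (2 * s + 1) \<le> a * moment c I (2 * s) + moment c I (2 * s + 2) / a"
proof -
  note int = integrable_tr_W_power[OF assms(1) subset_refl]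
  have "(\<integral>X. 2 * Re (tr d (W c I X ^ (2 * s + 1))) \<partial>P I)
      \<le> (\<integral>X. a * Re (tr d (W c I X ^ (2 * s))) + Re (tr d (W c I X ^ (2 * s + 2))) / a \<partial>P I)"
    by (intro integral_mono tr_odd_power_AMGM hermitian_W assms Bochner_Integration.integrable_add
        integrable_mult_right integrable_divide int)
  also have "\<dots> = a * moment c I (2 * s) + moment c I (2 * s + 2) / a"
    unfolding moment_def by (simp only: Bochner_Integration.integral_add integrable_mult_right
        integrable_divide int integral_mult_right_zero integral_divide_zero)
  finally show ?thesis unfolding moment_def by (simp only: integral_mult_right_zero)
qed

lemma integral_W_remove:
  assumes "finite I" "i \<in> I" "hermitian_on d c"
  shows "(\<integral>X. Re (tr d (W c (I - {i}) X ^ k)) \<partial>P I) = moment c (I - {i}) k"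
  using integral_insert_unused[of "I - {i}" i "\<lambda>X. W c (I - {i}) X ^ k"] assms
    bounded_random_linop_W_power[of c "I - {i}" I k]
  by (auto simp: W_unused moment_def insert_absorb)

lemma integral_rank_one_W_remove:
  assumes "finite I" "i \<in> I" "hermitian_on d c"
  shows "(\<integral>X. Re (tr d (Y (X i) * W c (I - {i}) X ^ k)) \<partial>P I)
    = (\<integral>X. (\<Sum>a<d. l a * Re (entry (W c (I - {i}) X ^ k) a a)) \<partial>P (I - {i}))"
  using integral_insert_rank_one[of "I - {i}" i "\<lambda>X. W c (I - {i}) X ^ k"] assms
    bounded_random_linop_W_power[of c "I - {i}" I k] adjoint_pair_preserves(1)[OF hermitian_W[OF assms(3)]]
  by (auto simp: W_unused insert_absorb)

lemma tr_rank_one_square_le: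
  assumes "x \<in> space \<mu>" "hermitian_on d A"
  shows "Re (tr d (Y x * Y x * A ^ (2 * s))) \<le> R * Re (tr d (Y x * A ^ (2 * s)))"
proof -
  have "Re (tr d (Y x * Y x * A ^ (2 * s))) = vec_norm_sq d (y x) * Re (tr d (Y x * A ^ (2 * s)))"
    unfolding vec_norm_sq_def
    by (intro tr_rank_one_square preserves_power adjoint_pair_preserves(1)[OF assms(2)])
  then show ?thesis
    using vec_bound[OF assms(1)] tr_rank_one_psd_even_power[OF assms(2), of "y x" s] by (simp add: mult_right_mono)
qed

text \<open>The expectation of the splitting inequality. As \<open>Y\<^sup>2 \<le> R Y\<close>, the second-order terms are at most
  \<open>R tr (Y i W\<^sup>2\<^sup>s)\<close>; those with the full sum \<open>W\<close> add up to \<open>R tr W\<^sup>2\<^sup>s\<^sup>+\<^sup>1\<close>, and in all others \<open>W\<close> lacks the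
  \<open>i\<close>-th summand and independence applies.\<close>
lemma uncentred_moment_step:
  assumes I: "finite I"
  shows "moment 0 I (2 * s + 2) \<le>
    (\<Sum>i\<in>I. \<integral>X. (\<Sum>a<d. l a * Re (entry (W 0 (I - {i}) X ^ (2 * s + 1)) a a)) \<partial>P (I - {i}))
    + (2 * real s + 1) / 2 * R * (moment 0 I (2 * s + 1)
      + (\<Sum>i\<in>I. \<integral>X. (\<Sum>a<d. l a * Re (entry (W 0 (I - {i}) X ^ (2 * s)) a a)) \<partial>P (I - {i})))"
proof -
  let ?c = "(2 * real s + 1) / 2"
  have h0: "hermitian_on d 0" by auto
  have pw: "Re (tr d (W 0 I X ^ (2 * s + 2))) \<le>
      (\<Sum>i\<in>I. Re (tr d (Y (X i) * W 0 (I - {i}) X ^ (2 * s + 1))))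
      + ?c * R * (Re (tr d (W 0 I X ^ (2 * s + 1)))
         + (\<Sum>i\<in>I. Re (tr d (Y (X i) * W 0 (I - {i}) X ^ (2 * s)))))"
    if X: "X \<in> space (P I)" for X
  proof -
    have X: "X i \<in> space \<mu>" if "i \<in> I" for i using X that by (auto simp: space_PiM)
    have "Re (tr d (W 0 I X ^ (2 * s + 2))) \<le> (\<Sum>i\<in>I. Re (tr d (Y (X i) * W 0 (I - {i}) X ^ (2 * s + 1)))
      + ?c * (Re (tr d (Y (X i) * Y (X i) * W 0 I X ^ (2 * s))) + Re (tr d (Y (X i) * Y (X i) * W 0 (I - {i}) X ^ (2 * s)))))"
      using tr_power_split_le[OF I, of d "\<lambda>i. Y (X i)" s] by (auto simp: W_def)
    also have "\<dots> \<le> (\<Sum>i\<in>I. Re (tr d (Y (X i) * W 0 (I - {i}) X ^ (2 * s + 1)))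
      + ?c * (R * Re (tr d (Y (X i) * W 0 I X ^ (2 * s))) + R * Re (tr d (Y (X i) * W 0 (I - {i}) X ^ (2 * s)))))"
      by (intro sum_mono add_left_mono mult_left_mono add_mono tr_rank_one_square_le X hermitian_W h0) auto
    also have "\<dots> = (\<Sum>i\<in>I. Re (tr d (Y (X i) * W 0 (I - {i}) X ^ (2 * s + 1))))
      + ?c * R * ((\<Sum>i\<in>I. Re (tr d (Y (X i) * W 0 I X ^ (2 * s)))) + (\<Sum>i\<in>I. Re (tr d (Y (X i) * W 0 (I - {i}) X ^ (2 * s)))))"
      by (simp only: sum.distrib sum_distrib_left distrib_left mult.assoc)
    also have "(\<Sum>i\<in>I. Re (tr d (Y (X i) * W 0 I X ^ (2 * s)))) = Re (tr d (W 0 I X * W 0 I X ^ (2 * s)))"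
      unfolding W_def by (simp add: sum_distrib_right tr_sum)
    finally show ?thesis by simp
  qed
  have b: "bounded_random_linop d (P I) (\<lambda>X. Y (X i) * W 0 (I - {i}) X ^ k)" if "i \<in> I" for i k
    using that h0 by (intro bounded_random_linop_times bounded_random_linop_Y bounded_random_linop_W_power) auto
  note ints = integrable_Re_tr[OF finite_measure_P b] integrable_tr_W_power[OF h0 subset_refl, of I]
  have "moment 0 I (2 * s + 2) \<le> (\<integral>X. (\<Sum>i\<in>I. Re (tr d (Y (X i) * W 0 (I - {i}) X ^ (2 * s + 1))))
      + ?c * R * (Re (tr d (W 0 I X ^ (2 * s + 1)))
         + (\<Sum>i\<in>I. Re (tr d (Y (X i) * W 0 (I - {i}) X ^ (2 * s))))) \<partial>P I)"
    unfolding moment_def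
    by (intro integral_mono pw Bochner_Integration.integrable_add integrable_mult_right
        Bochner_Integration.integrable_sum ints)
  also have "\<dots> = (\<Sum>i\<in>I. \<integral>X. Re (tr d (Y (X i) * W 0 (I - {i}) X ^ (2 * s + 1))) \<partial>P I)
      + ?c * R * (moment 0 I (2 * s + 1) + (\<Sum>i\<in>I. \<integral>X. Re (tr d (Y (X i) * W 0 (I - {i}) X ^ (2 * s))) \<partial>P I))"
    unfolding moment_def by (intro integral_sum_plus_sum ints)
  finally show ?thesis by (simp only: integral_rank_one_W_remove[OF I _ h0] cong: sum.cong)
qed

text \<open>The first-order terms of the splitting inequality have mean zero, because \<open>Y i - 1\<close> does and is
  independent of the other summands. For the second-order terms \<open>(Y - 1)\<^sup>2 \<le> R Y + 1\<close>, and the terms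
  with the full sum are collected by means of \<open>\<Sum>i\<in>I. Y i = W + card I\<close>.\<close>
lemma centred_moment_step:
  assumes I: "finite I" and l: "\<And>a. a < d \<Longrightarrow> l a = 1"
  shows "moment 1 I (2 * s + 2) \<le> (2 * real s + 1) / 2 * (R * moment 1 I (2 * s + 1)
    + (R + 1) * real (card I) * moment 1 I (2 * s) + (R + 1) * (\<Sum>i\<in>I. moment 1 (I - {i}) (2 * s)))"
proof -
  let ?c = "(2 * real s + 1) / 2"
  let ?V = "\<lambda>X i. W 1 (I - {i}) X"
  have h1: "hermitian_on d 1" by auto
  have sq: "Re (tr d ((Y x - 1) * (Y x - 1) * A ^ (2 * s))) \<le> R * Re (tr d (Y x * A ^ (2 * s))) + Re (tr d (A ^ (2 * s)))"
    if "x \<in> space \<mu>" "hermitian_on d A" for x A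
  proof -
    have "(Y x - 1) * (Y x - 1) * A ^ (2 * s) = Y x * Y x * A ^ (2 * s) - Y x * A ^ (2 * s) - Y x * A ^ (2 * s) + A ^ (2 * s)"
      by (simp add: left_diff_distrib right_diff_distrib)
    then show ?thesis
      using tr_rank_one_square_le[OF that, of s] tr_rank_one_psd_even_power[OF that(2), of "y x" s]
      by (simp add: tr_plus tr_minus)
  qed
  have pw: "Re (tr d (W 1 I X ^ (2 * s + 2))) \<le>
      (\<Sum>i\<in>I. Re (tr d (Y (X i) * ?V X i ^ (2 * s + 1))) - Re (tr d (?V X i ^ (2 * s + 1))))
      + ?c * (R * Re (tr d (W 1 I X ^ (2 * s + 1))) + (R + 1) * real (card I) * Re (tr d (W 1 I X ^ (2 * s)))
         + (\<Sum>i\<in>I. R * Re (tr d (Y (X i) * ?V X i ^ (2 * s))) + Re (tr d (?V X i ^ (2 * s)))))"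
    if X: "X \<in> space (P I)" for X
  proof -
    have X: "X i \<in> space \<mu>" if "i \<in> I" for i using X that by (auto simp: space_PiM)
    have "Re (tr d (W 1 I X ^ (2 * s + 2))) \<le> (\<Sum>i\<in>I. Re (tr d ((Y (X i) - 1) * ?V X i ^ (2 * s + 1)))
      + ?c * (Re (tr d ((Y (X i) - 1) * (Y (X i) - 1) * W 1 I X ^ (2 * s))) + Re (tr d ((Y (X i) - 1) * (Y (X i) - 1) * ?V X i ^ (2 * s)))))"
      using tr_power_split_le[OF I, of d "\<lambda>i. Y (X i) - 1" s] by (auto simp: W_def)
    also have "\<dots> \<le> (\<Sum>i\<in>I. Re (tr d ((Y (X i) - 1) * ?V X i ^ (2 * s + 1)))
      + ?c * ((R * Re (tr d (Y (X i) * W 1 I X ^ (2 * s))) + Re (tr d (W 1 I X ^ (2 * s))))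
        + (R * Re (tr d (Y (X i) * ?V X i ^ (2 * s))) + Re (tr d (?V X i ^ (2 * s))))))"
      by (intro sum_mono add_left_mono mult_left_mono add_mono sq X hermitian_W h1) auto
    also have "\<dots> = (\<Sum>i\<in>I. Re (tr d ((Y (X i) - 1) * ?V X i ^ (2 * s + 1))))
      + ?c * (R * (\<Sum>i\<in>I. Re (tr d (Y (X i) * W 1 I X ^ (2 * s)))) + real (card I) * Re (tr d (W 1 I X ^ (2 * s)))
        + (\<Sum>i\<in>I. R * Re (tr d (Y (X i) * ?V X i ^ (2 * s))) + Re (tr d (?V X i ^ (2 * s)))))"
      by (simp only: sum.distrib sum_distrib_left[symmetric] sum_constant add.assoc)
    also have "(\<Sum>i\<in>I. Re (tr d (Y (X i) * W 1 I X ^ (2 * s))))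
        = Re (tr d (W 1 I X ^ (2 * s + 1))) + real (card I) * Re (tr d (W 1 I X ^ (2 * s)))"
    proof -
      have "Re (tr d (W 1 I X ^ (2 * s + 1))) = Re (tr d (W 1 I X * W 1 I X ^ (2 * s)))" by simp
      also have "\<dots> = (\<Sum>i\<in>I. Re (tr d (Y (X i) * W 1 I X ^ (2 * s))) - Re (tr d (W 1 I X ^ (2 * s))))"
        by (subst (1) W_def) (simp add: sum_distrib_right tr_sum left_diff_distrib tr_minus del: sum_subtractf)
      finally show ?thesis by (simp add: sum_subtractf)
    qed
    also have "(\<Sum>i\<in>I. Re (tr d ((Y (X i) - 1) * ?V X i ^ (2 * s + 1))))
        = (\<Sum>i\<in>I. Re (tr d (Y (X i) * ?V X i ^ (2 * s + 1))) - Re (tr d (?V X i ^ (2 * s + 1))))"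
      by (simp only: left_diff_distrib tr_minus minus_complex.sel mult_1)
    finally show ?thesis by (simp add: algebra_simps)
  qed
  have b: "bounded_random_linop d (P I) (\<lambda>X. Y (X i) * ?V X i ^ k)" if "i \<in> I" for i k
    using that h1 by (intro bounded_random_linop_times bounded_random_linop_Y bounded_random_linop_W_power) auto
  note ints = integrable_Re_tr[OF finite_measure_P b] integrable_tr_W_power[OF h1 subset_refl, of I]
    integrable_tr_W_power[OF h1 Diff_subset, of I]
  have trl: "(\<integral>X. Re (tr d (Y (X i) * ?V X i ^ k)) \<partial>P I) = moment 1 (I - {i}) k" if "i \<in> I" for i k
  proof -
    have "(\<Sum>a<d. l a * Re (entry Z a a)) = Re (tr d Z)" for Z using l by (simp add: tr_def)
    then show ?thesis unfolding integral_rank_one_W_remove[OF I that h1] moment_def by simp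
  qed
  note rem = integral_W_remove[OF I _ h1]
  have "moment 1 I (2 * s + 2) \<le> (\<integral>X.
      (\<Sum>i\<in>I. Re (tr d (Y (X i) * ?V X i ^ (2 * s + 1))) - Re (tr d (?V X i ^ (2 * s + 1))))
      + ?c * (R * Re (tr d (W 1 I X ^ (2 * s + 1))) + (R + 1) * real (card I) * Re (tr d (W 1 I X ^ (2 * s)))
         + (\<Sum>i\<in>I. R * Re (tr d (Y (X i) * ?V X i ^ (2 * s))) + Re (tr d (?V X i ^ (2 * s))))) \<partial>P I)"
    unfolding moment_def
    by (intro integral_mono pw Bochner_Integration.integrable_add integrable_mult_right
        Bochner_Integration.integrable_diff Bochner_Integration.integrable_sum ints)
  also have "\<dots> = (\<integral>X. (\<Sum>i\<in>I. Re (tr d (Y (X i) * ?V X i ^ (2 * s + 1))) - Re (tr d (?V X i ^ (2 * s + 1)))) \<partial>P I)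
      + ?c * ((\<integral>X. R * Re (tr d (W 1 I X ^ (2 * s + 1))) + (R + 1) * real (card I) * Re (tr d (W 1 I X ^ (2 * s))) \<partial>P I)
         + (\<Sum>i\<in>I. \<integral>X. R * Re (tr d (Y (X i) * ?V X i ^ (2 * s))) + Re (tr d (?V X i ^ (2 * s))) \<partial>P I))"
    by (intro integral_add_mult_add_sum Bochner_Integration.integrable_add integrable_mult_right
        Bochner_Integration.integrable_diff Bochner_Integration.integrable_sum ints)
  also have "(\<integral>X. (\<Sum>i\<in>I. Re (tr d (Y (X i) * ?V X i ^ (2 * s + 1))) - Re (tr d (?V X i ^ (2 * s + 1)))) \<partial>P I)
      = (\<Sum>i\<in>I. \<integral>X. Re (tr d (Y (X i) * ?V X i ^ (2 * s + 1))) - Re (tr d (?V X i ^ (2 * s + 1))) \<partial>P I)"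
    by (intro Bochner_Integration.integral_sum Bochner_Integration.integrable_diff ints)
  also have "\<dots> = (\<Sum>i\<in>I. 0)"
  proof (rule sum.cong[OF refl])
    fix i assume i: "i \<in> I"
    show "(\<integral>X. Re (tr d (Y (X i) * ?V X i ^ (2 * s + 1))) - Re (tr d (?V X i ^ (2 * s + 1))) \<partial>P I) = 0"
      by (simp only: Bochner_Integration.integral_diff[OF ints(1)[OF i] ints(3)] trl[OF i] rem[OF i] diff_self)
  qed
  also have "(\<integral>X. R * Re (tr d (W 1 I X ^ (2 * s + 1))) + (R + 1) * real (card I) * Re (tr d (W 1 I X ^ (2 * s))) \<partial>P I)
      = R * moment 1 I (2 * s + 1) + (R + 1) * real (card I) * moment 1 I (2 * s)"
    unfolding moment_def
    by (simp only: Bochner_Integration.integral_add integrable_mult_right ints integral_mult_right_zero)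
  also have "(\<Sum>i\<in>I. \<integral>X. R * Re (tr d (Y (X i) * ?V X i ^ (2 * s))) + Re (tr d (?V X i ^ (2 * s))) \<partial>P I)
      = (\<Sum>i\<in>I. (R + 1) * moment 1 (I - {i}) (2 * s))"
  proof (rule sum.cong[OF refl])
    fix i assume i: "i \<in> I"
    show "(\<integral>X. R * Re (tr d (Y (X i) * ?V X i ^ (2 * s))) + Re (tr d (?V X i ^ (2 * s))) \<partial>P I) = (R + 1) * moment 1 (I - {i}) (2 * s)"
      by (simp only: Bochner_Integration.integral_add integrable_mult_right ints(1)[OF i] ints(3)
          integral_mult_right_zero trl[OF i] rem[OF i] distrib_right mult_1)
  qed
  finally show ?thesis by (simp add: sum_distrib_left)
qed

end

section \<open>Moment bounds\<close>

lemma supp_below_app: "preserves d A \<Longrightarrow> supp_below d v \<Longrightarrow> supp_below d (app A v)"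
  by (simp add: preserves_def)

lemma vec_inner_unit: "a < d \<Longrightarrow> vec_inner d u (unit_vector a) = u a"
proof -
  assume "a < d"
  then have "(\<Sum>i<d. u i * cnj (unit_vector a i)) = (\<Sum>i\<in>{a}. u i * cnj (unit_vector a i))"
    by (intro sum.mono_neutral_right) (auto simp: unit_vector_def)
  then show ?thesis by (simp add: vec_inner_def unit_vector_def)
qed

lemma half_le_mono:
  fixes u :: real
  assumes "2 * u \<le> v + w" "v \<le> v'" "w \<le> w'" shows "u \<le> (v' + w') / 2"
  using assms by simp

text \<open>The case of interest is that \<open>M\<close> is the moment of order \<open>2s + 2\<close>, \<open>u\<close> that of order \<open>2s + 1\<close>, and \<open>B\<close>
  a bound for those of order \<open>2s\<close>. On the right-hand side \<open>M\<close> occurs only in \<open>u\<close>, with total factor at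
  most \<open>1/8\<close>, and is absorbed; the other terms add up to at most \<open>7/2 c R n B\<close>.\<close>
lemma centred_recursion_arith:
  fixes M B n c R u x z :: real
  assumes M: "M \<le> c * (R * u + (R + 1) * x + (R + 1) * z)"
    and u: "u \<le> (n * B + M / n) / 2" and x: "x \<le> n * B" and z: "z \<le> n * B"
    and R: "2 \<le> R" and "0 \<le> B" "0 \<le> M" "0 < n" "0 \<le> c" and cR: "c * R \<le> n / 4"
  shows "M \<le> 4 * c * R * (n * B)"
proof -
  define w q where "w = n * B" and "q = M / n"
  have w0: "0 \<le> w" using assms by (simp add: w_def)
  have "R * u + (R + 1) * x + (R + 1) * z \<le> R * ((w + q) / 2) + (R + 1) * w + (R + 1) * w"
    using u x z R by (intro add_mono mult_left_mono) (auto simp: w_def q_def)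
  then have "M \<le> c * (R * ((w + q) / 2) + (R + 1) * w + (R + 1) * w)"
    using M \<open>0 \<le> c\<close> by (meson mult_left_mono order_trans)
  also have "\<dots> = c * R * w / 2 + c * R * q / 2 + 2 * (c * R * w) + c * (2 * w)"
    by (simp add: field_simps)
  also have "c * R * q \<le> n / 4 * q"
    using cR assms by (intro mult_right_mono) (auto simp: q_def)
  also have "n / 4 * q = M / 4" using \<open>0 < n\<close> by (simp add: q_def)
  also have "c * (2 * w) \<le> c * (R * w)"
    using R w0 \<open>0 \<le> c\<close> by (intro mult_left_mono mult_right_mono) auto
  finally have "M \<le> c * R * w / 2 + M / 4 / 2 + 2 * (c * R * w) + c * R * w" by (simp add: mult.assoc)
  then have "M \<le> 4 * (c * R * w)" by linarith
  then show ?thesis by (simp add: w_def mult_ac)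
qed

text \<open>Again \<open>M\<close> is the moment to be bounded and \<open>u\<close> the odd one below it; \<open>x\<close> bounds the odd moment with
  one summand removed, through the bound \<open>b\<close> that is already known for fewer summands. If \<open>M\<close> exceeded
  \<open>b\<close>, then both odd moments would be at most \<open>(a B + M / a) / 2\<close> with \<open>a = \<alpha> + \<beta>\<close>, and \<open>M\<close> would be at most
  \<open>(a\<^sup>2 + 2 \<alpha> \<beta>) B\<close>, which is at most \<open>b\<close>.\<close>
lemma uncentred_recursion_arith:
  fixes M B \<alpha> \<beta> u x b :: real
  assumes M: "M \<le> \<alpha> * x + \<beta> * (u + \<alpha> * B)"
    and x: "x \<le> ((\<alpha> + \<beta>) * B + b / (\<alpha> + \<beta>)) / 2"
    and u: "u \<le> ((\<alpha> + \<beta>) * B + M / (\<alpha> + \<beta>)) / 2"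
    and b: "b = (\<alpha> + 2 * \<beta>)\<^sup>2 * B" and nn: "0 \<le> \<alpha>" "0 < \<beta>" "0 \<le> B"
  shows "M \<le> b"
proof (rule ccontr)
  assume "\<not> M \<le> b"
  then have bM: "b \<le> M" by simp
  define a where "a = \<alpha> + \<beta>"
  have a: "0 < a" using nn by (simp add: a_def)
  have "M \<le> \<alpha> * ((a * B + M / a) / 2) + \<beta> * ((a * B + M / a) / 2 + \<alpha> * B)"
  proof (rule order_trans[OF M], intro add_mono mult_left_mono order_refl)
    have "b / a \<le> M / a" using bM a by (simp add: divide_right_mono)
    then show "x \<le> (a * B + M / a) / 2" using x by (simp add: a_def)
  qed (use u nn in \<open>auto simp: a_def\<close>)
  also have "\<dots> = a * ((a * B + M / a) / 2) + \<alpha> * \<beta> * B"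
    unfolding a_def by (simp only: distrib_left distrib_right mult.assoc mult.left_commute[of \<beta> \<alpha>] add.assoc)
  also have "a * ((a * B + M / a) / 2) = a\<^sup>2 * B / 2 + M / 2" using a by (simp add: field_simps power2_eq_square)
  finally have "M \<le> (a\<^sup>2 + 2 * \<alpha> * \<beta>) * B" by (simp add: field_simps)
  also have "\<dots> \<le> (\<alpha> + 2 * \<beta>)\<^sup>2 * B"
  proof (intro mult_right_mono)
    have "0 \<le> \<beta>\<^sup>2 * 3" by simp
    then show "a\<^sup>2 + 2 * \<alpha> * \<beta> \<le> (\<alpha> + 2 * \<beta>)\<^sup>2" unfolding a_def by (simp add: power2_eq_square algebra_simps)
  qed (use nn in simp)
  finally show False using \<open>\<not> M \<le> b\<close> b by simp
qed

context independent_vectors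
begin

lemma prob_space_P: "prob_space (P I)"
  by (intro prob_space_PiM prob_space_axioms)

lemma vec_inner_W_0:
  assumes "supp_below d v"
  shows "vec_inner d (app (W 0 I X) v) v = of_real (\<Sum>i\<in>I. (cmod (\<Sum>j<d. cnj (y (X i) j) * v j))\<^sup>2)"
proof -
  have "vec_inner d (app (\<Sum>i\<in>I. Y (X i)) v) v = (\<Sum>i\<in>I. vec_inner d (app (Y (X i)) v) v)"
    by (induction I rule: infinite_finite_induct) (simp_all add: vec_inner_def sum.distrib distrib_right)
  then show ?thesis by (simp add: W_def vec_inner_rank_one[OF assms])
qed

lemma vec_inner_W_1:
  assumes "supp_below d v"
  shows "Re (vec_inner d (app (W 1 I X) v) v)
    = (\<Sum>i\<in>I. (cmod (\<Sum>j<d. cnj (y (X i) j) * v j))\<^sup>2) - real (card I) * vec_norm_sq d v"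
proof -
  have "vec_inner d (app (\<Sum>i\<in>I. Y (X i) - 1) v) v
      = (\<Sum>i\<in>I. vec_inner d (app (Y (X i)) v) v - of_real (vec_norm_sq d v))"
    by (induction I rule: infinite_finite_induct)
       (simp_all add: vec_inner_self[symmetric] vec_inner_def sum.distrib sum_subtractf distrib_right left_diff_distrib)
  then show ?thesis by (simp add: W_def vec_inner_rank_one[OF assms] sum_subtractf)
qed

text \<open>\<open>W\<close> is positive semidefinite, hence so are \<open>W\<^sup>2\<^sup>t\<close> and \<open>W\<^sup>2\<^sup>t\<^sup>+\<^sup>1 = W\<^sup>t W W\<^sup>t\<close>.\<close>
lemma Re_diagonal_power_nonneg:
  assumes "a < d" shows "0 \<le> Re (entry (W 0 I X ^ k) a a)"
proof -
  have h: "hermitian_on d (W 0 I X)" by (rule hermitian_W) auto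
  define u where "u t = app (W 0 I X ^ t) (unit_vector a)" for t
  have supp: "supp_below d (u t)" for t
    unfolding u_def by (intro supp_below_app preserves_power adjoint_pair_preserves(1)[OF h] supp_below_unit assms)
  have e: "entry (W 0 I X ^ (t + k)) a a = vec_inner d (u k) (u t)" for t k
  proof -
    have "entry (W 0 I X ^ (t + k)) a a = vec_inner d (app (W 0 I X ^ t) (u k)) (unit_vector a)"
      using assms by (simp add: entry_def vec_inner_unit power_add u_def)
    also have "\<dots> = vec_inner d (u k) (u t)"
      unfolding u_def[of t] using assms supp by (intro vec_inner_adjoint hermitian_on_power h supp_below_unit) auto
    finally show ?thesis .
  qed
  show ?thesis
  proof (cases "even k")
    case True
    then obtain t where "k = t + t" by (metis evenE mult_2)
    then show ?thesis by (simp add: e vec_inner_self)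
  next
    case False
    then obtain t where "k = t + Suc t" by (metis oddE mult_2 Suc_eq_plus1 add_Suc_right)
    moreover have "u (Suc t) = app (W 0 I X) (u t)" by (simp add: u_def)
    ultimately show ?thesis using vec_inner_W_0[OF supp[of t], of I X] by (simp only: e) (simp add: sum_nonneg)
  qed
qed

lemma moment_power_0: "moment c I 0 = real d"
proof -
  show ?thesis by (simp add: moment_def tr_def entry_one prob_space.prob_space[OF prob_space_P])
qed

lemma moment_0_first:
  assumes "finite I" shows "moment 0 I 1 = real (card I) * (\<Sum>a<d. l a)"
proof -
  have "(\<integral>X. Re (tr d (Y (X i) * 1)) \<partial>P I) = (\<Sum>a<d. l a)" if "i \<in> I" for i
  proof -
    show ?thesis
      using integral_insert_rank_one[of "I - {i}" i "\<lambda>_. 1"] that assms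
      by (auto simp: insert_absorb bounded_random_linop_one entry_one prob_space.prob_space[OF prob_space_P] preserves_one)
  qed
  moreover have "moment 0 I 1 = (\<Sum>i\<in>I. \<integral>X. Re (tr d (Y (X i) * 1)) \<partial>P I)"
    unfolding moment_def
    by (simp add: W_def tr_sum)
       (intro Bochner_Integration.integral_sum integrable_Re_tr finite_measure_P bounded_random_linop_Y)
  ultimately show ?thesis by simp
qed

text \<open>Induction on \<open>s\<close>. The condition \<open>4 p R \<le> n\<close> is what lets every step up to order \<open>p\<close> absorb the odd
  moment.\<close>
theorem centred_moment_bound:
  assumes l: "\<And>a. a < d \<Longrightarrow> l a = 1" and R: "2 \<le> R" and p: "4 * real p * R \<le> real n"
    and s: "s \<le> p" and I: "finite I" "card I \<le> n"
  shows "moment 1 I (2 * s) \<le> real d * (4 * real p * real n * R) ^ s"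
  using s I
proof (induction s arbitrary: I)
  case 0
  then show ?case by (simp add: moment_power_0)
next
  case (Suc s)
  define B where "B = real d * (4 * real p * real n * R) ^ s"
  define M where "M = moment 1 I (2 * s + 2)"
  have h1: "hermitian_on d 1" by auto
  have B0: "0 \<le> B" using R by (simp add: B_def)
  have M0: "0 \<le> M" using moment_even_nonneg[OF h1, of I "Suc s"] by (simp add: M_def)
  have sp: "2 * real s + 1 \<le> 2 * real p" using Suc.prems by simp
  have n: "0 < real n"
  proof -
    have "0 < 4 * real p * R" using Suc.prems R by simp
    then show ?thesis using p by linarith
  qed
  let ?c = "(2 * real s + 1) / 2"
  have sum: "(\<Sum>i\<in>I. moment 1 (I - {i}) (2 * s)) \<le> real n * B"
  proof -
    have "(\<Sum>i\<in>I. moment 1 (I - {i}) (2 * s)) \<le> (\<Sum>i\<in>I. B)"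
      using Suc.prems unfolding B_def by (intro sum_mono Suc.IH) (auto simp: card_Diff_singleton_if)
    also have "\<dots> \<le> real n * B" using Suc.prems B0 by (simp add: mult_right_mono)
    finally show ?thesis .
  qed
  have m2: "moment 1 I (2 * s) \<le> B" unfolding B_def using Suc.prems by (intro Suc.IH) auto
  have cm: "real (card I) * moment 1 I (2 * s) \<le> real n * B"
    using m2 moment_even_nonneg[OF h1, of I s] Suc.prems by (intro mult_mono) auto
  have "2 * moment 1 I (2 * s + 1) \<le> real n * moment 1 I (2 * s) + M / real n"
    unfolding M_def using n by (intro moment_odd_le h1)
  moreover have "real n * moment 1 I (2 * s) \<le> real n * B" using m2 n by (intro mult_left_mono) auto
  ultimately have odd: "moment 1 I (2 * s + 1) \<le> (real n * B + M / real n) / 2"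
    by (rule half_le_mono[OF _ _ order_refl])
  have step: "M \<le> ?c * (R * moment 1 I (2 * s + 1) + (R + 1) * (real (card I) * moment 1 I (2 * s))
      + (R + 1) * (\<Sum>i\<in>I. moment 1 (I - {i}) (2 * s)))"
    unfolding M_def using centred_moment_step[OF _ l, of I s] Suc.prems by (simp add: mult.assoc)
  have "(2 * real s + 1) * R \<le> 2 * real p * R" using sp R by (intro mult_right_mono) auto
  moreover have "?c * R = (2 * real s + 1) * R / 2" by simp
  ultimately have cR: "?c * R \<le> real n / 4" using p by linarith
  have "M \<le> 4 * ?c * R * (real n * B)"
    by (rule centred_recursion_arith[OF step odd cm sum R B0 M0 n _ cR]) simp
  also have "\<dots> \<le> 4 * real p * R * (real n * B)"
    using sp R B0 by (intro mult_right_mono) auto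
  finally show ?case by (simp add: M_def B_def mult_ac)
qed

text \<open>The diagonal entries of powers of a positive sum are nonnegative.\<close>
lemma uncentred_trace_le:
  assumes l: "\<And>a. a < d \<Longrightarrow> 0 \<le> l a \<and> l a \<le> \<kappa>"
  shows "(\<integral>X. (\<Sum>a<d. l a * Re (entry (W 0 J X ^ k) a a)) \<partial>P J) \<le> \<kappa> * moment 0 J k"
proof -
  have h0: "hermitian_on d 0" by auto
  note bnd = bounded_random_linop_W_power[OF h0 subset_refl, of J k]
  have "(\<integral>X. (\<Sum>a<d. l a * Re (entry (W 0 J X ^ k) a a)) \<partial>P J)
      \<le> (\<integral>X. \<kappa> * Re (tr d (W 0 J X ^ k)) \<partial>P J)"
  proof (intro integral_mono Bochner_Integration.integrable_sum integrable_mult_right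
      integrable_Re_entry[OF finite_measure_P bnd] integrable_Re_tr[OF finite_measure_P bnd])
    fix X
    have "(\<Sum>a<d. l a * Re (entry (W 0 J X ^ k) a a)) \<le> (\<Sum>a<d. \<kappa> * Re (entry (W 0 J X ^ k) a a))"
      using l Re_diagonal_power_nonneg by (intro sum_mono mult_right_mono) auto
    then show "(\<Sum>a<d. l a * Re (entry (W 0 J X ^ k) a a)) \<le> \<kappa> * Re (tr d (W 0 J X ^ k))"
      by (simp add: tr_def sum_distrib_left)
  qed auto
  then show ?thesis by (simp add: moment_def)
qed

text \<open>The induction on \<open>s\<close> starts with the first moment, which is at most \<open>n T\<close>; in this way the bound
  depends on the trace \<open>T\<close> of the covariance and not on the dimension. In the induction step the
  first-order terms involve moments of the same order with one summand removed, and an inner induction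
  on the number of summands deals with them.\<close>
theorem uncentred_moment_bound:
  assumes l: "\<And>a. a < d \<Longrightarrow> 0 \<le> l a \<and> l a \<le> \<kappa>" and T: "(\<Sum>a<d. l a) \<le> T" and "0 \<le> \<kappa>"
    and s: "s < p" and I: "finite I" "card I \<le> n"
  shows "moment 0 I (2 * s + 2) \<le> real n * T * (real n * \<kappa> + 2 * real p * R) ^ (2 * s + 1)"
  using s I
proof (induction s arbitrary: I)
  case (0 I)
  note I = 0(2,3)
  have lT: "0 \<le> (\<Sum>a<d. l a)" by (intro sum_nonneg) (use l in auto)
  have T0: "0 \<le> T" using lT T by simp
  have m1: "moment 0 J 1 \<le> real n * T" if "J \<subseteq> I" for J
  proof -
    have "card J \<le> n" using that I card_mono le_trans by blast
    then have "real (card J) * (\<Sum>a<d. l a) \<le> real n * T" using lT T by (intro mult_mono) auto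
    then show ?thesis using moment_0_first[of J] finite_subset[OF that I(1)] by simp
  qed
  have first: "(\<integral>X. (\<Sum>a<d. l a * Re (entry (W 0 (I - {i}) X ^ (2 * 0 + 1)) a a)) \<partial>P (I - {i})) \<le> \<kappa> * (real n * T)" for i
  proof -
    have "\<kappa> * moment 0 (I - {i}) 1 \<le> \<kappa> * (real n * T)"
      using m1[of "I - {i}"] \<open>0 \<le> \<kappa>\<close> by (intro mult_left_mono) auto
    then show ?thesis using uncentred_trace_le[OF l, of "I - {i}" 1] by simp
  qed
  have second: "(\<integral>X. (\<Sum>a<d. l a * Re (entry (W 0 (I - {i}) X ^ (2 * 0)) a a)) \<partial>P (I - {i})) \<le> T" for i
    using T by (simp add: entry_one prob_space.prob_space[OF prob_space_P])
  have "moment 0 I (2 * 0 + 2) \<le> (\<Sum>i\<in>I. \<kappa> * (real n * T)) + (2 * real 0 + 1) / 2 * R * (real n * T + (\<Sum>i\<in>I. T))"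
    using R_pos m1[of I]
    by (intro order_trans[OF uncentred_moment_step[OF I(1)]] add_mono mult_left_mono sum_mono first second) auto
  also have "\<dots> = real (card I) * (\<kappa> * (real n * T)) + R / 2 * (real n * T + real (card I) * T)" by simp
  also have "\<dots> \<le> real n * (\<kappa> * (real n * T)) + R / 2 * (real n * T + real n * T)"
    using I T0 \<open>0 \<le> \<kappa>\<close> R_pos by (intro add_mono mult_right_mono mult_left_mono) auto
  also have "\<dots> = real n * T * (real n * \<kappa> + R)" by (simp add: algebra_simps)
  also have "\<dots> \<le> real n * T * (real n * \<kappa> + 2 * real p * R)"
    using T0 R_pos 0(1) by (intro mult_left_mono add_left_mono) auto
  finally show ?case by simp
next
  case (Suc s)
  define \<alpha> \<beta> where "\<alpha> = real n * \<kappa>" and "\<beta> = (2 * real (Suc s) + 1) / 2 * R"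
  define B where "B = real n * T * (real n * \<kappa> + 2 * real p * R) ^ (2 * s + 1)"
  define b where "b = (\<alpha> + 2 * \<beta>)\<^sup>2 * B"
  have "0 \<le> (\<Sum>a<d. l a)" by (intro sum_nonneg) (use l in auto)
  then have T0: "0 \<le> T" using T by simp
  have B0: "0 \<le> B" using T0 R_pos \<open>0 \<le> \<kappa>\<close> by (simp add: B_def)
  have \<alpha>: "0 \<le> \<alpha>" and \<beta>: "0 < \<beta>" using \<open>0 \<le> \<kappa>\<close> R_pos by (auto simp: \<alpha>_def \<beta>_def)
  have h0: "hermitian_on d 0" by auto
  have prev: "moment 0 J (2 * Suc s) \<le> B" if "finite J" "card J \<le> n" for J
    using Suc.IH[OF _ that] Suc.prems(1) by (simp add: B_def)
  have "moment 0 J (2 * Suc s + 2) \<le> b" if "finite J" "card J \<le> n" for J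
    using that
  proof (induction "card J" arbitrary: J rule: less_induct)
    case less
    define M where "M = moment 0 J (2 * Suc s + 2)"
    have odd: "moment 0 J' (2 * Suc s + 1) \<le> ((\<alpha> + \<beta>) * B + moment 0 J' (2 * Suc s + 2) / (\<alpha> + \<beta>)) / 2"
      if J': "finite J'" "card J' \<le> n" for J'
    proof -
      have "(\<alpha> + \<beta>) * moment 0 J' (2 * Suc s) \<le> (\<alpha> + \<beta>) * B"
        using prev[OF J'] \<alpha> \<beta> by (intro mult_left_mono) auto
      moreover have "0 < \<alpha> + \<beta>" using \<alpha> \<beta> by simp
      ultimately show ?thesis by (intro half_le_mono[OF moment_odd_le[OF h0] _ order_refl])
    qed
    define x where "x = ((\<alpha> + \<beta>) * B + b / (\<alpha> + \<beta>)) / 2"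
    have x0: "0 \<le> x" using \<alpha> \<beta> B0 by (simp add: x_def b_def)
    have sub: "finite (J - {i})" "card (J - {i}) \<le> n" "card (J - {i}) < card J" if "i \<in> J" for i
      using less.prems that card_Diff1_less[of J i] by auto
    have first: "(\<integral>X. (\<Sum>a<d. l a * Re (entry (W 0 (J - {i}) X ^ (2 * Suc s + 1)) a a)) \<partial>P (J - {i})) \<le> \<kappa> * x"
      if i: "i \<in> J" for i
    proof -
      have "moment 0 (J - {i}) (2 * Suc s + 2) / (\<alpha> + \<beta>) \<le> b / (\<alpha> + \<beta>)"
        using less.hyps[OF sub(3,1,2)[OF i]] \<alpha> \<beta> by (intro divide_right_mono) auto
      then have "moment 0 (J - {i}) (2 * Suc s + 1) \<le> x"
        using odd[OF sub(1,2)[OF i]] unfolding x_def by (meson add_left_mono divide_right_mono order_trans zero_le_numeral)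
      then have "\<kappa> * moment 0 (J - {i}) (2 * Suc s + 1) \<le> \<kappa> * x"
        using \<open>0 \<le> \<kappa>\<close> by (rule mult_left_mono)
      then show ?thesis using uncentred_trace_le[OF l, of "J - {i}" "2 * Suc s + 1"] by linarith
    qed
    have second: "(\<integral>X. (\<Sum>a<d. l a * Re (entry (W 0 (J - {i}) X ^ (2 * Suc s)) a a)) \<partial>P (J - {i})) \<le> \<kappa> * B"
      if i: "i \<in> J" for i
      using uncentred_trace_le[OF l, of "J - {i}" "2 * Suc s"] mult_left_mono[OF prev[OF sub(1,2)[OF i]] \<open>0 \<le> \<kappa>\<close>]
      by linarith
    have "M \<le> (\<Sum>i\<in>J. \<kappa> * x) + \<beta> * (moment 0 J (2 * Suc s + 1) + (\<Sum>i\<in>J. \<kappa> * B))"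
      unfolding M_def
      by (rule order_trans[OF uncentred_moment_step[OF less.prems(1)]], unfold \<beta>_def[symmetric],
          intro add_mono mult_left_mono sum_mono first second) (use \<beta> in auto)
    also have "\<dots> = real (card J) * (\<kappa> * x) + \<beta> * (moment 0 J (2 * Suc s + 1) + real (card J) * (\<kappa> * B))" by simp
    also have "\<dots> \<le> real n * (\<kappa> * x) + \<beta> * (moment 0 J (2 * Suc s + 1) + real n * (\<kappa> * B))"
      using less.prems x0 B0 \<beta> \<open>0 \<le> \<kappa>\<close> by (intro add_mono mult_right_mono mult_left_mono) auto
    finally have "M \<le> \<alpha> * x + \<beta> * (moment 0 J (2 * Suc s + 1) + \<alpha> * B)" by (simp add: \<alpha>_def mult.assoc)
    then have "M \<le> b"
      by (rule uncentred_recursion_arith[OF _ _ _ b_def \<alpha> \<beta> B0])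
         (use odd[OF less.prems] in \<open>auto simp: x_def M_def\<close>)
    then show ?case by (simp add: M_def)
  qed
  from this[OF Suc.prems(2,3)] have "moment 0 I (2 * Suc s + 2) \<le> b" .
  also have "b \<le> (real n * \<kappa> + 2 * real p * R)\<^sup>2 * B"
    unfolding b_def
  proof (intro mult_right_mono power_mono B0)
    have "2 * real (Suc s) + 1 \<le> 2 * real p" using Suc.prems by simp
    then have "(2 * real (Suc s) + 1) * R \<le> 2 * real p * R" using R_pos by (intro mult_right_mono) auto
    then show "\<alpha> + 2 * \<beta> \<le> real n * \<kappa> + 2 * real p * R" by (simp add: \<alpha>_def \<beta>_def)
  qed (use \<alpha> \<beta> in simp)
  also have "\<dots> = real n * T * (real n * \<kappa> + 2 * real p * R) ^ (2 * Suc s + 1)"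
    by (simp add: B_def power2_eq_square mult_ac)
  finally show ?case .
qed

lemma trace_power_tail:
  assumes "hermitian_on d c" "0 < t"
  shows "{X \<in> space (P I). t \<le> Re (tr d (W c I X ^ (2 * p)))} \<in> sets (P I)"
    and "measure (P I) {X \<in> space (P I). t \<le> Re (tr d (W c I X ^ (2 * p)))} \<le> moment c I (2 * p) / t"
proof -
  note int = integrable_tr_W_power[OF assms(1) subset_refl, of I "2 * p"]
  show "{X \<in> space (P I). t \<le> Re (tr d (W c I X ^ (2 * p)))} \<in> sets (P I)"
    using borel_measurable_integrable[OF int] by measurable
  show "measure (P I) {X \<in> space (P I). t \<le> Re (tr d (W c I X ^ (2 * p)))} \<le> moment c I (2 * p) / t"
    unfolding moment_def
    using Re_tr_power_even_nonneg[OF hermitian_W[OF assms(1)]]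
    by (intro integral_Markov_inequality_measure[OF int sets.top] assms(2)) auto
qed

end

section \<open>Extreme eigenvalues of sample Gram matrices\<close>

context independent_vectors
begin

text \<open>Let \<open>a = 3n/4\<close>. Where \<open>tr W\<^sup>2\<^sup>p < a\<^sup>2\<^sup>p\<close> for the centred sum \<open>W\<close>, the quadratic form of the sum is at
  least \<open>n - 3n/4\<close> times \<open>|v|\<^sup>2\<close>. By Markov's inequality this fails with probability at most
  \<open>d (4 p n R / a\<^sup>2)\<^sup>p\<close>, that is \<open>d (64/9 p R / n)\<^sup>p\<close>, and \<open>64/9\<close> times Euler's number is below \<open>20\<close>.\<close>
theorem sample_gram_lower_bound:
  assumes l: "\<And>a. a < d \<Longrightarrow> l a = 1" and R: "2 \<le> R" and p: "1 \<le> p" "20 * real p * R \<le> real n"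
    and I: "finite I" "card I = n"
  shows "\<exists>E\<in>sets (P I). measure (P I) E \<le> real d * exp (- real p) \<and>
    (\<forall>X\<in>space (P I) - E. \<forall>v. supp_below d v \<longrightarrow>
       real n / 4 * vec_norm_sq d v \<le> (\<Sum>i\<in>I. (cmod (\<Sum>j<d. cnj (y (X i) j) * v j))\<^sup>2))"
proof -
  have h1: "hermitian_on d 1" by auto
  have pR: "0 < real p * R" using p R by simp
  then have n: "0 < real n" using p(2) by linarith
  define a where "a = 3 / 4 * real n"
  have a: "0 < a" using n by (simp add: a_def)
  \<comment> \<open>the exceptional set is measurable by construction, unlike the set where the claim fails for some \<open>v\<close>\<close>
  define E where "E = {X \<in> space (P I). a ^ (2 * p) \<le> Re (tr d (W 1 I X ^ (2 * p)))}"
  note tail = trace_power_tail[OF h1 zero_less_power[OF a, of "2 * p"], of I p, folded E_def]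
  have "measure (P I) E \<le> moment 1 I (2 * p) / a ^ (2 * p)" by (rule tail(2))
  also have "\<dots> \<le> real d * (4 * real p * real n * R) ^ p / a ^ (2 * p)"
    using l R p I a pR by (intro divide_right_mono centred_moment_bound) auto
  also have "\<dots> = real d * (4 * real p * real n * R / a\<^sup>2) ^ p"
    by (simp add: power_divide power_mult)
  also have "4 * real p * real n * R / a\<^sup>2 = 64 / 9 * (real p * R) / real n"
    using n by (simp add: a_def power2_eq_square field_simps)
  also have "real d * (64 / 9 * (real p * R) / real n) ^ p \<le> real d * exp (- 1) ^ p"
  proof (intro mult_left_mono power_mono)
    have e: "exp 1 \<le> (2.8 :: real)" using e_less_272 by simp
    have "64 / 9 * (real p * R) * exp 1 \<le> 64 / 9 * (real p * R) * 2.8"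
      using e pR by (intro mult_left_mono) auto
    also have "\<dots> \<le> 20 * (real p * R)" using less_imp_le[OF pR] by (simp add: mult.commute)
    also have "\<dots> \<le> real n" using p(2) by simp
    finally show "64 / 9 * (real p * R) / real n \<le> exp (- 1)"
      using n by (simp add: exp_minus field_simps)
  qed (use n in \<open>simp_all add: less_imp_le[OF R_pos]\<close>)
  also have "exp (- 1) ^ p = exp (- real p)" by (simp flip: exp_of_nat_mult)
  finally have "measure (P I) E \<le> real d * exp (- real p)" .
  moreover have "real n / 4 * vec_norm_sq d v \<le> (\<Sum>i\<in>I. (cmod (\<Sum>j<d. cnj (y (X i) j) * v j))\<^sup>2)"
    if X: "X \<in> space (P I) - E" and v: "supp_below d v" for X v
  proof -
    have "Re (tr d (W 1 I X ^ (2 * p))) < a ^ (2 * p)" using X by (auto simp: E_def)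
    from quadratic_form_le_of_tr_power[OF hermitian_W[OF h1] a v this]
    have "\<bar>Re (vec_inner d (app (W 1 I X) v) v)\<bar> \<le> 3 / 4 * real n * vec_norm_sq d v"
      by (simp add: a_def)
    then have "real n * vec_norm_sq d v - (\<Sum>i\<in>I. (cmod (\<Sum>j<d. cnj (y (X i) j) * v j))\<^sup>2)
        \<le> 3 / 4 * real n * vec_norm_sq d v"
      unfolding vec_inner_W_1[OF v] I(2) abs_le_iff by linarith
    then show ?thesis by simp
  qed
  ultimately show ?thesis using tail(1) by blast
qed

text \<open>Let \<open>A = n \<kappa> + 2 p R\<close>. Markov's inequality at the threshold \<open>A / \<delta>\<close> gives the probability
  \<open>n T A\<^sup>2\<^sup>p\<^sup>-\<^sup>1 (\<delta> / A)\<^sup>2\<^sup>p = (n T / A) \<delta>\<^sup>2\<^sup>p \<le> n \<delta>\<^sup>2\<^sup>p\<close>. As \<open>\<delta>\<close> is below the inverse of Euler's number, the last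
  term is at most \<open>n \<delta>\<close> times \<open>exp (- p)\<close>, which is at most \<open>\<delta>\<close>.\<close>
theorem sample_gram_upper_bound:
  assumes l: "\<And>a. a < d \<Longrightarrow> 0 \<le> l a \<and> l a \<le> \<kappa>" and T: "(\<Sum>a<d. l a) \<le> T" "0 < T" "T \<le> R"
    and "0 \<le> \<kappa>" and p: "1 \<le> p" "real n \<le> exp (real p)" and \<delta>: "0 < \<delta>" "\<delta> < 1 / 3"
    and I: "finite I" "card I = n"
  shows "\<exists>E\<in>sets (P I). measure (P I) E \<le> \<delta> \<and>
    (\<forall>X\<in>space (P I) - E. \<forall>v. supp_below d v \<longrightarrow>
       (\<Sum>i\<in>I. (cmod (\<Sum>j<d. cnj (y (X i) j) * v j))\<^sup>2)
         \<le> (real n * \<kappa> + 2 * real p * R) / \<delta> * vec_norm_sq d v)"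
proof -
  have h0: "hermitian_on d 0" by auto
  define A where "A = real n * \<kappa> + 2 * real p * R"
  have pR: "0 < 2 * real p * R" using p R_pos by simp
  have A: "0 < A" using pR \<open>0 \<le> \<kappa>\<close> by (simp add: A_def add_nonneg_pos)
  define a where "a = A / \<delta>"
  have a: "0 < a" using A \<delta> by (simp add: a_def)
  define E where "E = {X \<in> space (P I). a ^ (2 * p) \<le> Re (tr d (W 0 I X ^ (2 * p)))}"
  note tail = trace_power_tail[OF h0 zero_less_power[OF a, of "2 * p"], of I p, folded E_def]
  have p2: "2 * (p - 1) + 2 = 2 * p" "2 * (p - 1) + 1 = 2 * p - 1" using p by auto
  have "measure (P I) E \<le> moment 0 I (2 * p) / a ^ (2 * p)" by (rule tail(2))
  also have "\<dots> \<le> real n * T * A ^ (2 * p - 1) / a ^ (2 * p)"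
  proof (intro divide_right_mono)
    have "moment 0 I (2 * (p - 1) + 2) \<le> real n * T * A ^ (2 * (p - 1) + 1)"
      unfolding A_def using p I by (intro uncentred_moment_bound[OF l T(1) \<open>0 \<le> \<kappa>\<close>]) auto
    then show "moment 0 I (2 * p) \<le> real n * T * A ^ (2 * p - 1)" unfolding p2 .
  qed (use a in simp)
  also have "\<dots> = real n * T / A * \<delta> ^ (2 * p)"
  proof -
    have "A ^ (2 * p) = A * A ^ (2 * p - 1)" using p by (simp flip: power_Suc)
    then show ?thesis using A \<delta> by (simp add: a_def power_divide field_simps)
  qed
  also have "\<dots> \<le> real n * \<delta> ^ (2 * p)"
  proof (intro mult_right_mono)
    have "2 * R \<le> 2 * real p * R" using p R_pos by (intro mult_right_mono) auto
    moreover have "0 \<le> real n * \<kappa>" using \<open>0 \<le> \<kappa>\<close> by simp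
    ultimately have "T \<le> A" using T R_pos unfolding A_def by linarith
    then have "T / A \<le> 1" using A by simp
    then have "real n * (T / A) \<le> real n * 1" by (intro mult_left_mono) auto
    then show "real n * T / A \<le> real n" by simp
  qed (use \<delta> in simp)
  also have "\<dots> \<le> \<delta>"
  proof -
    have e: "\<delta> \<le> exp (- 1)"
    proof -
      have "(exp 1 :: real) \<le> 3" using e_less_272 by simp
      then have "1 / 3 \<le> (exp (- 1) :: real)" by (simp add: exp_minus field_simps)
      then show ?thesis using \<delta> by simp
    qed
    have "\<delta> ^ (2 * p) = \<delta> * \<delta> ^ (2 * p - 1)" using p by (simp flip: power_Suc)
    also have "\<delta> ^ (2 * p - 1) \<le> \<delta> ^ p" using p \<delta> by (intro power_decreasing) auto
    also have "\<delta> ^ p \<le> exp (- 1) ^ p" using \<delta> e by (intro power_mono) auto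
    also have "exp (- 1) ^ p = exp (- real p)" by (simp flip: exp_of_nat_mult)
    finally have "\<delta> ^ (2 * p) \<le> \<delta> * exp (- real p)" using \<delta> by (simp add: mult_left_mono)
    then have "real n * \<delta> ^ (2 * p) \<le> exp (real p) * (\<delta> * exp (- real p))"
      using p \<delta> by (intro mult_mono) auto
    also have "\<dots> = \<delta>" by (simp add: exp_minus field_simps)
    finally show ?thesis .
  qed
  finally have "measure (P I) E \<le> \<delta>" .
  moreover have "(\<Sum>i\<in>I. (cmod (\<Sum>j<d. cnj (y (X i) j) * v j))\<^sup>2) \<le> A / \<delta> * vec_norm_sq d v"
    if X: "X \<in> space (P I) - E" and v: "supp_below d v" for X v
  proof -
    have "Re (tr d (W 0 I X ^ (2 * p))) < a ^ (2 * p)" using X by (auto simp: E_def)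
    from quadratic_form_le_of_tr_power[OF hermitian_W[OF h0] a v this]
    show ?thesis unfolding vec_inner_W_0[OF v] by (simp add: a_def abs_le_iff)
  qed
  ultimately show ?thesis using tail(1) by (auto simp: A_def)
qed

end

section \<open>Semi-inner products\<close>

lemma fscale_apply: "fscale c f x = c * f x" by (simp add: fscale_def)

text \<open>This covers the inner product of the Hilbert space as well as the \<open>L\<^sub>2\<close> form on it, which may vanish
  at nonzero functions.\<close>
locale semi_inner_product =
  fixes H :: "('a \<Rightarrow> complex) set" and B :: "('a \<Rightarrow> complex) \<Rightarrow> ('a \<Rightarrow> complex) \<Rightarrow> complex"
  assumes subspace: "cfun.subspace H"
    and add_left: "f \<in> H \<Longrightarrow> g \<in> H \<Longrightarrow> h \<in> H \<Longrightarrow> B (f + g) h = B f h + B g h"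
    and scale_left: "f \<in> H \<Longrightarrow> g \<in> H \<Longrightarrow> B (fscale c f) g = c * B f g"
    and commute: "f \<in> H \<Longrightarrow> g \<in> H \<Longrightarrow> B g f = cnj (B f g)"
    and nonneg: "f \<in> H \<Longrightarrow> 0 \<le> Re (B f f)"
begin

definition norm_sq :: "('a \<Rightarrow> complex) \<Rightarrow> real" where "norm_sq f = Re (B f f)"

lemma mem_add: "f \<in> H \<Longrightarrow> g \<in> H \<Longrightarrow> f + g \<in> H" by (rule cfun.subspace_add[OF subspace])
lemma mem_diff: "f \<in> H \<Longrightarrow> g \<in> H \<Longrightarrow> f - g \<in> H" by (rule cfun.subspace_diff[OF subspace])
lemma mem_scale: "f \<in> H \<Longrightarrow> fscale c f \<in> H" by (rule cfun.subspace_scale[OF subspace])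
lemma mem_zero: "0 \<in> H" by (rule cfun.subspace_0[OF subspace])
lemma mem_sum: "(\<And>i. i \<in> S \<Longrightarrow> f i \<in> H) \<Longrightarrow> (\<Sum>i\<in>S. f i) \<in> H"
  by (rule cfun.subspace_sum[OF subspace])

lemma add_right: "f \<in> H \<Longrightarrow> g \<in> H \<Longrightarrow> h \<in> H \<Longrightarrow> B f (g + h) = B f g + B f h"
  using commute[of "g + h" f] commute[of g f] commute[of h f] by (simp add: add_left mem_add)
lemma scale_right: "f \<in> H \<Longrightarrow> g \<in> H \<Longrightarrow> B f (fscale c g) = cnj c * B f g"
  using commute[of "fscale c g" f] commute[of g f] by (simp add: scale_left mem_scale)
lemma zero_left: "g \<in> H \<Longrightarrow> B 0 g = 0"
  using scale_left[of 0 g 0] mem_zero by (simp add: fscale_def zero_fun_def)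
lemma zero_right: "g \<in> H \<Longrightarrow> B g 0 = 0"
  using commute[of 0 g] mem_zero zero_left[of g] by simp
lemma diff_left: "f \<in> H \<Longrightarrow> g \<in> H \<Longrightarrow> h \<in> H \<Longrightarrow> B (f - g) h = B f h - B g h"
  using add_left[of "f - g" g h] by (simp add: mem_diff)
lemma diff_right: "f \<in> H \<Longrightarrow> g \<in> H \<Longrightarrow> h \<in> H \<Longrightarrow> B f (g - h) = B f g - B f h"
  using add_right[of f "g - h" h] by (simp add: mem_diff)
lemma sum_left: "(\<And>i. i \<in> S \<Longrightarrow> f i \<in> H) \<Longrightarrow> g \<in> H \<Longrightarrow> B (\<Sum>i\<in>S. f i) g = (\<Sum>i\<in>S. B (f i) g)"
  by (induction S rule: infinite_finite_induct) (simp_all add: zero_left add_left mem_sum)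
lemma sum_right: "(\<And>i. i \<in> S \<Longrightarrow> f i \<in> H) \<Longrightarrow> g \<in> H \<Longrightarrow> B g (\<Sum>i\<in>S. f i) = (\<Sum>i\<in>S. B g (f i))"
  by (induction S rule: infinite_finite_induct) (simp_all add: zero_right add_right mem_sum)

lemma self_eq_norm_sq: "f \<in> H \<Longrightarrow> B f f = of_real (norm_sq f)"
  using commute[of f f] by (simp add: norm_sq_def complex_eq_iff)
lemma norm_sq_nonneg: "f \<in> H \<Longrightarrow> 0 \<le> norm_sq f" by (simp add: norm_sq_def nonneg)
lemma norm_sq_scale: "f \<in> H \<Longrightarrow> norm_sq (fscale c f) = (cmod c)\<^sup>2 * norm_sq f"
proof -
  assume f: "f \<in> H"
  have "B (fscale c f) (fscale c f) = c * cnj c * B f f" using f by (simp add: scale_left scale_right mem_scale)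
  also have "c * cnj c = of_real ((cmod c)\<^sup>2)" by (simp only: complex_norm_square)
  finally show ?thesis unfolding norm_sq_def by (simp del: of_real_power)
qed
lemma norm_sq_add: "f \<in> H \<Longrightarrow> g \<in> H \<Longrightarrow> norm_sq (f + g) = norm_sq f + 2 * Re (B f g) + norm_sq g"
  using commute[of f g] by (simp add: norm_sq_def add_left add_right mem_add)
lemma norm_sq_diff: "f \<in> H \<Longrightarrow> g \<in> H \<Longrightarrow> norm_sq (f - g) = norm_sq f - 2 * Re (B f g) + norm_sq g"
  using commute[of f g] by (simp add: norm_sq_def diff_left diff_right mem_diff)
lemma norm_sq_diff_commute: "f \<in> H \<Longrightarrow> g \<in> H \<Longrightarrow> norm_sq (f - g) = norm_sq (g - f)"
  using commute[of f g] by (simp add: norm_sq_diff)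

lemma Cauchy_Schwarz:
  assumes f: "f \<in> H" and g: "g \<in> H"
  shows "(cmod (B f g))\<^sup>2 \<le> norm_sq f * norm_sq g"
proof -
  have key: "2 * s * (cmod (B f g))\<^sup>2 \<le> norm_sq f + s\<^sup>2 * (cmod (B f g))\<^sup>2 * norm_sq g" for s :: real
  proof -
    let ?t = "of_real s * B f g"
    have "0 \<le> norm_sq (f - fscale ?t g)" using f g by (intro norm_sq_nonneg mem_diff mem_scale)
    also have "\<dots> = norm_sq f - 2 * Re (cnj ?t * B f g) + (cmod ?t)\<^sup>2 * norm_sq g"
      using f g by (simp add: norm_sq_diff mem_scale scale_right norm_sq_scale)
    also have "cnj ?t * B f g = of_real (s * (cmod (B f g))\<^sup>2)"
      by (simp add: complex_norm_square mult_ac flip: of_real_power)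
    finally show ?thesis by (simp add: norm_mult power_mult_distrib)
  qed
  show ?thesis
  proof (cases "norm_sq g = 0")
    case True
    have "cmod (B f g) = 0"
    proof (rule ccontr)
      assume "cmod (B f g) \<noteq> 0"
      then show False
        using key[of "(norm_sq f + 1) / (cmod (B f g))\<^sup>2"] True norm_sq_nonneg[OF f] by simp
    qed
    then show ?thesis using True by simp
  next
    case False
    then have "0 < norm_sq g" using norm_sq_nonneg[OF g] by simp
    then show ?thesis using key[of "1 / norm_sq g"] by (simp add: field_simps power2_eq_square)
  qed
qed

lemma cmod_le_sqrt: "f \<in> H \<Longrightarrow> g \<in> H \<Longrightarrow> cmod (B f g) \<le> sqrt (norm_sq f) * sqrt (norm_sq g)"
  using Cauchy_Schwarz[of f g] by (metis real_le_rsqrt real_sqrt_mult)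

lemma sqrt_norm_sq_triangle:
  assumes "f \<in> H" "g \<in> H" shows "sqrt (norm_sq (f + g)) \<le> sqrt (norm_sq f) + sqrt (norm_sq g)"
proof (rule real_le_lsqrt)
  have "Re (B f g) \<le> sqrt (norm_sq f) * sqrt (norm_sq g)"
    using cmod_le_sqrt[OF assms] complex_Re_le_cmod order_trans by blast
  then show "norm_sq (f + g) \<le> (sqrt (norm_sq f) + sqrt (norm_sq g))\<^sup>2"
    using assms norm_sq_nonneg by (simp add: norm_sq_add power2_sum)
qed (use assms norm_sq_nonneg in auto)

end

section \<open>Hilbert spaces of functions\<close>

context function_hilbert_space
begin

sublocale ip: semi_inner_product H ip
proof
  fix f g assume "f \<in> H"
  show "0 \<le> Re (ip f f)"
  proof (cases "f = 0")
    case True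
    have "ip (fscale 0 f) f = 0" using ip_scale_left[OF \<open>f \<in> H\<close> \<open>f \<in> H\<close>, of 0] by simp
    moreover have "fscale 0 f = f" using True by (simp add: fscale_def zero_fun_def)
    ultimately show ?thesis by simp
  qed (use ip_pos[OF \<open>f \<in> H\<close>] in simp)
qed (fact subspace ip_add_left ip_scale_left ip_commute)+

lemma hnorm_eq: "hnorm ip f = sqrt (ip.norm_sq f)" by (simp add: hnorm_def ip.norm_sq_def)
lemma hnorm_power2: "f \<in> H \<Longrightarrow> (hnorm ip f)\<^sup>2 = ip.norm_sq f" by (simp add: hnorm_eq ip.norm_sq_nonneg)
lemma hnorm_nonneg: "f \<in> H \<Longrightarrow> 0 \<le> hnorm ip f" by (simp add: hnorm_eq ip.norm_sq_nonneg)
lemma norm_sq_eq_0D: "f \<in> H \<Longrightarrow> ip.norm_sq f = 0 \<Longrightarrow> f = 0"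
  using ip_pos[of f] by (auto simp: ip.norm_sq_def)

lemma tendsto_ip_left:
  assumes "\<And>i. s i \<in> H" "f \<in> H" "g \<in> H" "(\<lambda>i. hnorm ip (s i - f)) \<longlonglongrightarrow> 0"
  shows "(\<lambda>i. ip (s i) g) \<longlonglongrightarrow> ip f g"
proof -
  have "(\<lambda>i. ip (s i) g - ip f g) \<longlonglongrightarrow> 0"
  proof (rule Lim_null_comparison[where g="\<lambda>i. hnorm ip (s i - f) * hnorm ip g"])
    show "\<forall>\<^sub>F i in sequentially. norm (ip (s i) g - ip f g) \<le> hnorm ip (s i - f) * hnorm ip g"
      using assms ip.cmod_le_sqrt[of "s _ - f" g]
      by (intro always_eventually allI) (simp add: hnorm_eq ip.diff_left ip.mem_diff)
    show "(\<lambda>i. hnorm ip (s i - f) * hnorm ip g) \<longlonglongrightarrow> 0"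
      using tendsto_mult_right[OF assms(4), of "hnorm ip g"] by simp
  qed
  then show ?thesis by (simp add: LIM_zero_iff)
qed

lemma tendsto_ip_right:
  assumes "\<And>i. s i \<in> H" "f \<in> H" "g \<in> H" "(\<lambda>i. hnorm ip (s i - f)) \<longlonglongrightarrow> 0"
  shows "(\<lambda>i. ip g (s i)) \<longlonglongrightarrow> ip g f"
  using tendsto_cnj[OF tendsto_ip_left[OF assms]] assms(1-3)
  by (simp flip: ip_commute)

lemma tendsto_norm_sq:
  assumes "\<And>i. s i \<in> H" "f \<in> H" "(\<lambda>i. hnorm ip (s i - f)) \<longlonglongrightarrow> 0"
  shows "(\<lambda>i. ip.norm_sq (s i)) \<longlonglongrightarrow> ip.norm_sq f"
proof -
  have e: "ip.norm_sq (s i) = (hnorm ip (s i - f))\<^sup>2 + 2 * Re (ip (s i) f) - ip.norm_sq f" for i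
    using assms(1)[of i] assms(2) by (simp add: hnorm_power2 ip.mem_diff ip.norm_sq_diff)
  have "(\<lambda>i. (hnorm ip (s i - f))\<^sup>2 + 2 * Re (ip (s i) f) - ip.norm_sq f) \<longlonglongrightarrow> 0\<^sup>2 + 2 * Re (ip f f) - ip.norm_sq f"
    by (intro tendsto_intros assms tendsto_ip_left)
  moreover have "0\<^sup>2 + 2 * Re (ip f f) - ip.norm_sq f = ip.norm_sq f" by (simp add: ip.norm_sq_def)
  ultimately show ?thesis by (simp only: e)
qed

text \<open>The representing element minimises \<open>J u = |u|\<^sup>2 - 2 Re (\<phi> u)\<close>: by the parallelogram law a minimising
  sequence is Cauchy, and the first variation of \<open>J\<close> at its limit is the claim.\<close>
lemma Riesz_representation:
  assumes add: "\<And>f g. f \<in> H \<Longrightarrow> g \<in> H \<Longrightarrow> \<phi> (f + g) = \<phi> f + \<phi> g"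
    and scale: "\<And>c f. f \<in> H \<Longrightarrow> \<phi> (fscale c f) = c * \<phi> f"
    and bound: "\<And>f. f \<in> H \<Longrightarrow> (cmod (\<phi> f))\<^sup>2 \<le> C * ip.norm_sq f"
  shows "\<exists>u\<in>H. \<forall>h\<in>H. \<phi> h = ip h u"
proof -
  define J where "J u = ip.norm_sq u - 2 * Re (\<phi> u)" for u
  have "- \<bar>C\<bar> \<le> J u" if u: "u \<in> H" for u
  proof -
    have "2 * Re (\<phi> u) \<le> 2 * (sqrt \<bar>C\<bar> * sqrt (ip.norm_sq u))"
    proof -
      have "(cmod (\<phi> u))\<^sup>2 \<le> \<bar>C\<bar> * ip.norm_sq u"
        using bound[OF u] ip.norm_sq_nonneg[OF u] by (meson abs_ge_self mult_right_mono order_trans)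
      then have "cmod (\<phi> u) \<le> sqrt (\<bar>C\<bar> * ip.norm_sq u)" by (rule real_le_rsqrt)
      then show ?thesis using complex_Re_le_cmod[of "\<phi> u"] by (simp add: real_sqrt_mult)
    qed
    also have "\<dots> \<le> \<bar>C\<bar> + ip.norm_sq u"
      using sum_squares_bound[of "sqrt \<bar>C\<bar>" "sqrt (ip.norm_sq u)"] ip.norm_sq_nonneg[OF u] by simp
    finally show ?thesis by (simp add: J_def)
  qed
  then have bdd: "bdd_below (J ` H)" by (intro bdd_belowI2)
  define j where "j = Inf (J ` H)"
  have j: "j \<le> J u" if "u \<in> H" for u unfolding j_def using that bdd by (intro cINF_lower)
  have "\<exists>u\<in>H. J u < j + inverse (real (Suc i))" for i
  proof -
    have "Inf (J ` H) < j + inverse (real (Suc i))" by (simp add: j_def)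
    then show ?thesis using cInf_less_iff[OF _ bdd] ip.mem_zero by auto
  qed
  then obtain s where s: "\<And>i. s i \<in> H" and sJ: "\<And>i. J (s i) < j + inverse (real (Suc i))" by metis
  \<comment> \<open>the parallelogram law\<close>
  have half: "ip.norm_sq (u - v) \<le> 2 * J u + 2 * J v - 4 * j" if "u \<in> H" "v \<in> H" for u v
  proof -
    have "j \<le> J (fscale (1/2) (u + v))" using that by (intro j ip.mem_scale ip.mem_add)
    also have "\<dots> = ip.norm_sq (u + v) / 4 - Re (\<phi> u + \<phi> v)"
    proof -
      have e: "\<phi> (fscale (1/2) (u + v)) = (1/2) * (\<phi> u + \<phi> v)"
        using that by (simp only: scale add ip.mem_add)
      have n: "ip.norm_sq (fscale (1/2) (u + v)) = ip.norm_sq (u + v) / 4"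
        using ip.norm_sq_scale[OF ip.mem_add[OF that], of "1/2"] by (simp only: norm_divide) (simp add: power2_eq_square)
      show ?thesis unfolding J_def e n by (simp add: field_simps)
    qed
    finally have "4 * j \<le> ip.norm_sq (u + v) - 4 * Re (\<phi> u + \<phi> v)" by simp
    then show ?thesis unfolding J_def ip.norm_sq_add[OF that] ip.norm_sq_diff[OF that] plus_complex.sel
      by (simp add: algebra_simps)
  qed
  have "\<forall>\<epsilon>>0. \<exists>N. \<forall>i\<ge>N. \<forall>k\<ge>N. hnorm ip (s i - s k) < \<epsilon>"
  proof (intro allI impI)
    fix \<epsilon> :: real assume "0 < \<epsilon>"
    then obtain N where N: "inverse (real (Suc N)) < \<epsilon>\<^sup>2 / 4" using reals_Archimedean[of "\<epsilon>\<^sup>2 / 4"] by auto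
    have "hnorm ip (s i - s k) < \<epsilon>" if "N \<le> i" "N \<le> k" for i k
    proof -
      have "inverse (real (Suc i)) \<le> inverse (real (Suc N))" "inverse (real (Suc k)) \<le> inverse (real (Suc N))"
        using that by (auto intro!: le_imp_inverse_le)
      then have "ip.norm_sq (s i - s k) < \<epsilon>\<^sup>2"
        using half[OF s[of i] s[of k]] sJ[of i] sJ[of k] N by linarith
      then show ?thesis unfolding hnorm_eq using \<open>0 < \<epsilon>\<close> by (intro real_less_lsqrt) auto
    qed
    then show "\<exists>N. \<forall>i\<ge>N. \<forall>k\<ge>N. hnorm ip (s i - s k) < \<epsilon>" by blast
  qed
  then obtain u where u: "u \<in> H" and lim: "(\<lambda>i. hnorm ip (s i - u)) \<longlonglongrightarrow> 0" using complete s by blast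
  have var: "0 \<le> 2 * Re (ip g u - \<phi> g) + ip.norm_sq g" if g: "g \<in> H" for g
  proof (rule LIMSEQ_le)
    have "(\<lambda>i. 2 * Re (ip g (s i) - \<phi> g) + ip.norm_sq g + inverse (real (Suc i)))
        \<longlonglongrightarrow> 2 * Re (ip g u - \<phi> g) + ip.norm_sq g + 0"
      by (intro tendsto_intros tendsto_ip_right s u g lim LIMSEQ_inverse_real_of_nat)
    then show "(\<lambda>i. 2 * Re (ip g (s i) - \<phi> g) + ip.norm_sq g + inverse (real (Suc i)))
        \<longlonglongrightarrow> 2 * Re (ip g u - \<phi> g) + ip.norm_sq g" by simp
    have "0 \<le> 2 * Re (ip g (s i) - \<phi> g) + ip.norm_sq g + inverse (real (Suc i))" for i
      using j[OF ip.mem_add[OF g s[of i]]] sJ[of i] g s[of i]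
      by (simp add: J_def ip.norm_sq_add add)
    then show "\<exists>N. \<forall>i\<ge>N. 0 \<le> 2 * Re (ip g (s i) - \<phi> g) + ip.norm_sq g + inverse (real (Suc i))" by blast
  qed (rule tendsto_const)
  have "\<phi> h = ip h u" if h: "h \<in> H" for h
  proof (rule ccontr)
    assume "\<phi> h \<noteq> ip h u"
    define b where "b = ip h u - \<phi> h"
    have b: "0 < (cmod b)\<^sup>2" using \<open>\<phi> h \<noteq> ip h u\<close> by (simp add: b_def)
    \<comment> \<open>a multiple \<open>c h\<close> along which \<open>J\<close> would decrease: the first-order gain is \<open>2 t |b|\<^sup>2\<close>, and \<open>t\<close> is so small that the second-order term stays below it\<close>
    define t where "t = 1 / (ip.norm_sq h + 1)"
    have t: "0 < t" "t * ip.norm_sq h < 1" using ip.norm_sq_nonneg[OF h] by (auto simp: t_def field_simps)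
    define c where "c = - of_real t * cnj b"
    have "ip (fscale c h) u - \<phi> (fscale c h) = c * b"
      using h u by (simp add: ip.scale_left scale b_def right_diff_distrib)
    also have "c * b = of_real (- t * (cmod b)\<^sup>2)"
      by (simp add: c_def complex_norm_square[of b] mult_ac del: of_real_power)
    finally have "0 \<le> 2 * (- t * (cmod b)\<^sup>2) + (cmod c)\<^sup>2 * ip.norm_sq h"
      using var[OF ip.mem_scale[OF h, of c]] h by (simp add: ip.norm_sq_scale del: of_real_mult of_real_power)
    also have "\<dots> = t * (cmod b)\<^sup>2 * (t * ip.norm_sq h - 2)"
      by (simp add: c_def norm_mult power2_eq_square algebra_simps)
    also have "\<dots> < 0" using t b by (intro mult_pos_neg) auto
    finally show False by simp
  qed
  then show ?thesis using u by blast
qed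

end

section \<open>The embedding of a reproducing kernel Hilbert space into L2\<close>

lemma Re_mult_cnj: "Re (z * cnj z) = (cmod z)\<^sup>2"
  by (simp only: cmod_power2) (simp add: power2_eq_square)

locale embedded_rkhs = reproducing_kernel_hilbert_space D K H ip
  for D :: "'a set" and K and H :: "('a \<Rightarrow> complex) set" and ip +
  fixes M :: "'a measure"
  assumes sigma_finite: "sigma_finite_measure M"
    and space_M: "space M = D"
    and measurable_H: "H \<subseteq> borel_measurable M"
    and separable: "separable_hilbert H ip"
    and finite_trace: "(\<integral>\<^sup>+x. ennreal (Re (K x x)) \<partial>M) < \<infinity>"
begin

definition ks :: "'a \<Rightarrow> 'a \<Rightarrow> complex" where "ks x = kernel_section D K x"

lemma ks_mem: "x \<in> D \<Longrightarrow> ks x \<in> H" by (simp add: ks_def section_in)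
lemma eval_eq: "f \<in> H \<Longrightarrow> x \<in> D \<Longrightarrow> f x = ip f (ks x)" by (simp add: ks_def reproducing)
lemma norm_sq_ks: "x \<in> D \<Longrightarrow> ip.norm_sq (ks x) = Re (K x x)"
  using eval_eq[OF ks_mem, of x x] by (simp add: ip.norm_sq_def ks_def kernel_section_def)
lemma kernel_diag_nonneg: "x \<in> D \<Longrightarrow> 0 \<le> Re (K x x)"
  using ip.norm_sq_nonneg[OF ks_mem, of x] by (simp add: norm_sq_ks)

lemma eval_bound: "f \<in> H \<Longrightarrow> x \<in> D \<Longrightarrow> (cmod (f x))\<^sup>2 \<le> ip.norm_sq f * Re (K x x)"
  using ip.Cauchy_Schwarz[of f "ks x"] by (simp add: ks_mem norm_sq_ks flip: eval_eq)

lemma tendsto_eval: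
  assumes "\<And>i. s i \<in> H" "f \<in> H" "(\<lambda>i. hnorm ip (s i - f)) \<longlonglongrightarrow> 0"
  shows "(\<lambda>i. s i x) \<longlonglongrightarrow> f x"
proof (cases "x \<in> D")
  case True
  then show ?thesis
    using tendsto_ip_left[OF assms(1,2) ks_mem assms(3)] assms(1,2) by (simp flip: eval_eq)
next
  case False
  then show ?thesis by (simp add: vanish_outside[OF assms(1)] vanish_outside[OF assms(2)])
qed

definition dense_sequence :: "(nat \<Rightarrow> 'a \<Rightarrow> complex) \<Rightarrow> bool" where
  "dense_sequence c \<longleftrightarrow> (\<forall>i. c i \<in> H) \<and> (\<forall>f\<in>H. \<forall>\<epsilon>>0. \<exists>i. hnorm ip (f - c i) < \<epsilon>)"

lemma dense_sequence_mem: "dense_sequence c \<Longrightarrow> c i \<in> H" by (simp add: dense_sequence_def)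

lemma dense_sequence_ex: "\<exists>c. dense_sequence c"
proof -
  obtain C where C: "countable C" "C \<subseteq> H" "\<forall>f\<in>H. \<forall>\<epsilon>>0. \<exists>g\<in>C. hnorm ip (f - g) < \<epsilon>"
    using separable unfolding separable_hilbert_def by (elim exE conjE)
  have ne: "C \<noteq> {}" using C(3)[rule_format, OF ip.mem_zero, of 1] by auto
  have "dense_sequence (from_nat_into C)"
    unfolding dense_sequence_def
  proof (intro conjI allI ballI impI)
    show "from_nat_into C i \<in> H" for i using from_nat_into[OF ne] C(2) by blast
    show "\<exists>i. hnorm ip (f - from_nat_into C i) < \<epsilon>" if "f \<in> H" "0 < \<epsilon>" for f \<epsilon>
    proof -
      obtain g where g: "g \<in> C" "hnorm ip (f - g) < \<epsilon>"
        using C(3)[rule_format, OF \<open>f \<in> H\<close> \<open>0 < \<epsilon>\<close>] by (rule bexE)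
      obtain i where "from_nat_into C i = g" using from_nat_into_surj[OF C(1) g(1)] by (rule exE)
      then show ?thesis using g(2) by (intro exI[of _ i]) simp
    qed
  qed
  then show ?thesis by blast
qed

lemma approximating_sequence:
  assumes dense: "dense_sequence c" and f: "f \<in> H"
  obtains r :: "nat \<Rightarrow> nat" where "(\<lambda>i. hnorm ip (c (r i) - f)) \<longlonglongrightarrow> 0"
proof -
  note c = dense_sequence_mem[OF dense]
  have "\<exists>k. hnorm ip (f - c k) < inverse (real (Suc i))" for i
    using dense f by (simp add: dense_sequence_def)
  then obtain r where r: "\<And>i. hnorm ip (f - c (r i)) < inverse (real (Suc i))" by metis
  have "(\<lambda>i. hnorm ip (c (r i) - f)) \<longlonglongrightarrow> 0"
  proof (rule Lim_null_comparison[OF _ LIMSEQ_inverse_real_of_nat], intro always_eventually allI)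
    fix i
    have "hnorm ip (c (r i) - f) = hnorm ip (f - c (r i))"
      using f c by (simp add: hnorm_eq ip.norm_sq_diff_commute[of f])
    then show "norm (hnorm ip (c (r i) - f)) \<le> inverse (real (Suc i))"
      using r[of i] hnorm_nonneg[OF ip.mem_diff[OF c f], of "r i"] by simp
  qed
  then show thesis by (rule that)
qed

lemma measurable_mem: "f \<in> H \<Longrightarrow> f \<in> borel_measurable M" using measurable_H by blast

text \<open>\<open>K(x, x)\<close> is the squared norm of the evaluation at \<open>x\<close>, hence the supremum of \<open>|f(x)|\<^sup>2 / |f|\<^sup>2\<close> over a
  dense sequence of functions \<open>f\<close>.\<close>
lemma kernel_diag_measurable: "(\<lambda>x. Re (K x x)) \<in> borel_measurable M"
proof -
  obtain c where dense: "dense_sequence c" using dense_sequence_ex by blast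
  note c = dense_sequence_mem[OF dense]
  have "{x \<in> space M. t < Re (K x x)} \<in> sets M" for t
  proof (cases "t < 0")
    case True
    then have "{x \<in> space M. t < Re (K x x)} = space M"
      using kernel_diag_nonneg space_M by force
    then show ?thesis by simp
  next
    case False
    have "{x \<in> space M. t < Re (K x x)} = (\<Union>i. {x \<in> space M. t * ip.norm_sq (c i) < (cmod (c i x))\<^sup>2})"
    proof (intro equalityI subsetI)
      fix x assume "x \<in> {x \<in> space M. t < Re (K x x)}"
      then have x: "x \<in> D" "t < Re (K x x)" by (auto simp: space_M)
      obtain r where r: "(\<lambda>i. hnorm ip (c (r i) - ks x)) \<longlonglongrightarrow> 0"
        using approximating_sequence[OF dense ks_mem[OF x(1)]] by blast
      have "(\<lambda>i. (cmod (c (r i) x))\<^sup>2 - t * ip.norm_sq (c (r i))) \<longlonglongrightarrow> (cmod (ks x x))\<^sup>2 - t * ip.norm_sq (ks x)"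
        using r c x by (intro tendsto_intros tendsto_eval tendsto_norm_sq ks_mem) auto
      moreover have "ks x x = of_real (Re (K x x))"
        using eval_eq[OF ks_mem[OF x(1)] x(1)] ip.self_eq_norm_sq[OF ks_mem[OF x(1)]] norm_sq_ks[OF x(1)] by simp
      then have "0 < (cmod (ks x x))\<^sup>2 - t * ip.norm_sq (ks x)"
        using x False by (simp add: norm_sq_ks power2_eq_square flip: left_diff_distrib)
      ultimately have "\<forall>\<^sub>F i in sequentially. 0 < (cmod (c (r i) x))\<^sup>2 - t * ip.norm_sq (c (r i))"
        by (rule order_tendstoD(1))
      then obtain i where "0 < (cmod (c (r i) x))\<^sup>2 - t * ip.norm_sq (c (r i))"
        by (auto simp: eventually_sequentially)
      then show "x \<in> (\<Union>i. {x \<in> space M. t * ip.norm_sq (c i) < (cmod (c i x))\<^sup>2})"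
        using x by (auto simp: space_M)
    next
      fix x assume "x \<in> (\<Union>i. {x \<in> space M. t * ip.norm_sq (c i) < (cmod (c i x))\<^sup>2})"
      then obtain i where x: "x \<in> D" "t * ip.norm_sq (c i) < (cmod (c i x))\<^sup>2" by (auto simp: space_M)
      then have "t * ip.norm_sq (c i) < Re (K x x) * ip.norm_sq (c i)"
        using eval_bound[OF c x(1), of i] by (simp add: mult.commute)
      then show "x \<in> {x \<in> space M. t < Re (K x x)}"
        using x ip.norm_sq_nonneg[OF c, of i] by (auto simp: space_M mult_less_cancel_right)
    qed
    moreover have "{x \<in> space M. t * ip.norm_sq (c i) < (cmod (c i x))\<^sup>2} \<in> sets M" for i
    proof -
      have [measurable]: "c i \<in> borel_measurable M" by (rule measurable_mem[OF c])
      show ?thesis by measurable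
    qed
    then have "(\<Union>i. {x \<in> space M. t * ip.norm_sq (c i) < (cmod (c i x))\<^sup>2}) \<in> sets M" by blast
    ultimately show ?thesis by simp
  qed
  then show ?thesis by (simp add: borel_measurable_iff_greater)
qed

definition kernel_trace :: real where "kernel_trace = (\<integral>x. Re (K x x) \<partial>M)"

lemma kernel_diag_integrable: "integrable M (\<lambda>x. Re (K x x))"
  using kernel_diag_measurable finite_trace kernel_diag_nonneg space_M
  by (intro integrableI_nonneg) auto

lemma kernel_trace_nonneg: "0 \<le> kernel_trace"
  unfolding kernel_trace_def using kernel_diag_nonneg space_M by (intro integral_nonneg_AE AE_I2) auto

lemma integrable_square:
  assumes f: "f \<in> H" shows "integrable M (\<lambda>x. (cmod (f x))\<^sup>2)"
proof (rule Bochner_Integration.integrable_bound[OF integrable_mult_right[OF kernel_diag_integrable]])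
  show "(\<lambda>x. (cmod (f x))\<^sup>2) \<in> borel_measurable M" using measurable_mem[OF f] by measurable
  show "AE x in M. norm ((cmod (f x))\<^sup>2) \<le> norm (ip.norm_sq f * Re (K x x))"
    using eval_bound[OF f] space_M by (intro AE_I2) (force intro: order_trans)
qed

lemma integrable_product:
  assumes f: "f \<in> H" and g: "g \<in> H" shows "integrable M (\<lambda>x. f x * cnj (g x))"
proof (rule Bochner_Integration.integrable_bound[OF Bochner_Integration.integrable_add[OF integrable_square[OF f] integrable_square[OF g]]])
  have "(\<lambda>x. cnj (g x)) \<in> borel_measurable M"
    by (rule borel_measurable_continuous_on[OF continuous_on_cnj[OF continuous_on_id] measurable_mem[OF g]])
  then show "(\<lambda>x. f x * cnj (g x)) \<in> borel_measurable M" using measurable_mem[OF f] by measurable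
  show "AE x in M. norm (f x * cnj (g x)) \<le> norm ((cmod (f x))\<^sup>2 + (cmod (g x))\<^sup>2)"
  proof (intro AE_I2)
    fix x
    have "2 * (cmod (f x) * cmod (g x)) \<le> (cmod (f x))\<^sup>2 + (cmod (g x))\<^sup>2"
      using sum_squares_bound[of "cmod (f x)" "cmod (g x)"] by (simp add: mult.assoc)
    moreover have "0 \<le> cmod (f x) * cmod (g x)" by simp
    ultimately have "cmod (f x) * cmod (g x) \<le> (cmod (f x))\<^sup>2 + (cmod (g x))\<^sup>2" by linarith
    then show "norm (f x * cnj (g x)) \<le> norm ((cmod (f x))\<^sup>2 + (cmod (g x))\<^sup>2)"
      by (simp add: norm_mult)
  qed
qed

sublocale l2: semi_inner_product H "L2_inner M"
proof
  show "cfun.subspace H" by (rule subspace)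
  show "L2_inner M (f + g) h = L2_inner M f h + L2_inner M g h" if "f \<in> H" "g \<in> H" "h \<in> H" for f g h
    using that by (simp add: L2_inner_def distrib_right integrable_product)
  show "L2_inner M (fscale c f) g = c * L2_inner M f g" if "f \<in> H" "g \<in> H" for c f g
    by (simp add: L2_inner_def fscale_apply mult.assoc)
  show "L2_inner M g f = cnj (L2_inner M f g)" if "f \<in> H" "g \<in> H" for f g
    unfolding L2_inner_def by (subst Bochner_Integration.integral_cnj[symmetric]) (simp add: mult.commute)
  show "0 \<le> Re (L2_inner M f f)" if "f \<in> H" for f
  proof -
    have "Re (L2_inner M f f) = (\<integral>x. Re (f x * cnj (f x)) \<partial>M)"
      unfolding L2_inner_def by (rule integral_Re[OF integrable_product[OF that that], symmetric])
    also have "0 \<le> \<dots>" by (intro integral_nonneg_AE AE_I2) simp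
    finally show ?thesis .
  qed
qed

lemma l2_norm_sq: "f \<in> H \<Longrightarrow> l2.norm_sq f = (\<integral>x. (cmod (f x))\<^sup>2 \<partial>M)"
proof -
  assume f: "f \<in> H"
  have "l2.norm_sq f = (\<integral>x. Re (f x * cnj (f x)) \<partial>M)"
    unfolding l2.norm_sq_def L2_inner_def by (rule integral_Re[OF integrable_product[OF f f], symmetric])
  also have "(\<lambda>x. Re (f x * cnj (f x))) = (\<lambda>x. (cmod (f x))\<^sup>2)"
    by (simp only: Re_mult_cnj)
  finally show ?thesis .
qed

lemma L2_norm_sq_eq: "f \<in> H \<Longrightarrow> L2_norm_sq M f = ennreal (l2.norm_sq f)"
  by (simp add: L2_norm_sq_def l2_norm_sq nn_integral_eq_integral[OF integrable_square])

lemma l2_norm_sq_le: "f \<in> H \<Longrightarrow> l2.norm_sq f \<le> kernel_trace * ip.norm_sq f"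
proof -
  assume f: "f \<in> H"
  have "(\<integral>x. (cmod (f x))\<^sup>2 \<partial>M) \<le> (\<integral>x. ip.norm_sq f * Re (K x x) \<partial>M)"
    using eval_bound[OF f] space_M
    by (intro integral_mono integrable_square f integrable_mult_right kernel_diag_integrable) auto
  then show ?thesis by (simp add: l2_norm_sq f kernel_trace_def mult.commute)
qed

abbreviation T :: "('a \<Rightarrow> complex) \<Rightarrow> 'a \<Rightarrow> complex" where "T \<equiv> embedding_adjoint M H ip"

lemma ip_cancel:
  assumes "u \<in> H" "v \<in> H" "\<And>h. h \<in> H \<Longrightarrow> ip u h = ip v h" shows "u = v"
proof -
  have "ip (u - v) (u - v) = 0" using assms by (simp add: ip.diff_left ip.mem_diff)
  then show ?thesis using norm_sq_eq_0D[of "u - v"] assms by (simp add: ip.norm_sq_def ip.mem_diff)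
qed

text \<open>The \<open>L\<^sub>2\<close> norm is at most the square root of the trace of the kernel times the norm of \<open>H\<close>, so that
  \<open>h \<mapsto> \<langle>h, g\<rangle>\<close> in \<open>L\<^sub>2\<close> is a bounded functional on \<open>H\<close>.\<close>
lemma adjoint_ex: "g \<in> H \<Longrightarrow> \<exists>!u. u \<in> H \<and> (\<forall>h\<in>H. ip u h = L2_inner M g h)"
proof -
  assume g: "g \<in> H"
  have "\<exists>u\<in>H. \<forall>h\<in>H. L2_inner M h g = ip h u"
  proof (rule Riesz_representation)
    show "(cmod (L2_inner M f g))\<^sup>2 \<le> (kernel_trace * l2.norm_sq g) * ip.norm_sq f" if "f \<in> H" for f
    proof -
      have "(cmod (L2_inner M f g))\<^sup>2 \<le> l2.norm_sq f * l2.norm_sq g" by (rule l2.Cauchy_Schwarz[OF that g])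
      also have "\<dots> \<le> (kernel_trace * ip.norm_sq f) * l2.norm_sq g"
        using l2_norm_sq_le[OF that] l2.norm_sq_nonneg[OF g] by (intro mult_right_mono)
      finally show ?thesis by (simp add: mult_ac)
    qed
  qed (use g l2.add_left l2.scale_left in auto)
  then obtain u where u: "u \<in> H" "\<And>h. h \<in> H \<Longrightarrow> L2_inner M h g = ip h u" by blast
  have "ip u h = L2_inner M g h" if "h \<in> H" for h
    using ip_commute[OF that u(1)] l2.commute[OF that g] u(2)[OF that] by simp
  then show ?thesis using u(1) ip_cancel by (intro ex1I[of _ u]) auto
qed

lemma T_mem: "g \<in> H \<Longrightarrow> T g \<in> H" and ip_T: "g \<in> H \<Longrightarrow> h \<in> H \<Longrightarrow> ip (T g) h = L2_inner M g h"
  using theI'[OF adjoint_ex] unfolding embedding_adjoint_def by blast+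

lemma T_diff: "f \<in> H \<Longrightarrow> g \<in> H \<Longrightarrow> T (f - g) = T f - T g"
  by (rule ip_cancel) (simp_all add: T_mem ip_T ip.mem_diff ip.diff_left l2.diff_left)
lemma norm_sq_T_le: "g \<in> H \<Longrightarrow> ip.norm_sq (T g) \<le> kernel_trace * l2.norm_sq g"
proof -
  assume g: "g \<in> H"
  have "(ip.norm_sq (T g))\<^sup>2 = (cmod (L2_inner M g (T g)))\<^sup>2"
  proof -
    have "L2_inner M g (T g) = of_real (ip.norm_sq (T g))"
      using ip_T[OF g T_mem[OF g]] ip.self_eq_norm_sq[OF T_mem[OF g]] by simp
    then show ?thesis by simp
  qed
  also have "\<dots> \<le> l2.norm_sq g * l2.norm_sq (T g)" by (rule l2.Cauchy_Schwarz[OF g T_mem[OF g]])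
  also have "\<dots> \<le> l2.norm_sq g * (kernel_trace * ip.norm_sq (T g))"
    by (intro mult_left_mono l2_norm_sq_le T_mem g l2.norm_sq_nonneg)
  finally have "ip.norm_sq (T g) * ip.norm_sq (T g) \<le> (kernel_trace * l2.norm_sq g) * ip.norm_sq (T g)"
    by (simp add: power2_eq_square mult_ac)
  moreover have "0 \<le> kernel_trace * l2.norm_sq g" using kernel_trace_nonneg l2.norm_sq_nonneg[OF g] by simp
  ultimately show ?thesis using ip.norm_sq_nonneg[OF T_mem[OF g]]
    by (cases "ip.norm_sq (T g) = 0") (auto simp: mult_le_cancel_right)
qed

end

section \<open>Compactness of the embedding\<close>

context embedded_rkhs
begin

text \<open>The inner products with a dense sequence form a point in a product of discs, which is compact and
  metrisable. The uniform bound extends the convergence from the dense sequence to all of \<open>H\<close>.\<close>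
lemma weakly_convergent_subsequence:
  fixes f :: "nat \<Rightarrow> 'a \<Rightarrow> complex"
  assumes f: "\<And>n. f n \<in> H" and bound: "\<And>n. ip.norm_sq (f n) \<le> 1"
  shows "\<exists>r :: nat \<Rightarrow> nat. strict_mono r \<and> (\<forall>g\<in>H. convergent (\<lambda>n. ip (f (r n)) g))"
proof -
  obtain c where dense: "dense_sequence c" using dense_sequence_ex by blast
  note c = dense_sequence_mem[OF dense]
  have le: "cmod (ip (f n) g) \<le> hnorm ip g" if "g \<in> H" for n g
  proof -
    have "cmod (ip (f n) g) \<le> sqrt (ip.norm_sq (f n)) * sqrt (ip.norm_sq g)" by (rule ip.cmod_le_sqrt[OF f that])
    also have "\<dots> \<le> 1 * sqrt (ip.norm_sq g)"
      using bound ip.norm_sq_nonneg[OF that] by (intro mult_right_mono) auto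
    finally show ?thesis by (simp add: hnorm_eq)
  qed
  define z where "z n = (\<lambda>i. ip (f n) (c i))" for n
  define S where "S = (\<Pi>\<^sub>E i\<in>(UNIV::nat set). cball (0::complex) (hnorm ip (c i)))"
  have "compactin (product_topology (\<lambda>_. euclidean) UNIV) S"
    unfolding S_def compactin_PiE by simp
  then have "compact S" by (simp add: euclidean_product_topology)
  then have "seq_compact S" by (simp add: compact_imp_seq_compact)
  moreover have "\<forall>n. z n \<in> S" using le[OF c] by (auto simp: z_def S_def PiE_iff)
  ultimately obtain l r where "l \<in> S" and r: "strict_mono r" and lim: "(z \<circ> r) \<longlonglongrightarrow> l"
    by (rule seq_compactE[of S z])
  have comp: "(\<lambda>n. ip (f (r n)) (c i)) \<longlonglongrightarrow> l i" for i
    using continuous_on_tendsto_compose[OF continuous_on_product_coordinates lim, of i]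
    by (simp add: z_def o_def)
  have "convergent (\<lambda>n. ip (f (r n)) g)" if g: "g \<in> H" for g
  proof (rule Cauchy_convergent, rule metric_CauchyI)
    fix \<epsilon> :: real assume "0 < \<epsilon>"
    then have "\<exists>i. hnorm ip (g - c i) < \<epsilon> / 4" 
      using dense[unfolded dense_sequence_def, THEN conjunct2, rule_format, OF g, of "\<epsilon> / 4"] by simp
    then obtain i where i: "hnorm ip (g - c i) < \<epsilon> / 4" by blast
    have "Cauchy (\<lambda>n. ip (f (r n)) (c i))" using comp[of i] by (rule LIMSEQ_imp_Cauchy)
    from metric_CauchyD[OF this, of "\<epsilon> / 2"] \<open>0 < \<epsilon>\<close>
    obtain N where N: "\<And>a b. N \<le> a \<Longrightarrow> N \<le> b \<Longrightarrow> dist (ip (f (r a)) (c i)) (ip (f (r b)) (c i)) < \<epsilon> / 2"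
      by auto
    have "dist (ip (f (r a)) g) (ip (f (r b)) g) < \<epsilon>" if "N \<le> a" "N \<le> b" for a b
    proof -
      have split: "ip (f n) g = ip (f n) (c i) + ip (f n) (g - c i)" for n
        using f g c by (simp add: ip.diff_right)
      have small: "cmod (ip (f n) (g - c i)) < \<epsilon> / 4" for n
        using le[OF ip.mem_diff[OF g c]] i by (rule le_less_trans)
      have "ip (f (r a)) g - ip (f (r b)) g = (ip (f (r a)) (c i) - ip (f (r b)) (c i))
          + (ip (f (r a)) (g - c i) - ip (f (r b)) (g - c i))"
        unfolding split[of "r a"] split[of "r b"] by simp
      then have "cmod (ip (f (r a)) g - ip (f (r b)) g) \<le> cmod (ip (f (r a)) (c i) - ip (f (r b)) (c i))
          + (cmod (ip (f (r a)) (g - c i)) + cmod (ip (f (r b)) (g - c i)))"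
        using norm_triangle_ineq[of "ip (f (r a)) (c i) - ip (f (r b)) (c i)" "ip (f (r a)) (g - c i) - ip (f (r b)) (g - c i)"]
          norm_triangle_ineq4[of "ip (f (r a)) (g - c i)" "ip (f (r b)) (g - c i)"]
        by simp
      also have "\<dots> < \<epsilon> / 2 + (\<epsilon> / 4 + \<epsilon> / 4)"
        using N[OF that] small[of "r a"] small[of "r b"] unfolding dist_norm by (intro add_strict_mono)
      finally show ?thesis by (simp add: dist_norm)
    qed
    then show "\<exists>N. \<forall>a\<ge>N. \<forall>b\<ge>N. dist (ip (f (r a)) g) (ip (f (r b)) g) < \<epsilon>" by blast
  qed
  then show ?thesis using r by blast
qed

text \<open>Evaluations are inner products with kernel sections, so a weakly convergent subsequence converges
  pointwise. It is dominated by the integrable diagonal of the kernel and therefore Cauchy in \<open>L\<^sub>2\<close>, and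
  \<open>T\<close> turns this into convergence in \<open>H\<close>. The pointwise limit \<open>\<phi>\<close> only serves to compare the members of
  the sequence.\<close>
lemma T_compact:
  fixes f :: "nat \<Rightarrow> 'a \<Rightarrow> complex"
  assumes f: "\<And>n. f n \<in> H" and bound: "\<And>n. ip.norm_sq (f n) \<le> 1"
  shows "\<exists>r :: nat \<Rightarrow> nat. strict_mono r \<and> (\<exists>u\<in>H. (\<lambda>n. hnorm ip (T (f (r n)) - u)) \<longlonglongrightarrow> 0)"
proof -
  obtain r where r: "strict_mono r" and weak: "\<And>g. g \<in> H \<Longrightarrow> convergent (\<lambda>n. ip (f (r n)) g)"
    using weakly_convergent_subsequence[of f, OF f bound] by blast
  define h where "h n = f (r n)" for n
  have h: "h n \<in> H" "ip.norm_sq (h n) \<le> 1" for n using f bound by (auto simp: h_def)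
  define \<phi> where "\<phi> x = lim (\<lambda>n. h n x)" for x
  have lim: "(\<lambda>n. h n x) \<longlonglongrightarrow> \<phi> x" if "x \<in> D" for x
    using weak[OF ks_mem[OF that]] h(1) that unfolding \<phi>_def h_def
    by (simp add: convergent_LIMSEQ_iff[symmetric] eval_eq[of "f (r _)"] f)
  have hK: "(cmod (h n x))\<^sup>2 \<le> Re (K x x)" if "x \<in> D" for n x
  proof -
    have "ip.norm_sq (h n) * Re (K x x) \<le> 1 * Re (K x x)"
      using h(2) kernel_diag_nonneg[OF that] by (intro mult_right_mono)
    then show ?thesis using eval_bound[OF h(1) that, of n] by simp
  qed
  have \<phi>K: "(cmod (\<phi> x))\<^sup>2 \<le> Re (K x x)" if "x \<in> D" for x
    by (rule LIMSEQ_le_const2[OF tendsto_power[OF tendsto_norm[OF lim[OF that]]]]) (use hK[OF that] in blast)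
  have \<phi>m: "\<phi> \<in> borel_measurable M"
    by (rule borel_measurable_LIMSEQ_metric[where f=h]) (use measurable_mem h(1) lim space_M in auto)
  have two: "(cmod (a - b))\<^sup>2 \<le> 2 * (cmod a)\<^sup>2 + 2 * (cmod b)\<^sup>2" for a b :: complex
  proof -
    have "(cmod (a - b))\<^sup>2 \<le> (cmod a + cmod b)\<^sup>2" by (intro power_mono norm_triangle_ineq4) auto
    also have "\<dots> \<le> 2 * (cmod a)\<^sup>2 + 2 * (cmod b)\<^sup>2"
      using sum_squares_bound[of "cmod a" "cmod b"] by (simp add: power2_sum)
    finally show ?thesis .
  qed
  have dom: "(cmod (h n x - \<phi> x))\<^sup>2 \<le> 4 * Re (K x x)" if "x \<in> D" for n x
    using two[of "h n x" "\<phi> x"] hK[OF that, of n] \<phi>K[OF that] by linarith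
  define A where "A n = (\<integral>x. (cmod (h n x - \<phi> x))\<^sup>2 \<partial>M)" for n
  have hm: "(\<lambda>x. (cmod (h n x - \<phi> x))\<^sup>2) \<in> borel_measurable M" for n
    using measurable_mem[OF h(1)[of n]] \<phi>m by measurable
  have int: "integrable M (\<lambda>x. (cmod (h n x - \<phi> x))\<^sup>2)" for n
    by (rule Bochner_Integration.integrable_bound[OF integrable_mult_right[OF kernel_diag_integrable, of 4] hm])
       (use dom space_M in \<open>auto intro!: AE_I2 intro: order_trans[OF _ abs_ge_self]\<close>)
  have "A \<longlonglongrightarrow> (\<integral>x. 0 \<partial>M)"
    unfolding A_def
  proof (rule integral_dominated_convergence[where w="\<lambda>x. 4 * Re (K x x)"])
    show "AE x in M. (\<lambda>n. (cmod (h n x - \<phi> x))\<^sup>2) \<longlonglongrightarrow> 0"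
    proof (intro AE_I2)
      fix x assume "x \<in> space M"
      then have "(\<lambda>n. (cmod (h n x - \<phi> x))\<^sup>2) \<longlonglongrightarrow> (cmod (\<phi> x - \<phi> x))\<^sup>2"
        by (intro tendsto_intros lim) (simp add: space_M)
      then show "(\<lambda>n. (cmod (h n x - \<phi> x))\<^sup>2) \<longlonglongrightarrow> 0" by simp
    qed
  qed (use hm dom space_M kernel_diag_integrable in auto)
  then have A: "A \<longlonglongrightarrow> 0" by simp
  have l2: "l2.norm_sq (h i - h k) \<le> 2 * A i + 2 * A k" for i k
  proof -
    have "(\<integral>x. (cmod ((h i - h k) x))\<^sup>2 \<partial>M) \<le> (\<integral>x. 2 * (cmod (h i x - \<phi> x))\<^sup>2 + 2 * (cmod (h k x - \<phi> x))\<^sup>2 \<partial>M)"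
    proof (intro integral_mono Bochner_Integration.integrable_add integrable_mult_right int)
      show "integrable M (\<lambda>x. (cmod ((h i - h k) x))\<^sup>2)" by (intro integrable_square ip.mem_diff h)
      show "(cmod ((h i - h k) x))\<^sup>2 \<le> 2 * (cmod (h i x - \<phi> x))\<^sup>2 + 2 * (cmod (h k x - \<phi> x))\<^sup>2" for x
        using two[of "h i x - \<phi> x" "h k x - \<phi> x"] by simp
    qed
    also have "\<dots> = 2 * A i + 2 * A k" unfolding A_def using int by simp
    finally show ?thesis by (simp add: l2_norm_sq ip.mem_diff h)
  qed
  have "\<forall>\<epsilon>>0. \<exists>N. \<forall>i\<ge>N. \<forall>k\<ge>N. hnorm ip (T (h i) - T (h k)) < \<epsilon>"
  proof (intro allI impI)
    fix \<epsilon> :: real assume "0 < \<epsilon>"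
    \<comment> \<open>one is added because the trace of the kernel may vanish\<close>
    define \<delta> where "\<delta> = \<epsilon>\<^sup>2 / (4 * (kernel_trace + 1))"
    have k: "0 < kernel_trace + 1" using kernel_trace_nonneg by simp
    have "0 < \<delta>" using \<open>0 < \<epsilon>\<close> k by (simp add: \<delta>_def)
    then have "\<forall>\<^sub>F n in sequentially. A n < \<delta>" using A by (rule order_tendstoD(2)[rotated])
    then obtain N where N: "\<And>n. N \<le> n \<Longrightarrow> A n < \<delta>" by (auto simp: eventually_sequentially)
    have "hnorm ip (T (h i) - T (h k)) < \<epsilon>" if "N \<le> i" "N \<le> k" for i k
    proof -
      have "ip.norm_sq (T (h i) - T (h k)) = ip.norm_sq (T (h i - h k))" using h by (simp add: T_diff)
      also have "\<dots> \<le> kernel_trace * l2.norm_sq (h i - h k)" by (intro norm_sq_T_le ip.mem_diff h)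
      also have "\<dots> \<le> (kernel_trace + 1) * l2.norm_sq (h i - h k)"
        using l2.norm_sq_nonneg[OF ip.mem_diff[OF h(1) h(1)], of i k] by (intro mult_right_mono) auto
      also have "\<dots> < (kernel_trace + 1) * (4 * \<delta>)"
      proof (rule mult_strict_left_mono[OF _ k])
        show "l2.norm_sq (h i - h k) < 4 * \<delta>" using l2[of i k] N[of i] N[of k] that by simp
      qed
      also have "\<dots> = \<epsilon>\<^sup>2"
      proof -
        have "a * (4 * (x / (4 * a))) = x" if "0 < a" for a x :: real using that by simp
        from this[OF k] show ?thesis unfolding \<delta>_def .
      qed
      finally show ?thesis unfolding hnorm_eq using \<open>0 < \<epsilon>\<close> by (intro real_less_lsqrt) auto
    qed
    then show "\<exists>N. \<forall>i\<ge>N. \<forall>k\<ge>N. hnorm ip (T (h i) - T (h k)) < \<epsilon>" by blast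
  qed
  then obtain u where "u \<in> H" "(\<lambda>n. hnorm ip (T (h n) - u)) \<longlonglongrightarrow> 0"
    using complete[of "\<lambda>n. T (h n)"] T_mem h(1) by blast
  then show ?thesis using r unfolding h_def by blast
qed

lemma T_self_adjoint: "f \<in> H \<Longrightarrow> g \<in> H \<Longrightarrow> ip (T f) g = ip f (T g)"
proof -
  assume f: "f \<in> H" and g: "g \<in> H"
  have "ip (T f) g = L2_inner M f g" by (rule ip_T[OF f g])
  also have "\<dots> = cnj (L2_inner M g f)" by (rule l2.commute[OF g f])
  also have "\<dots> = cnj (ip (T g) f)" by (simp only: ip_T[OF g f])
  also have "\<dots> = ip f (T g)" by (rule ip_commute[OF T_mem[OF g] f, symmetric])
  finally show ?thesis .
qed

lemma tendsto_hnorm_add: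
  assumes "\<And>n. a n \<in> H" "\<And>n. b n \<in> H" "u \<in> H"
    "(\<lambda>n. hnorm ip (a n - b n)) \<longlonglongrightarrow> 0" "(\<lambda>n. hnorm ip (b n - u)) \<longlonglongrightarrow> 0"
  shows "(\<lambda>n. hnorm ip (a n - u)) \<longlonglongrightarrow> 0"
proof (rule Lim_null_comparison)
  have "hnorm ip (a n - u) \<le> hnorm ip (a n - b n) + hnorm ip (b n - u)" for n
  proof -
    have "a n - u = (a n - b n) + (b n - u)" by simp
    then show ?thesis unfolding hnorm_eq
      using ip.sqrt_norm_sq_triangle[of "a n - b n" "b n - u"] assms(1-3) by (simp add: ip.mem_diff)
  qed
  then show "\<forall>\<^sub>F n in sequentially. norm (hnorm ip (a n - u)) \<le> hnorm ip (a n - b n) + hnorm ip (b n - u)"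
    using assms(1-3) by (intro always_eventually allI) (simp add: hnorm_nonneg ip.mem_diff)
  show "(\<lambda>n. hnorm ip (a n - b n) + hnorm ip (b n - u)) \<longlonglongrightarrow> 0"
    using tendsto_add[OF assms(4,5)] by simp
qed

end

section \<open>Spectral decomposition\<close>

locale embedded_rkhs_spectrum = embedded_rkhs D K H ip M
  for D :: "'a set" and K and H :: "('a \<Rightarrow> complex) set" and ip and M +
  fixes lam :: "nat \<Rightarrow> real" and e :: "nat \<Rightarrow> 'a \<Rightarrow> complex"
  assumes eigensystem: "positive_eigensystem M H ip lam e"
begin

lemma lam_pos: "1 \<le> k \<Longrightarrow> 0 < lam k" using eigensystem unfolding positive_eigensystem_def by blast
lemma lam_Suc: "1 \<le> k \<Longrightarrow> lam (Suc k) \<le> lam k" using eigensystem unfolding positive_eigensystem_def by blast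
lemma e_mem: "1 \<le> k \<Longrightarrow> e k \<in> H" using eigensystem unfolding positive_eigensystem_def by blast
lemma T_e: "1 \<le> k \<Longrightarrow> T (e k) = fscale (of_real (lam k)) (e k)"
  using eigensystem unfolding positive_eigensystem_def by blast
lemma orthonormal: "1 \<le> j \<Longrightarrow> 1 \<le> k \<Longrightarrow> ip (e j) (e k) = (if j = k then 1 else 0)"
  using eigensystem unfolding positive_eigensystem_def by blast
lemma eigenfunction_in_span: "0 < \<mu> \<Longrightarrow> f \<in> H \<Longrightarrow> T f = fscale (of_real \<mu>) f \<Longrightarrow>
    f \<in> cfun.span {e k |k. k \<ge> 1 \<and> lam k = \<mu>}"
  using eigensystem unfolding positive_eigensystem_def by blast

lemma lam_antimono: "1 \<le> j \<Longrightarrow> j \<le> k \<Longrightarrow> lam k \<le> lam j"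
proof -
  assume "1 \<le> j" "j \<le> k"
  from this(2) show ?thesis
  proof (induction k rule: dec_induct)
    case (step k)
    then show ?case using lam_Suc[of k] \<open>1 \<le> j\<close> by simp
  qed simp
qed

definition perp :: "('a \<Rightarrow> complex) \<Rightarrow> bool" where
  "perp f \<longleftrightarrow> f \<in> H \<and> (\<forall>k\<ge>1. ip f (e k) = 0)"

lemma perp_mem: "perp f \<Longrightarrow> f \<in> H" by (simp add: perp_def)
lemma perp_e: "perp f \<Longrightarrow> 1 \<le> k \<Longrightarrow> ip f (e k) = 0" by (simp add: perp_def)
lemma perp_scale: "perp f \<Longrightarrow> perp (fscale c f)"
  by (simp add: perp_def ip.mem_scale ip.scale_left e_mem)
lemma perp_T: "perp f \<Longrightarrow> perp (T f)"
  unfolding perp_def by (auto simp: T_mem T_self_adjoint T_e e_mem ip.scale_right)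

text \<open>\<open>f\<close> is orthogonal to that span, hence to itself.\<close>
lemma perp_span:
  assumes f: "perp f" and span: "f \<in> cfun.span {e k |k. k \<ge> 1 \<and> lam k = \<mu>}"
  shows "f = 0"
proof -
  have "cfun.subspace {g \<in> H. ip f g = 0}"
    using perp_mem[OF f] by (auto simp: cfun.subspace_def ip.mem_zero ip.mem_add ip.mem_scale ip.zero_right ip.add_right ip.scale_right)
  moreover have "{e k |k. k \<ge> 1 \<and> lam k = \<mu>} \<subseteq> {g \<in> H. ip f g = 0}"
    using perp_e[OF f] e_mem by auto
  ultimately have "f \<in> {g \<in> H. ip f g = 0}" using cfun.span_minimal span by blast
  then show ?thesis using norm_sq_eq_0D[of f] by (simp add: ip.norm_sq_def)
qed

text \<open>Let \<open>\<Lambda>\<close> be the supremum of the squared \<open>L\<^sub>2\<close> norm over the unit ball of the orthogonal complement of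
  the eigenfunctions, and suppose that \<open>\<Lambda> > 0\<close>. For a maximising sequence \<open>f n\<close> the distance of \<open>\<Lambda> f n\<close>
  and \<open>T (f n)\<close> tends to zero. As \<open>T\<close> is compact, a subsequence of \<open>\<Lambda> f n\<close> converges to some \<open>u\<close>, for which
  \<open>T u = \<Lambda> u\<close>. All eigenfunctions for \<open>\<Lambda>\<close> lie in the span of the \<open>e k\<close>, and \<open>u\<close> is orthogonal to them, so
  that \<open>u = 0\<close>. But the norms of the \<open>f n\<close> tend to one, so that \<open>|u| \<ge> \<Lambda>\<close>.\<close>
lemma perp_l2_norm_sq_eq_0:
  assumes "perp f0" shows "l2.norm_sq f0 = 0"
proof (rule ccontr)
  assume "l2.norm_sq f0 \<noteq> 0"
  then have f0: "0 < l2.norm_sq f0" using l2.norm_sq_nonneg[OF perp_mem[OF assms]] by simp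
  define S where "S = {f. perp f \<and> ip.norm_sq f \<le> 1}"
  have up: "l2.norm_sq f \<le> kernel_trace" if "f \<in> S" for f
  proof -
    have "kernel_trace * ip.norm_sq f \<le> kernel_trace * 1"
      using that kernel_trace_nonneg by (intro mult_left_mono) (auto simp: S_def)
    then show ?thesis using l2_norm_sq_le[OF perp_mem, of f] that by (simp add: S_def)
  qed
  then have bdd: "bdd_above (l2.norm_sq ` S)" by (intro bdd_aboveI2)
  define \<Lambda> where "\<Lambda> = Sup (l2.norm_sq ` S)"
  have normalise: "l2.norm_sq f \<le> \<Lambda> * ip.norm_sq f" if f: "perp f" for f
  proof (cases "ip.norm_sq f = 0")
    case True
    then show ?thesis using l2_norm_sq_le[OF perp_mem[OF f]] by simp
  next
    case False
    then have pos: "0 < ip.norm_sq f" using ip.norm_sq_nonneg[OF perp_mem[OF f]] by simp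
    let ?g = "fscale (of_real (1 / sqrt (ip.norm_sq f))) f"
    have c: "(cmod (of_real (1 / sqrt (ip.norm_sq f))))\<^sup>2 = 1 / ip.norm_sq f"
      using pos by (simp only: norm_of_real power2_abs) (simp add: power_divide)
    have "ip.norm_sq ?g = 1" unfolding ip.norm_sq_scale[OF perp_mem[OF f]] c using pos by simp
    then have "?g \<in> S" by (simp add: S_def perp_scale[OF f])
    then have "l2.norm_sq ?g \<le> \<Lambda>" unfolding \<Lambda>_def using bdd by (intro cSUP_upper)
    then show ?thesis unfolding l2.norm_sq_scale[OF perp_mem[OF f]] c using pos by (simp add: field_simps)
  qed
  have "0 < \<Lambda>"
  proof (rule ccontr)
    assume "\<not> 0 < \<Lambda>"
    then have "\<Lambda> * ip.norm_sq f0 \<le> 0" using ip.norm_sq_nonneg[OF perp_mem[OF assms]] by (simp add: mult_nonpos_nonneg)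
    then show False using normalise[OF assms] f0 by simp
  qed
  have "S \<noteq> {}"
  proof -
    have "0 \<in> S" using ip.mem_zero e_mem by (simp add: S_def perp_def ip.zero_left ip.norm_sq_def)
    then show ?thesis by blast
  qed
  have "\<exists>f\<in>S. \<Lambda> - inverse (real (Suc n)) < l2.norm_sq f" for n
  proof -
    have "\<Lambda> - inverse (real (Suc n)) < Sup (l2.norm_sq ` S)" by (simp add: \<Lambda>_def)
    then show ?thesis using less_cSUP_iff[OF \<open>S \<noteq> {}\<close> bdd] by blast
  qed
  then obtain f where fS: "\<And>n. f n \<in> S" and near: "\<And>n. \<Lambda> - inverse (real (Suc n)) < l2.norm_sq (f n)" by metis
  have perp_f: "perp (f n)" and f: "f n \<in> H" and f1: "ip.norm_sq (f n) \<le> 1" for n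
    using fS[of n] by (auto simp: S_def perp_mem)
  have Tf_le: "ip.norm_sq (T (f n)) \<le> \<Lambda>\<^sup>2" for n
  proof -
    have fl: "l2.norm_sq (f n) \<le> \<Lambda>" unfolding \<Lambda>_def using bdd fS by (intro cSUP_upper)
    have Tn: "0 \<le> ip.norm_sq (T (f n))" by (intro ip.norm_sq_nonneg T_mem f)
    have "L2_inner M (f n) (T (f n)) = of_real (ip.norm_sq (T (f n)))"
      using ip_T[OF f T_mem[OF f]] ip.self_eq_norm_sq[OF T_mem[OF f]] by simp
    then have "ip.norm_sq (T (f n)) * ip.norm_sq (T (f n)) = (cmod (L2_inner M (f n) (T (f n))))\<^sup>2"
      by (simp add: power2_eq_square)
    also have "\<dots> \<le> l2.norm_sq (f n) * l2.norm_sq (T (f n))" by (rule l2.Cauchy_Schwarz[OF f T_mem[OF f]])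
    also have "\<dots> \<le> \<Lambda> * (\<Lambda> * ip.norm_sq (T (f n)))"
      using fl \<open>0 < \<Lambda>\<close> l2.norm_sq_nonneg[OF T_mem[OF f]] by (intro mult_mono normalise perp_T perp_f) auto
    also have "\<dots> = \<Lambda>\<^sup>2 * ip.norm_sq (T (f n))" by (simp add: power2_eq_square)
    finally show ?thesis using Tn by (cases "ip.norm_sq (T (f n)) = 0") (auto simp: mult_le_cancel_right)
  qed
  define v where "v n = fscale (of_real \<Lambda>) (f n)" for n
  have v: "v n \<in> H" for n by (simp add: v_def ip.mem_scale f)
  have v_norm: "ip.norm_sq (v n) = \<Lambda>\<^sup>2 * ip.norm_sq (f n)" for n
    by (simp add: v_def ip.norm_sq_scale f)
  have diff: "ip.norm_sq (v n - T (f n)) \<le> 2 * \<Lambda> * inverse (real (Suc n))" for n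
  proof -
    have "ip (v n) (T (f n)) = of_real (\<Lambda> * l2.norm_sq (f n))"
      using f T_self_adjoint[OF f f, of n n] ip_T[OF f f, of n n] l2.self_eq_norm_sq[OF f, of n]
      by (simp add: v_def ip.scale_left T_mem)
    then have "ip.norm_sq (v n - T (f n)) = \<Lambda>\<^sup>2 * ip.norm_sq (f n) - 2 * (\<Lambda> * l2.norm_sq (f n)) + ip.norm_sq (T (f n))"
      by (simp add: ip.norm_sq_diff v T_mem f v_norm)
    also have "\<dots> \<le> \<Lambda>\<^sup>2 * 1 - 2 * (\<Lambda> * (\<Lambda> - inverse (real (Suc n)))) + \<Lambda>\<^sup>2"
    proof -
      have "\<Lambda>\<^sup>2 * ip.norm_sq (f n) \<le> \<Lambda>\<^sup>2 * 1" using f1[of n] by (intro mult_left_mono) auto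
      moreover have "\<Lambda> * (\<Lambda> - inverse (real (Suc n))) \<le> \<Lambda> * l2.norm_sq (f n)"
        using less_imp_le[OF near[of n]] less_imp_le[OF \<open>0 < \<Lambda>\<close>] by (rule mult_left_mono)
      ultimately show ?thesis using Tf_le[of n] by (intro add_mono diff_mono) auto
    qed
    also have "\<dots> = 2 * \<Lambda> * inverse (real (Suc n))" by (simp add: power2_eq_square algebra_simps)
    finally show ?thesis .
  qed
  have close: "(\<lambda>n. hnorm ip (v n - T (f n))) \<longlonglongrightarrow> 0"
  proof -
    have "(\<lambda>n. 2 * \<Lambda> * inverse (real (Suc n))) \<longlonglongrightarrow> 2 * \<Lambda> * 0"
      by (rule tendsto_mult[OF tendsto_const LIMSEQ_inverse_real_of_nat])
    from tendsto_real_sqrt[OF this]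
    have lim: "(\<lambda>n. sqrt (2 * \<Lambda> * inverse (real (Suc n)))) \<longlonglongrightarrow> 0" by simp
    show ?thesis
    proof (rule Lim_null_comparison[OF _ lim], intro always_eventually allI)
      fix n
      have "norm (hnorm ip (v n - T (f n))) = sqrt (ip.norm_sq (v n - T (f n)))"
        using hnorm_nonneg[OF ip.mem_diff[OF v T_mem[OF f]], of n n] by (simp add: hnorm_eq)
      then show "norm (hnorm ip (v n - T (f n))) \<le> sqrt (2 * \<Lambda> * inverse (real (Suc n)))"
        using diff[of n] by simp
    qed
  qed
  obtain r u where r: "strict_mono r" and u: "u \<in> H" and Tlim: "(\<lambda>n. hnorm ip (T (f (r n)) - u)) \<longlonglongrightarrow> 0"
    using T_compact[of f, OF f f1] by blast
  have vlim: "(\<lambda>n. hnorm ip (v (r n) - u)) \<longlonglongrightarrow> 0"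
    by (rule tendsto_hnorm_add[OF v T_mem[OF f] u _ Tlim])
       (use LIMSEQ_subseq_LIMSEQ[OF close r] in \<open>simp add: o_def\<close>)
  have "perp u"
    unfolding perp_def
  proof (intro conjI u allI impI)
    fix k :: nat assume k: "1 \<le> k"
    have "(\<lambda>n. ip (T (f (r n))) (e k)) \<longlonglongrightarrow> ip u (e k)"
      by (intro tendsto_ip_left T_mem f u e_mem k Tlim)
    then show "ip u (e k) = 0" using perp_e[OF perp_T[OF perp_f] k] by (simp add: LIMSEQ_const_iff)
  qed
  have "T u = fscale (of_real \<Lambda>) u"
  proof (rule ip_cancel)
    fix h assume h: "h \<in> H"
    have "(\<lambda>n. ip (v (r n)) (T h)) \<longlonglongrightarrow> ip u (T h)" by (intro tendsto_ip_left v u T_mem h vlim)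
    moreover have "ip (v (r n)) (T h) = of_real \<Lambda> * ip (T (f (r n))) h" for n
      using T_self_adjoint[OF f h, of "r n"] by (simp add: v_def ip.scale_left f T_mem h)
    moreover have "(\<lambda>n. of_real \<Lambda> * ip (T (f (r n))) h) \<longlonglongrightarrow> of_real \<Lambda> * ip u h"
      by (intro tendsto_mult tendsto_const tendsto_ip_left T_mem f u h Tlim)
    ultimately have "ip u (T h) = of_real \<Lambda> * ip u h" by (simp add: LIMSEQ_unique)
    then show "ip (T u) h = ip (fscale (of_real \<Lambda>) u) h" using u h by (simp add: T_self_adjoint ip.scale_left)
  qed (use u in \<open>auto simp: T_mem ip.mem_scale\<close>)
  then have "u = 0" using perp_span[OF \<open>perp u\<close> eigenfunction_in_span[OF \<open>0 < \<Lambda>\<close> u]] by simp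
  have "\<Lambda>\<^sup>2 \<le> ip.norm_sq u"
  proof (rule LIMSEQ_le)
    show "(\<lambda>n. ip.norm_sq (v (r n))) \<longlonglongrightarrow> ip.norm_sq u" by (rule tendsto_norm_sq[OF v u vlim])
    have "(\<lambda>n. inverse (real (Suc (r n)))) \<longlonglongrightarrow> 0"
      using LIMSEQ_subseq_LIMSEQ[OF LIMSEQ_inverse_real_of_nat r] by (simp add: o_def)
    from tendsto_mult[OF tendsto_const[of \<Lambda>] tendsto_diff[OF tendsto_const[of \<Lambda>] this]]
    have "(\<lambda>n. \<Lambda> * (\<Lambda> - inverse (real (Suc (r n))))) \<longlonglongrightarrow> \<Lambda> * (\<Lambda> - 0)" .
    then show "(\<lambda>n. \<Lambda> * (\<Lambda> - inverse (real (Suc (r n))))) \<longlonglongrightarrow> \<Lambda>\<^sup>2" by (simp add: power2_eq_square)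
    have "\<Lambda> * (\<Lambda> - inverse (real (Suc n))) \<le> ip.norm_sq (v n)" for n
    proof -
      have "\<Lambda> - inverse (real (Suc n)) \<le> \<Lambda> * ip.norm_sq (f n)"
        using near[of n] normalise[OF perp_f[of n]] by simp
      then have "\<Lambda> * (\<Lambda> - inverse (real (Suc n))) \<le> \<Lambda> * (\<Lambda> * ip.norm_sq (f n))"
        using \<open>0 < \<Lambda>\<close> by (intro mult_left_mono) auto
      then show ?thesis by (simp add: v_norm power2_eq_square mult.assoc)
    qed
    then show "\<exists>N. \<forall>n\<ge>N. \<Lambda> * (\<Lambda> - inverse (real (Suc (r n)))) \<le> ip.norm_sq (v (r n))" by blast
  qed
  then show False using \<open>u = 0\<close> \<open>0 < \<Lambda>\<close> ip.mem_zero by (simp add: ip.norm_sq_def ip.zero_left)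
qed

end

section \<open>Eigenfunction expansions\<close>

lemma sum_split_interval:
  fixes F :: "nat \<Rightarrow> 'b::comm_monoid_add"
  assumes "i \<le> j" shows "sum F {1..j} = sum F {1..i} + sum F {Suc i..j}"
proof -
  have eq: "{1..j} = {1..i} \<union> {Suc i..j}" using assms by auto
  show ?thesis unfolding eq by (rule sum.union_disjoint) auto
qed

lemma cnj_mult_self: "cnj z * z = of_real ((cmod z)\<^sup>2)"
  by (subst complex_norm_square) (rule mult.commute)

context embedded_rkhs_spectrum
begin

lemma l2_e: "1 \<le> j \<Longrightarrow> 1 \<le> k \<Longrightarrow> L2_inner M (e j) (e k) = (if j = k then of_real (lam j) else 0)"
  using ip_T[OF e_mem e_mem, of j k] by (cases "j = k") (simp_all add: T_e ip.scale_left e_mem orthonormal)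

definition lincomb :: "nat set \<Rightarrow> (nat \<Rightarrow> complex) \<Rightarrow> 'a \<Rightarrow> complex" where
  "lincomb F a = (\<Sum>k\<in>F. fscale (a k) (e k))"

lemma lincomb_mem: "F \<subseteq> {1..} \<Longrightarrow> lincomb F a \<in> H"
  unfolding lincomb_def using e_mem by (intro ip.mem_sum ip.mem_scale) auto

lemma lincomb_apply: "lincomb F a x = (\<Sum>k\<in>F. a k * e k x)"
  unfolding lincomb_def by (induction F rule: infinite_finite_induct) (simp_all add: fscale_apply)

lemma ip_lincomb_e:
  assumes "finite F" "F \<subseteq> {1..}" "1 \<le> j"
  shows "ip (lincomb F a) (e j) = (if j \<in> F then a j else 0)"
proof -
  have "ip (lincomb F a) (e j) = (\<Sum>k\<in>F. ip (fscale (a k) (e k)) (e j))"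
    unfolding lincomb_def using assms by (intro ip.sum_left ip.mem_scale e_mem) auto
  also have "\<dots> = (\<Sum>k\<in>F. if j = k then a k else 0)"
    using assms by (intro sum.cong refl) (auto simp: ip.scale_left e_mem orthonormal)
  finally show ?thesis using assms by simp
qed

lemma norm_sq_lincomb:
  assumes "finite F" "F \<subseteq> {1..}"
  shows "ip.norm_sq (lincomb F a) = (\<Sum>k\<in>F. (cmod (a k))\<^sup>2)"
proof -
  have "ip (lincomb F a) (lincomb F a) = (\<Sum>k\<in>F. ip (lincomb F a) (fscale (a k) (e k)))"
    using assms unfolding lincomb_def[of F a] by (intro ip.sum_right ip.mem_scale e_mem ip.mem_sum) auto
  also have "\<dots> = (\<Sum>k\<in>F. of_real ((cmod (a k))\<^sup>2))"
  proof (rule sum.cong[OF refl])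
    fix k assume k: "k \<in> F"
    with assms have k1: "1 \<le> k" by auto
    have "ip (lincomb F a) (fscale (a k) (e k)) = cnj (a k) * a k"
      using k ip_lincomb_e[OF assms k1, of a] by (simp add: ip.scale_right lincomb_mem[OF assms(2)] e_mem[OF k1])
    then show "ip (lincomb F a) (fscale (a k) (e k)) = of_real ((cmod (a k))\<^sup>2)" by (simp only: cnj_mult_self)
  qed
  finally show ?thesis by (simp add: ip.norm_sq_def del: of_real_power)
qed

lemma l2_norm_sq_lincomb:
  assumes "finite F" "F \<subseteq> {1..}"
  shows "l2.norm_sq (lincomb F a) = (\<Sum>k\<in>F. (cmod (a k))\<^sup>2 * lam k)"
proof -
  have "L2_inner M (lincomb F a) (lincomb F a) = (\<Sum>k\<in>F. L2_inner M (lincomb F a) (fscale (a k) (e k)))"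
    using assms unfolding lincomb_def[of F a] by (intro l2.sum_right ip.mem_scale e_mem ip.mem_sum) auto
  also have "\<dots> = (\<Sum>k\<in>F. of_real ((cmod (a k))\<^sup>2 * lam k))"
  proof (rule sum.cong[OF refl])
    fix k assume k: "k \<in> F"
    with assms have k1: "1 \<le> k" by auto
    have "L2_inner M (lincomb F a) (e k) = (\<Sum>j\<in>F. L2_inner M (fscale (a j) (e j)) (e k))"
      unfolding lincomb_def using assms k by (intro l2.sum_left ip.mem_scale e_mem) auto
    also have "\<dots> = (\<Sum>j\<in>F. if k = j then a j * of_real (lam j) else 0)"
    proof (rule sum.cong[OF refl])
      fix j assume "j \<in> F"
      with assms have "1 \<le> j" by auto
      then show "L2_inner M (fscale (a j) (e j)) (e k) = (if k = j then a j * of_real (lam j) else 0)"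
        using k1 by (auto simp: l2.scale_left e_mem l2_e)
    qed
    also have "\<dots> = a k * of_real (lam k)" using assms k by simp
    finally have "L2_inner M (lincomb F a) (fscale (a k) (e k)) = cnj (a k) * (a k * of_real (lam k))"
      by (simp only: l2.scale_right lincomb_mem[OF assms(2)] e_mem[OF k1])
    also have "\<dots> = of_real ((cmod (a k))\<^sup>2) * of_real (lam k)"
      unfolding cnj_mult_self[symmetric] by (rule mult.assoc[symmetric])
    finally show "L2_inner M (lincomb F a) (fscale (a k) (e k)) = of_real ((cmod (a k))\<^sup>2 * lam k)"
      by (simp only: of_real_mult)
  qed
  also have "\<dots> = of_real (\<Sum>k\<in>F. (cmod (a k))\<^sup>2 * lam k)" by (simp only: of_real_sum)
  finally show ?thesis unfolding l2.norm_sq_def by (simp only: Re_complex_of_real)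
qed

definition ecoeff :: "('a \<Rightarrow> complex) \<Rightarrow> nat \<Rightarrow> complex" where "ecoeff f k = ip f (e k)"
definition partial :: "('a \<Rightarrow> complex) \<Rightarrow> nat \<Rightarrow> 'a \<Rightarrow> complex" where
  "partial f N = lincomb {1..N} (ecoeff f)"

lemma partial_mem: "partial f N \<in> H" unfolding partial_def by (rule lincomb_mem) auto

lemma norm_sq_diff_lincomb:
  assumes f: "f \<in> H" and F: "finite F" "F \<subseteq> {1..}"
  shows "ip.norm_sq (f - lincomb F (ecoeff f)) = ip.norm_sq f - (\<Sum>k\<in>F. (cmod (ecoeff f k))\<^sup>2)"
proof -
  have "ip f (lincomb F (ecoeff f)) = (\<Sum>k\<in>F. ip f (fscale (ecoeff f k) (e k)))"
    unfolding lincomb_def using f F by (intro ip.sum_right ip.mem_scale e_mem) auto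
  also have "\<dots> = (\<Sum>k\<in>F. of_real ((cmod (ecoeff f k))\<^sup>2))"
  proof (rule sum.cong[OF refl])
    fix k assume k: "k \<in> F"
    with F have "1 \<le> k" by auto
    then have "ip f (fscale (ecoeff f k) (e k)) = cnj (ecoeff f k) * ecoeff f k"
      using ip.scale_right[OF f e_mem, of k "ecoeff f k"] by (simp only: ecoeff_def)
    then show "ip f (fscale (ecoeff f k) (e k)) = of_real ((cmod (ecoeff f k))\<^sup>2)"
      by (simp only: cnj_mult_self)
  qed
  also have "\<dots> = of_real (\<Sum>k\<in>F. (cmod (ecoeff f k))\<^sup>2)" by (simp only: of_real_sum)
  finally have "Re (ip f (lincomb F (ecoeff f))) = (\<Sum>k\<in>F. (cmod (ecoeff f k))\<^sup>2)"
    by (simp only: Re_complex_of_real)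
  then show ?thesis
    unfolding ip.norm_sq_diff[OF f lincomb_mem[OF F(2)]] norm_sq_lincomb[OF F] by simp
qed

lemma Bessel:
  assumes "f \<in> H" "finite F" "F \<subseteq> {1..}"
  shows "(\<Sum>k\<in>F. (cmod (ecoeff f k))\<^sup>2) \<le> ip.norm_sq f"
  using norm_sq_diff_lincomb[OF assms] ip.norm_sq_nonneg[OF ip.mem_diff[OF assms(1) lincomb_mem[OF assms(3)]], of "ecoeff f"]
  by simp

lemma partial_split:
  assumes "i \<le> j" shows "partial f j - partial f i = lincomb {Suc i..j} (ecoeff f)"
proof -
  have "partial f j = partial f i + lincomb {Suc i..j} (ecoeff f)"
    unfolding partial_def lincomb_def by (rule sum_split_interval[OF assms])
  then show ?thesis by simp
qed

text \<open>By Bessel's inequality the partial sums are Cauchy. Their limit has the same coefficients as \<open>f\<close>.\<close>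
lemma expansion:
  assumes f: "f \<in> H"
  shows "\<exists>h. perp h \<and> (\<lambda>N. hnorm ip (partial f N - (f - h))) \<longlonglongrightarrow> 0"
proof -
  define s where "s N = (\<Sum>k=1..N. (cmod (ecoeff f k))\<^sup>2)" for N
  have split: "s j - s i = ip.norm_sq (partial f j - partial f i)" if "i \<le> j" for i j
  proof -
    have "s j = s i + (\<Sum>k\<in>{Suc i..j}. (cmod (ecoeff f k))\<^sup>2)"
      unfolding s_def by (rule sum_split_interval[OF that])
    moreover have "ip.norm_sq (lincomb {Suc i..j} (ecoeff f)) = (\<Sum>k\<in>{Suc i..j}. (cmod (ecoeff f k))\<^sup>2)"
      by (rule norm_sq_lincomb) auto
    ultimately show ?thesis unfolding partial_split[OF that] by simp
  qed
  have inc: "incseq s" unfolding s_def by (intro monoI sum_mono2) auto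
  have "\<forall>N. s N \<le> ip.norm_sq f" unfolding s_def by (intro allI Bessel[OF f]) auto
  then obtain L where "s \<longlonglongrightarrow> L" by (rule incseq_convergent[OF inc])
  then have "Cauchy s" by (rule LIMSEQ_imp_Cauchy)
  have "\<forall>\<epsilon>>0. \<exists>N. \<forall>i\<ge>N. \<forall>j\<ge>N. hnorm ip (partial f i - partial f j) < \<epsilon>"
  proof (intro allI impI)
    fix \<epsilon> :: real assume "0 < \<epsilon>"
    then have "0 < \<epsilon>\<^sup>2" by simp
    from metric_CauchyD[OF \<open>Cauchy s\<close> this]
    obtain N where N: "\<forall>i\<ge>N. \<forall>j\<ge>N. dist (s i) (s j) < \<epsilon>\<^sup>2" by blast
    have "hnorm ip (partial f i - partial f j) < \<epsilon>" if ij: "N \<le> i" "N \<le> j" for i j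
    proof -
      have "ip.norm_sq (partial f i - partial f j) = dist (s i) (s j)"
      proof (cases "i \<le> j")
        case True
        have "ip.norm_sq (partial f i - partial f j) = s j - s i"
          unfolding ip.norm_sq_diff_commute[OF partial_mem[of f i] partial_mem[of f j]] split[OF True] ..
        moreover have "s i \<le> s j" using \<open>incseq s\<close> True by (rule incseqD)
        ultimately show ?thesis by (simp add: dist_real_def)
      next
        case False
        then have "s i - s j = ip.norm_sq (partial f i - partial f j)" by (intro split) simp
        moreover have "s j \<le> s i" using False by (intro incseqD[OF inc]) simp
        ultimately show ?thesis by (simp add: dist_real_def)
      qed
      then have "ip.norm_sq (partial f i - partial f j) < \<epsilon>\<^sup>2" using N ij by simp
      then show ?thesis unfolding hnorm_eq using \<open>0 < \<epsilon>\<close> by (intro real_less_lsqrt) auto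
    qed
    then show "\<exists>N. \<forall>i\<ge>N. \<forall>j\<ge>N. hnorm ip (partial f i - partial f j) < \<epsilon>" by blast
  qed
  moreover have "\<forall>i. partial f i \<in> H" by (simp add: partial_mem)
  ultimately have "\<exists>g\<in>H. (\<lambda>N. hnorm ip (partial f N - g)) \<longlonglongrightarrow> 0" by (intro complete)
  then obtain g where g: "g \<in> H" and lim: "(\<lambda>N. hnorm ip (partial f N - g)) \<longlonglongrightarrow> 0" by (rule bexE)
  have "perp (f - g)"
    unfolding perp_def
  proof (intro conjI allI impI)
    show "f - g \<in> H" by (rule ip.mem_diff[OF f g])
    fix k :: nat assume k: "1 \<le> k"
    have "(\<lambda>N. ip (partial f N) (e k)) \<longlonglongrightarrow> ip g (e k)"
      by (intro tendsto_ip_left partial_mem g e_mem k lim)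
    moreover have "\<forall>\<^sub>F N in sequentially. ip (partial f N) (e k) = ip f (e k)"
      unfolding partial_def using k
      by (intro eventually_sequentiallyI[of k]) (subst ip_lincomb_e, auto simp: ecoeff_def)
    then have "(\<lambda>N. ip (partial f N) (e k)) \<longlonglongrightarrow> ip f (e k)" by (rule tendsto_eventually)
    ultimately have "ip g (e k) = ip f (e k)" by (rule LIMSEQ_unique)
    then show "ip (f - g) (e k) = 0" using f g k by (simp add: ip.diff_left e_mem)
  qed
  then show ?thesis using lim by (intro exI[of _ "f - g"]) simp
qed

lemma perp_expansion_orthogonal:
  assumes f: "f \<in> H" and h: "perp h" and lim: "(\<lambda>N. hnorm ip (partial f N - (f - h))) \<longlonglongrightarrow> 0" and g: "perp g"
  shows "ip (f - h) g = 0"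
proof -
  have "ip (partial f N) g = 0" for N
  proof -
    have "ip (partial f N) g = (\<Sum>k\<in>{1..N}. ip (fscale (ecoeff f k) (e k)) g)"
      unfolding partial_def lincomb_def by (intro ip.sum_left ip.mem_scale e_mem perp_mem[OF g]) auto
    also have "\<dots> = 0"
    proof (intro sum.neutral ballI)
      fix k assume "k \<in> {1..N}"
      then show "ip (fscale (ecoeff f k) (e k)) g = 0"
        using perp_e[OF g, of k] ip_commute[OF perp_mem[OF g] e_mem, of k] by (simp add: ip.scale_left e_mem perp_mem[OF g])
    qed
    finally show ?thesis .
  qed
  moreover have "(\<lambda>N. ip (partial f N) g) \<longlonglongrightarrow> ip (f - h) g"
    by (intro tendsto_ip_left partial_mem ip.mem_diff f perp_mem h g lim)
  ultimately show ?thesis by (simp add: LIMSEQ_const_iff)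
qed

definition vanishing_point :: "'a \<Rightarrow> bool" where
  "vanishing_point x \<longleftrightarrow> (\<forall>h. perp h \<longrightarrow> h x = 0)"

text \<open>Every function orthogonal to the eigenfunctions vanishes almost everywhere, but there are uncountably
  many of them. Let \<open>p i\<close> be the orthogonal projections of a dense sequence \<open>c i\<close> to this complement. They are
  dense in it, because \<open>p i\<close> is at least as close as \<open>c i\<close> to each of its elements. Outside the union of
  countably many null sets all \<open>p i\<close> vanish, and there their limits vanish as well.\<close>
lemma AE_vanishing_point: "AE x in M. vanishing_point x"
proof -
  obtain c where dense: "dense_sequence c" using dense_sequence_ex by blast
  note c = dense_sequence_mem[OF dense]
  have "\<forall>i. \<exists>p. perp p \<and> (\<lambda>N. hnorm ip (partial (c i) N - (c i - p))) \<longlonglongrightarrow> 0"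
    by (intro allI expansion c)
  from choice[OF this]
  obtain p where pp: "\<forall>i. perp (p i) \<and> (\<lambda>N. hnorm ip (partial (c i) N - (c i - p i))) \<longlonglongrightarrow> 0" ..
  then have p: "perp (p i)" and plim: "(\<lambda>N. hnorm ip (partial (c i) N - (c i - p i))) \<longlonglongrightarrow> 0" for i
    by simp_all
  \<comment> \<open>Pythagoras: \<open>c i - p i\<close> is orthogonal to the complement, which contains \<open>p i - h\<close>\<close>
  have closer: "ip.norm_sq (p i - h) \<le> ip.norm_sq (c i - h)" if h: "perp h" for i h
  proof -
    have m: "p i \<in> H" "h \<in> H" using p h perp_mem by auto
    have pp: "perp (p i - h)" using p[of i] h unfolding perp_def by (auto simp: ip.mem_diff ip.diff_left e_mem)
    have "ip (c i - p i) (p i - h) = 0"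
      by (rule perp_expansion_orthogonal[OF c p plim pp])
    moreover have "c i - h = (c i - p i) + (p i - h)" by simp
    ultimately have "ip.norm_sq (c i - h) = ip.norm_sq (c i - p i) + ip.norm_sq (p i - h)"
      using ip.norm_sq_add[OF ip.mem_diff[OF c[of i] m(1)] ip.mem_diff[OF m]] by simp
    then show ?thesis using ip.norm_sq_nonneg[OF ip.mem_diff[OF c m(1)], of i] by simp
  qed
  have "AE x in M. \<forall>i. p i x = 0"
    unfolding AE_all_countable
  proof
    fix i
    have pm: "p i \<in> H" by (rule perp_mem[OF p])
    have "(\<integral>x. (cmod (p i x))\<^sup>2 \<partial>M) = 0" using perp_l2_norm_sq_eq_0[OF p] l2_norm_sq[OF pm] by simp
    then have "AE x in M. (cmod (p i x))\<^sup>2 = 0"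
      using integral_nonneg_eq_0_iff_AE[OF integrable_square[OF pm]] by simp
    then show "AE x in M. p i x = 0" by simp
  qed
  moreover have "AE x in M. x \<in> D" using space_M by (intro AE_I2) simp
  ultimately show ?thesis
  proof eventually_elim
    case (elim x)
    show ?case
      unfolding vanishing_point_def
    proof (intro allI impI)
      fix h assume h: "perp h"
      obtain r where r: "(\<lambda>i. hnorm ip (c (r i) - h)) \<longlonglongrightarrow> 0"
        by (rule approximating_sequence[OF dense perp_mem[OF h]])
      have "(\<lambda>i. hnorm ip (p (r i) - h)) \<longlonglongrightarrow> 0"
      proof (rule Lim_null_comparison[OF _ r], intro always_eventually allI)
        fix i
        have "hnorm ip (p (r i) - h) \<le> hnorm ip (c (r i) - h)"
          unfolding hnorm_eq using closer[OF h] by simp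
        then show "norm (hnorm ip (p (r i) - h)) \<le> hnorm ip (c (r i) - h)"
          using hnorm_nonneg[OF ip.mem_diff[OF perp_mem[OF p] perp_mem[OF h]], of "r i"] by simp
      qed
      from tendsto_eval[OF perp_mem[OF p] perp_mem[OF h] this, of x]
      show "h x = 0" using elim(1) by (simp add: LIMSEQ_const_iff)
    qed
  qed
qed

lemma partial_tendsto:
  assumes f: "f \<in> H" and x: "vanishing_point x"
  shows "(\<lambda>N. partial f N x) \<longlonglongrightarrow> f x"
proof -
  obtain h where h: "perp h" and lim: "(\<lambda>N. hnorm ip (partial f N - (f - h))) \<longlonglongrightarrow> 0"
    by (rule exE[OF expansion[OF f]]) (erule conjE, rule that)
  have "(\<lambda>N. partial f N x) \<longlonglongrightarrow> (f - h) x"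
    by (intro tendsto_eval partial_mem ip.mem_diff f perp_mem[OF h] lim)
  moreover have "h x = 0" using x h by (simp add: vanishing_point_def)
  ultimately show ?thesis by simp
qed

lemma coeff_ks: "x \<in> D \<Longrightarrow> 1 \<le> k \<Longrightarrow> ecoeff (ks x) k = cnj (e k x)"
  unfolding ecoeff_def using ip_commute[OF e_mem ks_mem, of k x] eval_eq[OF e_mem, of k x] by simp

lemma kernel_diag_Bessel:
  assumes "x \<in> D" "finite F" "F \<subseteq> {1..}" shows "(\<Sum>k\<in>F. (cmod (e k x))\<^sup>2) \<le> Re (K x x)"
proof -
  have "(\<Sum>k\<in>F. (cmod (e k x))\<^sup>2) = (\<Sum>k\<in>F. (cmod (ecoeff (ks x) k))\<^sup>2)"
    using assms by (intro sum.cong refl) (auto simp: coeff_ks)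
  then show ?thesis using Bessel[OF ks_mem[OF assms(1)] assms(2,3)] by (simp add: norm_sq_ks assms(1))
qed

text \<open>The expansion of the kernel section at \<open>x\<close>, evaluated at \<open>x\<close>.\<close>
lemma kernel_diag_expansion:
  assumes x: "x \<in> D" "vanishing_point x"
  shows "(\<lambda>N. \<Sum>k=1..N. (cmod (e k x))\<^sup>2) \<longlonglongrightarrow> Re (K x x)"
proof -
  have "(\<lambda>N. Re (partial (ks x) N x)) \<longlonglongrightarrow> Re (ks x x)"
    by (intro tendsto_Re partial_tendsto ks_mem x)
  moreover have "Re (partial (ks x) N x) = (\<Sum>k=1..N. (cmod (e k x))\<^sup>2)" for N
  proof -
    have "partial (ks x) N x = (\<Sum>k=1..N. of_real ((cmod (e k x))\<^sup>2))"
      unfolding partial_def lincomb_apply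
    proof (rule sum.cong[OF refl])
      fix k assume "k \<in> {1..N}"
      then have "ecoeff (ks x) k * e k x = cnj (e k x) * e k x" using x by (simp add: coeff_ks)
      then show "ecoeff (ks x) k * e k x = of_real ((cmod (e k x))\<^sup>2)"
        by (simp only: cnj_mult_self)
    qed
    then show ?thesis by (simp del: of_real_power)
  qed
  moreover have "Re (ks x x) = Re (K x x)" using x by (simp add: ks_def kernel_section_def)
  ultimately show ?thesis by simp
qed

lemma integral_e: "1 \<le> k \<Longrightarrow> (\<integral>x. (cmod (e k x))\<^sup>2 \<partial>M) = lam k"
  using l2_norm_sq[OF e_mem, of k] l2_e[of k k] by (simp add: l2.norm_sq_def)

text \<open>The expansion of the diagonal is integrated term by term, dominated by the diagonal itself.\<close>
lemma trace_sums: "(\<lambda>N. \<Sum>k=1..N. lam k) \<longlonglongrightarrow> kernel_trace"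
proof -
  have "(\<lambda>N. \<integral>x. (\<Sum>k=1..N. (cmod (e k x))\<^sup>2) \<partial>M) \<longlonglongrightarrow> (\<integral>x. Re (K x x) \<partial>M)"
  proof (rule integral_dominated_convergence[where w="\<lambda>x. Re (K x x)"])
    have "AE x in M. x \<in> D" using space_M by (intro AE_I2) simp
    then show "AE x in M. (\<lambda>N. \<Sum>k=1..N. (cmod (e k x))\<^sup>2) \<longlonglongrightarrow> Re (K x x)"
      using AE_vanishing_point by eventually_elim (rule kernel_diag_expansion)
    show "AE x in M. norm (\<Sum>k=1..N. (cmod (e k x))\<^sup>2) \<le> Re (K x x)" for N
      using kernel_diag_Bessel[of _ "{1..N}"] space_M
      by (intro AE_I2) (auto simp: sum_nonneg)
    show "(\<lambda>x. \<Sum>k=1..N. (cmod (e k x))\<^sup>2) \<in> borel_measurable M" for N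
    proof (rule borel_measurable_sum)
      fix k assume "k \<in> {1..N}"
      then show "(\<lambda>x. (cmod (e k x))\<^sup>2) \<in> borel_measurable M"
        by (intro borel_measurable_integrable integrable_square e_mem) simp
    qed
  qed (rule kernel_diag_measurable kernel_diag_integrable)+
  moreover have "(\<integral>x. (\<Sum>k=1..N. (cmod (e k x))\<^sup>2) \<partial>M) = (\<Sum>k=1..N. lam k)" for N
  proof -
    have "(\<integral>x. (\<Sum>k=1..N. (cmod (e k x))\<^sup>2) \<partial>M) = (\<Sum>k=1..N. \<integral>x. (cmod (e k x))\<^sup>2 \<partial>M)"
      by (intro Bochner_Integration.integral_sum integrable_square e_mem) auto
    also have "\<dots> = (\<Sum>k=1..N. lam k)" by (intro sum.cong refl integral_e) auto
    finally show ?thesis .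
  qed
  ultimately show ?thesis by (simp add: kernel_trace_def)
qed

text \<open>The part of \<open>f\<close> that is orthogonal to all eigenfunctions does not appear in the expansion of \<open>f\<close>; its
  \<open>L\<^sub>2\<close> norm is zero. In the expansion of the rest, the squared coefficients are weighted with eigenvalues
  that are at most \<open>lam m\<close>.\<close>
lemma residual_l2_le:
  assumes f: "f \<in> H" and m: "1 \<le> m"
  shows "l2.norm_sq (f - partial f (m - 1)) \<le> lam m * ip.norm_sq f"
proof -
  obtain h where h: "perp h" and lim: "(\<lambda>N. hnorm ip (partial f N - (f - h))) \<longlonglongrightarrow> 0"
    by (rule exE[OF expansion[OF f]]) (erule conjE, rule that)
  note mems = f perp_mem[OF h] partial_mem
  let ?r = "f - partial f (m - 1)"
  have lm: "0 \<le> lam m * ip.norm_sq f" using lam_pos[OF m] ip.norm_sq_nonneg[OF f] by simp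
  have "sqrt (l2.norm_sq ?r) \<le> sqrt (lam m * ip.norm_sq f) + 0"
  proof (rule LIMSEQ_le_const)
    show "(\<lambda>N. sqrt (lam m * ip.norm_sq f) + sqrt kernel_trace * hnorm ip (partial f N - (f - h)))
        \<longlonglongrightarrow> sqrt (lam m * ip.norm_sq f) + 0"
      by (intro tendsto_add tendsto_const tendsto_mult_right_zero lim)
    have "sqrt (l2.norm_sq ?r) \<le> sqrt (lam m * ip.norm_sq f) + sqrt kernel_trace * hnorm ip (partial f N - (f - h))"
      if N: "m - 1 \<le> N" for N
    proof -
      let ?g = "partial f N - partial f (m - 1)" and ?d = "(f - h) - partial f N"
      have g: "?g \<in> H" and d: "?d \<in> H" using mems by (auto intro!: ip.mem_diff)
      have "?r = (?g + ?d) + h" by simp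
      then have r1: "sqrt (l2.norm_sq ?r) \<le> sqrt (l2.norm_sq (?g + ?d)) + sqrt (l2.norm_sq h)"
        using l2.sqrt_norm_sq_triangle[OF ip.mem_add[OF g d] perp_mem[OF h]] by simp
      have r2: "sqrt (l2.norm_sq h) = 0" using perp_l2_norm_sq_eq_0[OF h] by simp
      have r3: "sqrt (l2.norm_sq (?g + ?d)) \<le> sqrt (l2.norm_sq ?g) + sqrt (l2.norm_sq ?d)"
        by (rule l2.sqrt_norm_sq_triangle[OF g d])
      have r4: "l2.norm_sq ?g \<le> lam m * ip.norm_sq f"
      proof -
        have "l2.norm_sq ?g = (\<Sum>k\<in>{Suc (m - 1)..N}. (cmod (ecoeff f k))\<^sup>2 * lam k)"
          unfolding partial_split[OF N] by (rule l2_norm_sq_lincomb) auto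
        also have "\<dots> \<le> (\<Sum>k\<in>{Suc (m - 1)..N}. (cmod (ecoeff f k))\<^sup>2 * lam m)"
          using m by (intro sum_mono mult_left_mono lam_antimono) auto
        also have "\<dots> = lam m * (\<Sum>k\<in>{Suc (m - 1)..N}. (cmod (ecoeff f k))\<^sup>2)"
          by (simp add: sum_distrib_left mult.commute)
        also have "\<dots> \<le> lam m * ip.norm_sq f"
          using lam_pos[OF m] m by (intro mult_left_mono Bessel f) auto
        finally show ?thesis .
      qed
      have r5: "sqrt (l2.norm_sq ?d) \<le> sqrt kernel_trace * hnorm ip (partial f N - (f - h))"
      proof -
        have "l2.norm_sq ?d \<le> kernel_trace * ip.norm_sq (partial f N - (f - h))"
          using l2_norm_sq_le[OF d] ip.norm_sq_diff_commute[OF ip.mem_diff[OF f perp_mem[OF h]] partial_mem] by simp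
        then show ?thesis by (simp add: hnorm_eq flip: real_sqrt_mult)
      qed
      show ?thesis using r1 r2 r3 real_sqrt_le_mono[OF r4] r5 by linarith
    qed
    then show "\<exists>N. \<forall>n\<ge>N. sqrt (l2.norm_sq ?r) \<le> sqrt (lam m * ip.norm_sq f) + sqrt kernel_trace * hnorm ip (partial f n - (f - h))"
      by blast
  qed
  then show ?thesis using lm by simp
qed

end

section \<open>The sampling density\<close>

locale sampling_setup = embedded_rkhs_spectrum D K H ip M lam e
  for D :: "'a set" and K and H :: "('a \<Rightarrow> complex) set" and ip and M and lam and e +
  fixes m :: nat
  assumes m_ge: "2 \<le> m"
begin

abbreviation \<rho> :: "'a \<Rightarrow> real" where "\<rho> \<equiv> sampling_density K lam e m"
abbreviation \<mu> :: "'a measure" where "\<mu> \<equiv> sampling_measure M K lam e m"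

definition tail_trace :: real where "tail_trace = (\<Sum>j. lam (m + j))"

lemma tail_sums: "(\<lambda>j. lam (m + j)) sums (kernel_trace - (\<Sum>k=1..m-1. lam k))"
proof -
  have part: "(\<Sum>j<n. lam (m + j)) = (\<Sum>k=1..n+(m-1). lam k) - (\<Sum>k=1..m-1. lam k)" for n
  proof (induction n)
    case (Suc n)
    have "Suc n + (m - 1) = Suc (n + (m - 1))" by simp
    then have "(\<Sum>k=1..Suc n+(m-1). lam k) = (\<Sum>k=1..n+(m-1). lam k) + lam (Suc (n + (m - 1)))" by simp
    also have "Suc (n + (m - 1)) = m + n" using m_ge by simp
    finally show ?case using Suc by (simp only: sum.lessThan_Suc)
  qed simp
  have "(\<lambda>n. (\<Sum>k=1..n+(m-1). lam k) - (\<Sum>k=1..m-1. lam k)) \<longlonglongrightarrow> kernel_trace - (\<Sum>k=1..m-1. lam k)"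
    by (intro tendsto_diff tendsto_const LIMSEQ_ignore_initial_segment[OF trace_sums])
  then show ?thesis unfolding sums_def part .
qed

lemma tail_summable: "summable (\<lambda>j. lam (m + j))" using tail_sums by (rule sums_summable)
lemma tail_trace_eq: "tail_trace = kernel_trace - (\<Sum>k=1..m-1. lam k)"
  unfolding tail_trace_def using tail_sums by (rule sums_unique[symmetric])
lemma tail_trace_pos: "0 < tail_trace"
  unfolding tail_trace_def using m_ge by (intro suminf_pos tail_summable lam_pos) simp

definition low_part :: "'a \<Rightarrow> real" where "low_part x = (\<Sum>j=1..m-1. (cmod (eta lam e j x))\<^sup>2)"
definition high_part :: "'a \<Rightarrow> real" where "high_part x = Re (K x x) - (\<Sum>j=1..m-1. (cmod (e j x))\<^sup>2)"

lemma density_eq: "\<rho> x = 1 / 2 * (1 / (real m - 1) * low_part x + inverse tail_trace * high_part x)"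
  unfolding sampling_density_def low_part_def high_part_def tail_trace_def ..

lemma low_part_nonneg: "0 \<le> low_part x" by (simp add: low_part_def sum_nonneg)

lemma high_part_ge: 
  assumes x: "x \<in> D" shows "(\<Sum>j<N. (cmod (e (m + j) x))\<^sup>2) \<le> high_part x"
proof -
  have "(\<Sum>j<N. (cmod (e (m + j) x))\<^sup>2) = (\<Sum>k\<in>{m..<m+N}. (cmod (e k x))\<^sup>2)"
    by (rule sum.reindex_bij_witness[where i="\<lambda>k. k - m" and j="\<lambda>j. m + j"]) auto
  then have "(\<Sum>j<N. (cmod (e (m + j) x))\<^sup>2) + (\<Sum>j=1..m-1. (cmod (e j x))\<^sup>2)
      = (\<Sum>k\<in>{m..<m+N} \<union> {1..m-1}. (cmod (e k x))\<^sup>2)"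
    using m_ge by (subst sum.union_disjoint) auto
  also have "\<dots> \<le> Re (K x x)" using m_ge by (intro kernel_diag_Bessel x) auto
  finally show ?thesis by (simp add: high_part_def)
qed

lemma high_part_nonneg: "x \<in> D \<Longrightarrow> 0 \<le> high_part x" using high_part_ge[of x 0] by simp

lemma density_nonneg: "x \<in> D \<Longrightarrow> 0 \<le> \<rho> x"
  unfolding density_eq using low_part_nonneg high_part_nonneg tail_trace_pos m_ge
  by (intro mult_nonneg_nonneg add_nonneg_nonneg) auto

text \<open>This inequality and the next one are the purpose of the density: each of its two halves bounds the
  squared norm of one family of weighted function values, uniformly in \<open>x\<close>.\<close>
lemma low_part_le: "x \<in> D \<Longrightarrow> low_part x \<le> 2 * (real m - 1) * \<rho> x"
proof -
  assume x: "x \<in> D"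
  have "0 \<le> (real m - 1) * (inverse tail_trace * high_part x)"
    using high_part_nonneg[OF x] tail_trace_pos m_ge by (intro mult_nonneg_nonneg) auto
  moreover have "2 * (real m - 1) * \<rho> x = low_part x + (real m - 1) * (inverse tail_trace * high_part x)"
    unfolding density_eq using m_ge by (simp add: distrib_left)
  ultimately show ?thesis by simp
qed

lemma high_part_le: "x \<in> D \<Longrightarrow> high_part x \<le> 2 * tail_trace * \<rho> x"
proof -
  assume x: "x \<in> D"
  have "0 \<le> tail_trace * (1 / (real m - 1) * low_part x)"
    using low_part_nonneg tail_trace_pos m_ge by (intro mult_nonneg_nonneg) auto
  moreover have "2 * tail_trace * \<rho> x
      = tail_trace * (1 / (real m - 1) * low_part x) + (tail_trace * inverse tail_trace) * high_part x"
  proof -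
    have "2 * t * (1 / 2 * (a + i * h)) = t * a + (t * i) * h" for t a i h :: real
      by (simp add: algebra_simps)
    then show ?thesis unfolding density_eq .
  qed
  ultimately show ?thesis using tail_trace_pos by simp
qed

lemma eta_mem: "1 \<le> k \<Longrightarrow> eta lam e k \<in> H" by (simp add: eta_def ip.mem_scale e_mem)

lemma l2_eta:
  assumes "1 \<le> j" "1 \<le> k" shows "L2_inner M (eta lam e j) (eta lam e k) = (if j = k then 1 else 0)"
proof -
  have "L2_inner M (eta lam e j) (eta lam e k)
      = of_real (1 / sqrt (lam j)) * (of_real (1 / sqrt (lam k)) * L2_inner M (e j) (e k))"
    unfolding eta_def using assms by (simp only: l2.scale_left l2.scale_right ip.mem_scale e_mem complex_cnj_complex_of_real mult.left_commute)
  moreover have "1 / sqrt (lam k) * (1 / sqrt (lam k) * lam k) = 1"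
    using lam_pos[OF assms(2)] by (simp add: divide_simps)
  then have "complex_of_real (1 / sqrt (lam k)) * (of_real (1 / sqrt (lam k)) * of_real (lam k)) = 1"
    by (metis of_real_1 of_real_mult)
  ultimately show ?thesis using l2_e[OF assms] by (cases "j = k") simp_all
qed

lemma integral_eta: "1 \<le> k \<Longrightarrow> (\<integral>x. (cmod (eta lam e k x))\<^sup>2 \<partial>M) = 1"
  using l2_norm_sq[OF eta_mem, of k] l2_eta[of k k] by (simp add: l2.norm_sq_def)

lemma low_part_integrable: "integrable M low_part" and integral_low_part: "(\<integral>x. low_part x \<partial>M) = real m - 1"
proof -
  show "integrable M low_part" unfolding low_part_def[abs_def]
    by (intro Bochner_Integration.integrable_sum integrable_square eta_mem) auto
  have "(\<integral>x. low_part x \<partial>M) = (\<Sum>j=1..m-1. \<integral>x. (cmod (eta lam e j x))\<^sup>2 \<partial>M)"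
    unfolding low_part_def by (intro Bochner_Integration.integral_sum integrable_square eta_mem) auto
  also have "\<dots> = (\<Sum>j=1..m-1. 1)" by (intro sum.cong refl integral_eta) auto
  also have "\<dots> = real m - 1" using m_ge by (simp add: of_nat_diff)
  finally show "(\<integral>x. low_part x \<partial>M) = real m - 1" .
qed

lemma high_part_integrable: "integrable M high_part" and integral_high_part: "(\<integral>x. high_part x \<partial>M) = tail_trace"
proof -
  have s: "integrable M (\<lambda>x. \<Sum>j=1..m-1. (cmod (e j x))\<^sup>2)"
    by (intro Bochner_Integration.integrable_sum integrable_square e_mem) auto
  show "integrable M high_part" unfolding high_part_def[abs_def]
    by (intro Bochner_Integration.integrable_diff kernel_diag_integrable s)
  have "(\<integral>x. (\<Sum>j=1..m-1. (cmod (e j x))\<^sup>2) \<partial>M) = (\<Sum>j=1..m-1. \<integral>x. (cmod (e j x))\<^sup>2 \<partial>M)"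
    by (intro Bochner_Integration.integral_sum integrable_square e_mem) auto
  also have "\<dots> = (\<Sum>j=1..m-1. lam j)" by (intro sum.cong refl integral_e) auto
  finally show "(\<integral>x. high_part x \<partial>M) = tail_trace"
    unfolding high_part_def tail_trace_eq kernel_trace_def
    by (simp only: Bochner_Integration.integral_diff[OF kernel_diag_integrable s])
qed

lemma density_integrable: "integrable M \<rho>" and integral_density_eq_1: "(\<integral>x. \<rho> x \<partial>M) = 1"
proof -
  have eq: "\<rho> = (\<lambda>x. 1 / 2 * (1 / (real m - 1) * low_part x + inverse tail_trace * high_part x))"
    using density_eq by (rule ext)
  note ints = integrable_mult_right[OF low_part_integrable] integrable_mult_right[OF high_part_integrable]
  show "integrable M \<rho>" unfolding eq
    by (intro integrable_mult_right Bochner_Integration.integrable_add ints)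
  have "(\<integral>x. \<rho> x \<partial>M) = 1 / 2 * (1 / (real m - 1) * (real m - 1) + inverse tail_trace * tail_trace)"
    unfolding eq by (simp only: integral_mult_right_zero Bochner_Integration.integral_add[OF ints] integral_low_part integral_high_part)
  then show "(\<integral>x. \<rho> x \<partial>M) = 1" using m_ge tail_trace_pos by simp
qed

lemma density_measurable: "\<rho> \<in> borel_measurable M" using density_integrable by (rule borel_measurable_integrable)

lemma space_\<mu>: "space \<mu> = D" by (simp add: sampling_measure_def space_M)
lemma sets_\<mu>: "sets \<mu> = sets M" by (simp add: sampling_measure_def)

lemma prob_space_\<mu>: "prob_space \<mu>"
proof
  have "emeasure \<mu> (space \<mu>) = (\<integral>\<^sup>+x. ennreal (\<rho> x) \<partial>M)"
    unfolding sampling_measure_def using density_measurable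
    by (subst emeasure_density) (auto intro!: nn_integral_cong simp: indicator_def)
  also have "\<dots> = ennreal (\<integral>x. \<rho> x \<partial>M)"
    using density_nonneg space_M by (intro nn_integral_eq_integral density_integrable AE_I2) simp
  finally show "emeasure \<mu> (space \<mu>) = 1" by (simp add: integral_density_eq_1)
qed

text \<open>The values are conjugated so that \<open>y y\<^sup>*\<close> for \<open>y = node_vector g x\<close> is the contribution of the node
  \<open>x\<close> to the Gram matrix \<open>L\<^sup>* L\<close> of the design matrix \<open>L\<close>.\<close>
definition node_vector :: "(nat \<Rightarrow> 'a \<Rightarrow> complex) \<Rightarrow> 'a \<Rightarrow> nat \<Rightarrow> complex" where
  "node_vector g x j = (if \<rho> x \<noteq> 0 then cnj (g j x) / of_real (sqrt (\<rho> x)) else 0)"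

lemma node_vector_measurable: "g j \<in> H \<Longrightarrow> (\<lambda>x. node_vector g x j) \<in> borel_measurable M"
proof -
  assume "g j \<in> H"
  then have [measurable]: "g j \<in> borel_measurable M" by (rule measurable_mem)
  note density_measurable [measurable]
  show ?thesis unfolding node_vector_def by measurable
qed

text \<open>The two square roots of \<open>\<rho>\<close> in the denominators cancel the density; where it vanishes, so does
  \<open>g i\<close>.\<close>
lemma node_vector_covariance:
  assumes g: "g i \<in> H" "g j \<in> H" and zero: "\<And>x. x \<in> D \<Longrightarrow> \<rho> x = 0 \<Longrightarrow> g i x = 0"
  shows "(\<integral>x. node_vector g x i * cnj (node_vector g x j) \<partial>\<mu>) = L2_inner M (g j) (g i)"
proof -
  have meas: "(\<lambda>x. node_vector g x i * cnj (node_vector g x j)) \<in> borel_measurable M"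
    using node_vector_measurable[of g i, OF g(1)] node_vector_measurable[of g j, OF g(2)] by measurable
  have "(\<integral>x. node_vector g x i * cnj (node_vector g x j) \<partial>\<mu>)
      = (\<integral>x. \<rho> x *\<^sub>R (node_vector g x i * cnj (node_vector g x j)) \<partial>M)"
    unfolding sampling_measure_def using density_nonneg space_M
    by (intro integral_density meas density_measurable AE_I2) simp
  also have "\<dots> = (\<integral>x. g j x * cnj (g i x) \<partial>M)"
  proof (rule Bochner_Integration.integral_cong[OF refl])
    fix x assume "x \<in> space M"
    then have x: "x \<in> D" by (simp add: space_M)
    show "\<rho> x *\<^sub>R (node_vector g x i * cnj (node_vector g x j)) = g j x * cnj (g i x)"
    proof (cases "\<rho> x = 0")
      case True
      then show ?thesis using zero[OF x True] by simp
    next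
      case False
      then have pos: "0 < \<rho> x" using density_nonneg[OF x] by simp
      then have "complex_of_real (sqrt (\<rho> x)) * complex_of_real (sqrt (\<rho> x)) = of_real (\<rho> x)"
        by (simp flip: of_real_mult)
      then show ?thesis using pos False by (simp add: node_vector_def scaleR_conv_of_real field_simps)
    qed
  qed
  finally show ?thesis by (simp add: L2_inner_def)
qed

lemma node_vector_norm:
  assumes x: "x \<in> D" and le: "(\<Sum>j<d. (cmod (g j x))\<^sup>2) \<le> R * \<rho> x" and "0 \<le> R"
  shows "vec_norm_sq d (node_vector g x) \<le> R"
proof (cases "\<rho> x = 0")
  case True
  then show ?thesis using \<open>0 \<le> R\<close> by (simp add: vec_norm_sq_def node_vector_def)
next
  case False
  then have pos: "0 < \<rho> x" using density_nonneg[OF x] by simp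
  have "vec_norm_sq d (node_vector g x) = (\<Sum>j<d. (cmod (g j x))\<^sup>2 / \<rho> x)"
    unfolding vec_norm_sq_def using pos False
    by (intro sum.cong refl) (simp add: node_vector_def norm_divide power_divide)
  also have "\<dots> = (\<Sum>j<d. (cmod (g j x))\<^sup>2) / \<rho> x" by (simp add: sum_divide_distrib)
  also have "\<dots> \<le> R" using le pos by (simp add: field_simps)
  finally show ?thesis .
qed

definition low_fun :: "nat \<Rightarrow> 'a \<Rightarrow> complex" where "low_fun j = eta lam e (Suc j)"
definition high_fun :: "nat \<Rightarrow> 'a \<Rightarrow> complex" where "high_fun j = e (m + j)"

lemma low_sum: "(\<Sum>j<m-1. (cmod (low_fun j x))\<^sup>2) = low_part x"
  unfolding low_part_def low_fun_def
  by (rule sum.reindex_bij_witness[where i="\<lambda>k. k - 1" and j=Suc]) auto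

lemma low_zero: "x \<in> D \<Longrightarrow> \<rho> x = 0 \<Longrightarrow> j < m - 1 \<Longrightarrow> low_fun j x = 0"
proof -
  assume x: "x \<in> D" "\<rho> x = 0" "j < m - 1"
  have "(\<Sum>j<m-1. (cmod (low_fun j x))\<^sup>2) \<le> 0" unfolding low_sum using low_part_le[OF x(1)] x(2) by simp
  then have "(\<Sum>j<m-1. (cmod (low_fun j x))\<^sup>2) = 0" by (intro order_antisym sum_nonneg) auto
  then have "\<forall>j\<in>{..<m-1}. (cmod (low_fun j x))\<^sup>2 = 0" by (subst (asm) sum_nonneg_eq_0_iff) auto
  then show ?thesis using x(3) by simp
qed

lemma high_zero: "x \<in> D \<Longrightarrow> \<rho> x = 0 \<Longrightarrow> high_fun j x = 0"
proof -
  assume x: "x \<in> D" "\<rho> x = 0"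
  have "(\<Sum>j<Suc j. (cmod (e (m + j) x))\<^sup>2) \<le> 0"
    using high_part_ge[OF x(1), of "Suc j"] high_part_le[OF x(1)] x(2) by simp
  moreover have "0 \<le> (\<Sum>j<j. (cmod (e (m + j) x))\<^sup>2)" by (intro sum_nonneg) auto
  ultimately have "(cmod (e (m + j) x))\<^sup>2 \<le> 0" unfolding sum.lessThan_Suc by linarith
  then show ?thesis by (simp add: high_fun_def)
qed

lemma low_fun_mem: "low_fun j \<in> H" unfolding low_fun_def by (rule eta_mem) simp
lemma high_fun_mem: "high_fun j \<in> H" unfolding high_fun_def using m_ge by (intro e_mem) simp

lemma low_vectors:
  "independent_vectors \<mu> (node_vector low_fun) (m - 1) (2 * (real m - 1)) (\<lambda>_. 1)"
proof (intro independent_vectors.intro independent_vectors_axioms.intro prob_space_\<mu>)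
  show "(\<lambda>x. node_vector low_fun x j) \<in> borel_measurable \<mu>" if "j < m - 1" for j
    using node_vector_measurable[of low_fun j, OF low_fun_mem] by (simp add: measurable_cong_sets[OF sets_\<mu> refl])
  show "vec_norm_sq (m - 1) (node_vector low_fun x) \<le> 2 * (real m - 1)" if "x \<in> space \<mu>" for x
  proof (rule node_vector_norm)
    show x: "x \<in> D" using that by (simp add: space_\<mu>)
    show "(\<Sum>j<m-1. (cmod (low_fun j x))\<^sup>2) \<le> 2 * (real m - 1) * \<rho> x"
      unfolding low_sum by (rule low_part_le[OF x])
  qed (use m_ge in simp)
  show "(\<integral>x. node_vector low_fun x i * cnj (node_vector low_fun x j) \<partial>\<mu>) = (if i = j then of_real 1 else 0)"
    if "i < m - 1" "j < m - 1" for i j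
  proof -
    have "(\<integral>x. node_vector low_fun x i * cnj (node_vector low_fun x j) \<partial>\<mu>) = L2_inner M (low_fun j) (low_fun i)"
      using low_zero that by (intro node_vector_covariance low_fun_mem) auto
    then show ?thesis using l2_eta[of "Suc j" "Suc i"] by (auto simp: low_fun_def)
  qed
  show "0 < 2 * (real m - 1)" using m_ge by simp
qed

lemma high_vectors:
  "independent_vectors \<mu> (node_vector high_fun) N (2 * tail_trace) (\<lambda>j. lam (m + j))"
proof (intro independent_vectors.intro independent_vectors_axioms.intro prob_space_\<mu>)
  show "(\<lambda>x. node_vector high_fun x j) \<in> borel_measurable \<mu>" if "j < N" for j
    using node_vector_measurable[of high_fun j, OF high_fun_mem] by (simp add: measurable_cong_sets[OF sets_\<mu> refl])
  show "vec_norm_sq N (node_vector high_fun x) \<le> 2 * tail_trace" if "x \<in> space \<mu>" for x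
  proof (rule node_vector_norm)
    show x: "x \<in> D" using that by (simp add: space_\<mu>)
    show "(\<Sum>j<N. (cmod (high_fun j x))\<^sup>2) \<le> 2 * tail_trace * \<rho> x"
      using high_part_ge[OF x, of N] high_part_le[OF x] by (simp add: high_fun_def)
  qed (use tail_trace_pos in simp)
  show "(\<integral>x. node_vector high_fun x i * cnj (node_vector high_fun x j) \<partial>\<mu>) = (if i = j then of_real (lam (m + i)) else 0)"
    if "i < N" "j < N" for i j
  proof -
    have "(\<integral>x. node_vector high_fun x i * cnj (node_vector high_fun x j) \<partial>\<mu>) = L2_inner M (high_fun j) (high_fun i)"
      using high_zero by (intro node_vector_covariance high_fun_mem) auto
    then show ?thesis using l2_e[of "m + j" "m + i"] m_ge by (auto simp: high_fun_def)
  qed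
  show "0 < 2 * tail_trace" using tail_trace_pos by simp
qed

end

section \<open>Frame bounds for random nodes\<close>

context sampling_setup
begin

abbreviation nodes :: "nat \<Rightarrow> (nat \<Rightarrow> 'a) measure" where "nodes n \<equiv> Pi\<^sub>M {..<n} (\<lambda>_. \<mu>)"

lemma prob_space_nodes: "prob_space (nodes n)"
  by (intro prob_space_PiM prob_space_\<mu>)

definition weighted :: "('a \<Rightarrow> complex) \<Rightarrow> 'a \<Rightarrow> complex" where
  "weighted f x = (if \<rho> x \<noteq> 0 then f x / of_real (sqrt (\<rho> x)) else 0)"

lemma cnj_node_vector: "cnj (node_vector g x j) = weighted (g j) x"
  by (simp add: node_vector_def weighted_def)

definition truncate :: "nat \<Rightarrow> (nat \<Rightarrow> complex) \<Rightarrow> nat \<Rightarrow> complex" where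
  "truncate d c j = (if j < d then c j else 0)"

lemma supp_below_truncate: "d \<le> N \<Longrightarrow> supp_below N (truncate d c)"
  by (auto simp: supp_below_def truncate_def)

lemma vec_norm_sq_truncate: "d \<le> N \<Longrightarrow> vec_norm_sq N (truncate d c) = (\<Sum>j<d. (cmod (c j))\<^sup>2)"
proof -
  assume "d \<le> N"
  then have "vec_norm_sq N (truncate d c) = (\<Sum>j<d. (cmod (truncate d c j))\<^sup>2)"
    unfolding vec_norm_sq_def by (intro sum.mono_neutral_right) (auto simp: truncate_def)
  then show ?thesis by (simp add: truncate_def)
qed

lemma sum_mult_truncate: "d \<le> N \<Longrightarrow> (\<Sum>j<N. g j * truncate d c j) = (\<Sum>j<d. g j * c j)"
proof -
  assume "d \<le> N"
  then have "(\<Sum>j<N. g j * truncate d c j) = (\<Sum>j<d. g j * truncate d c j)"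
    by (intro sum.mono_neutral_right) (auto simp: truncate_def)
  also have "\<dots> = (\<Sum>j<d. g j * c j)" by (rule sum.cong) (auto simp: truncate_def)
  finally show ?thesis .
qed

lemma low_frame_event:
  assumes p: "1 \<le> p" "40 * real p * (real m - 1) \<le> real n"
  shows "\<exists>E\<in>sets (nodes n). measure (nodes n) E \<le> real (m - 1) * exp (- real p) \<and>
    (\<forall>X\<in>space (nodes n) - E. \<forall>c. real n / 4 * (\<Sum>j<m-1. (cmod (c j))\<^sup>2)
       \<le> (\<Sum>i<n. (cmod (\<Sum>j<m-1. weighted (low_fun j) (X i) * c j))\<^sup>2))"
proof -
  interpret V: independent_vectors \<mu> "node_vector low_fun" "m - 1" "2 * (real m - 1)" "\<lambda>_. 1"
    by (rule low_vectors)
  have "\<exists>E\<in>sets (nodes n). measure (nodes n) E \<le> real (m - 1) * exp (- real p) \<and>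
    (\<forall>X\<in>space (nodes n) - E. \<forall>v. supp_below (m - 1) v \<longrightarrow> real n / 4 * vec_norm_sq (m - 1) v
       \<le> (\<Sum>i<n. (cmod (\<Sum>j<m-1. cnj (node_vector low_fun (X i) j) * v j))\<^sup>2))"
    using m_ge p by (intro V.sample_gram_lower_bound) (auto simp: mult_ac)
  then obtain E where E: "E \<in> sets (nodes n)" "measure (nodes n) E \<le> real (m - 1) * exp (- real p)"
    and bound: "\<forall>X\<in>space (nodes n) - E. \<forall>v. supp_below (m - 1) v \<longrightarrow> real n / 4 * vec_norm_sq (m - 1) v
       \<le> (\<Sum>i<n. (cmod (\<Sum>j<m-1. cnj (node_vector low_fun (X i) j) * v j))\<^sup>2)"
    by (elim bexE conjE)
  show ?thesis
  proof (intro bexI[OF _ E(1)] conjI E(2) ballI allI)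
    fix X c assume X: "X \<in> space (nodes n) - E"
    show "real n / 4 * (\<Sum>j<m-1. (cmod (c j))\<^sup>2)
       \<le> (\<Sum>i<n. (cmod (\<Sum>j<m-1. weighted (low_fun j) (X i) * c j))\<^sup>2)"
      using bound[THEN bspec, OF X, THEN spec, THEN mp, OF supp_below_truncate[OF order_refl, of "m - 1" c]]
      by (simp only: vec_norm_sq_truncate[OF order_refl] sum_mult_truncate[OF order_refl] cnj_node_vector)
  qed
qed

text \<open>For finitely many functions this is the upper bound for sample Gram matrices, with an exceptional set
  \<open>E N\<close> whose measure is at most \<open>\<delta>\<close> for every number \<open>N\<close> of functions. The bound for \<open>N\<close> functions
  implies the one for fewer, so it suffices that infinitely many \<open>N\<close> are good. The points for which this
  fails form the increasing union of the sets \<open>F k\<close>, the intersections of the \<open>E N\<close> with \<open>N \<ge> k\<close>, whose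
  measures are at most \<open>\<delta>\<close>.\<close>
lemma high_frame_event:
  assumes p: "1 \<le> p" "real n \<le> exp (real p)" and \<delta>: "0 < \<delta>" "\<delta> < 1 / 3"
  shows "\<exists>E\<in>sets (nodes n). measure (nodes n) E \<le> \<delta> \<and>
    (\<forall>X\<in>space (nodes n) - E. \<forall>N c. (\<Sum>i<n. (cmod (\<Sum>j<N. weighted (high_fun j) (X i) * c j))\<^sup>2)
       \<le> (real n * lam m + 4 * real p * tail_trace) / \<delta> * (\<Sum>j<N. (cmod (c j))\<^sup>2))"
proof -
  let ?u = "(real n * lam m + 4 * real p * tail_trace) / \<delta>"
  interpret Q: prob_space "nodes n" by (rule prob_space_nodes)
  have "\<exists>E\<in>sets (nodes n). measure (nodes n) E \<le> \<delta> \<and>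
    (\<forall>X\<in>space (nodes n) - E. \<forall>v. supp_below N v \<longrightarrow>
      (\<Sum>i<n. (cmod (\<Sum>j<N. cnj (node_vector high_fun (X i) j) * v j))\<^sup>2) \<le> ?u * vec_norm_sq N v)" for N
  proof -
    interpret V: independent_vectors \<mu> "node_vector high_fun" N "2 * tail_trace" "\<lambda>j. lam (m + j)"
      by (rule high_vectors)
    have lam: "0 \<le> lam (m + a) \<and> lam (m + a) \<le> lam m" for a
      using lam_pos[of "m + a"] lam_antimono[of m "m + a"] m_ge by simp
    have trace: "(\<Sum>a<N. lam (m + a)) \<le> tail_trace"
      unfolding tail_trace_def using lam by (intro sum_le_suminf tail_summable) auto
    have "\<exists>E\<in>sets (nodes n). measure (nodes n) E \<le> \<delta> \<and>
      (\<forall>X\<in>space (nodes n) - E. \<forall>v. supp_below N v \<longrightarrow>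
        (\<Sum>i<n. (cmod (\<Sum>j<N. cnj (node_vector high_fun (X i) j) * v j))\<^sup>2)
          \<le> (real n * lam m + 2 * real p * (2 * tail_trace)) / \<delta> * vec_norm_sq N v)"
      using lam lam_pos[of m] m_ge tail_trace_pos p \<delta>
      by (intro V.sample_gram_upper_bound[where T=tail_trace and \<kappa>="lam m"] trace) auto
    then show ?thesis by (simp add: mult.assoc)
  qed
  then have "\<forall>N. \<exists>E. E \<in> sets (nodes n) \<and> measure (nodes n) E \<le> \<delta> \<and>
    (\<forall>X\<in>space (nodes n) - E. \<forall>v. supp_below N v \<longrightarrow>
      (\<Sum>i<n. (cmod (\<Sum>j<N. cnj (node_vector high_fun (X i) j) * v j))\<^sup>2) \<le> ?u * vec_norm_sq N v)"
    by (simp add: Bex_def)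
  from choice[OF this] obtain E where EE: "\<forall>N. E N \<in> sets (nodes n) \<and> measure (nodes n) (E N) \<le> \<delta> \<and>
    (\<forall>X\<in>space (nodes n) - E N. \<forall>v. supp_below N v \<longrightarrow>
      (\<Sum>i<n. (cmod (\<Sum>j<N. cnj (node_vector high_fun (X i) j) * v j))\<^sup>2) \<le> ?u * vec_norm_sq N v)" ..
  then have Es: "E N \<in> sets (nodes n)" and Em: "measure (nodes n) (E N) \<le> \<delta>" for N by simp_all
  define F where "F k = (\<Inter>N\<in>{k..}. E N)" for k
  have Fs: "F k \<in> sets (nodes n)" for k unfolding F_def by (intro sets.countable_INT') (use Es in auto)
  have inc: "incseq F" unfolding F_def by (intro monoI INF_superset_mono) auto
  have "(\<lambda>k. measure (nodes n) (F k)) \<longlonglongrightarrow> measure (nodes n) (\<Union>k. F k)"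
    using Fs inc by (intro Q.finite_Lim_measure_incseq) auto
  moreover have "measure (nodes n) (F k) \<le> \<delta>" for k
  proof -
    have "measure (nodes n) (F k) \<le> measure (nodes n) (E k)"
      by (intro Q.finite_measure_mono Es) (auto simp: F_def)
    then show ?thesis using Em[of k] by simp
  qed
  ultimately have small: "measure (nodes n) (\<Union>k. F k) \<le> \<delta>" by (intro LIMSEQ_le_const2) auto
  show ?thesis
  proof (rule bexI[where x="\<Union>k. F k"], intro conjI small ballI allI)
    fix X N c assume X: "X \<in> space (nodes n) - (\<Union>k. F k)"
    then obtain N' where N': "N \<le> N'" "X \<notin> E N'" unfolding F_def by auto
    have "X \<in> space (nodes n) - E N'" using X N'(2) by simp
    from EE[THEN spec, of N', THEN conjunct2, THEN conjunct2, THEN bspec, OF this, THEN spec, THEN mp,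
        OF supp_below_truncate[OF N'(1), of c]]
    show "(\<Sum>i<n. (cmod (\<Sum>j<N. weighted (high_fun j) (X i) * c j))\<^sup>2) \<le> ?u * (\<Sum>j<N. (cmod (c j))\<^sup>2)"
      by (simp only: vec_norm_sq_truncate[OF N'(1)] sum_mult_truncate[OF N'(1)] cnj_node_vector)
  qed (use Fs in auto)
qed

lemma AE_nodes_vanishing: "AE X in nodes n. \<forall>i\<in>{..<n}. vanishing_point (X i)"
proof (rule AE_finite_allI)
  have "AE x in \<mu>. vanishing_point x"
    unfolding sampling_measure_def using AE_vanishing_point density_measurable
    by (subst AE_density) (auto elim: AE_mp)
  then show "AE X in nodes n. vanishing_point (X i)" if "i \<in> {..<n}" for i
    using that by (intro AE_PiM_component prob_space_\<mu>)
qed simp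

lemma partial_shift: "partial f (N + (m - 1)) x - partial f (m - 1) x = (\<Sum>j<N. ecoeff f (m + j) * high_fun j x)"
proof -
  have "partial f (N + (m - 1)) x - partial f (m - 1) x = (\<Sum>k\<in>{Suc (m - 1)..N + (m - 1)}. ecoeff f k * e k x)"
    using fun_cong[OF partial_split[of "m - 1" "N + (m - 1)" f], of x] by (simp add: lincomb_apply)
  also have "\<dots> = (\<Sum>j<N. ecoeff f (m + j) * high_fun j x)"
    unfolding high_fun_def using m_ge
    by (intro sum.reindex_bij_witness[where i="\<lambda>j. m + j" and j="\<lambda>k. k - m"]) auto
  finally show ?thesis .
qed

text \<open>At almost all nodes \<open>f - partial f (m - 1)\<close> is the limit of its truncated expansions, whose squared
  coefficients sum up to at most \<open>|f|\<^sup>2\<close>.\<close>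
theorem residual_event:
  assumes p: "1 \<le> p" "real n \<le> exp (real p)" and \<delta>: "0 < \<delta>" "\<delta> < 1 / 3"
  shows "\<exists>E\<in>sets (nodes n). measure (nodes n) E \<le> \<delta> \<and>
    (\<forall>X\<in>space (nodes n) - E. \<forall>f\<in>H. (\<Sum>i<n. (cmod (weighted (f - partial f (m - 1)) (X i)))\<^sup>2)
       \<le> (real n * lam m + 4 * real p * tail_trace) / \<delta> * ip.norm_sq f)"
proof -
  let ?u = "(real n * lam m + 4 * real p * tail_trace) / \<delta>"
  interpret Q: prob_space "nodes n" by (rule prob_space_nodes)
  from high_frame_event[OF assms] obtain E where E: "E \<in> sets (nodes n)" "measure (nodes n) E \<le> \<delta>"
    and bound: "\<forall>X\<in>space (nodes n) - E. \<forall>N c. (\<Sum>i<n. (cmod (\<Sum>j<N. weighted (high_fun j) (X i) * c j))\<^sup>2)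
       \<le> ?u * (\<Sum>j<N. (cmod (c j))\<^sup>2)" by (elim bexE conjE)
  from AE_nodes_vanishing[of n] obtain Z where Z: "{X \<in> space (nodes n). \<not> (\<forall>i\<in>{..<n}. vanishing_point (X i))} \<subseteq> Z"
    "emeasure (nodes n) Z = 0" "Z \<in> sets (nodes n)" by (rule AE_E)
  have u0: "0 \<le> ?u" using lam_pos[of m] m_ge tail_trace_pos \<delta> by simp
  show ?thesis
  proof (rule bexI[where x="E \<union> Z"], intro conjI ballI)
    have "measure (nodes n) (E \<union> Z) \<le> measure (nodes n) E + measure (nodes n) Z"
      by (rule measure_Un_le[OF E(1) Z(3)])
    also have "measure (nodes n) Z = 0" using Z(2) by (simp add: measure_def)
    finally show "measure (nodes n) (E \<union> Z) \<le> \<delta>" using E(2) by simp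
    show "E \<union> Z \<in> sets (nodes n)" using E(1) Z(3) by simp
    fix X f assume X: "X \<in> space (nodes n) - (E \<union> Z)" and f: "f \<in> H"
    have van: "vanishing_point (X i)" if "i < n" for i using X Z(1) that by auto
    show "(\<Sum>i<n. (cmod (weighted (f - partial f (m - 1)) (X i)))\<^sup>2) \<le> ?u * ip.norm_sq f"
    proof (rule LIMSEQ_le_const2)
      show "\<exists>N0. \<forall>N\<ge>N0. (\<Sum>i<n. (cmod (\<Sum>j<N. weighted (high_fun j) (X i) * ecoeff f (m + j)))\<^sup>2) \<le> ?u * ip.norm_sq f"
      proof (intro exI allI impI)
        fix N :: nat
        have "(\<Sum>j<N. (cmod (ecoeff f (m + j)))\<^sup>2) = (\<Sum>k\<in>{m..<m+N}. (cmod (ecoeff f k))\<^sup>2)"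
          by (rule sum.reindex_bij_witness[where i="\<lambda>k. k - m" and j="\<lambda>j. m + j"]) auto
        also have "\<dots> \<le> ip.norm_sq f" using m_ge by (intro Bessel f) auto
        finally have le: "?u * (\<Sum>j<N. (cmod (ecoeff f (m + j)))\<^sup>2) \<le> ?u * ip.norm_sq f"
          using u0 by (rule mult_left_mono)
        have "X \<in> space (nodes n) - E" using X by simp
        from order_trans[OF bound[THEN bspec, OF this, THEN spec, of N, THEN spec, of "\<lambda>j. ecoeff f (m + j)"] le]
        show "(\<Sum>i<n. (cmod (\<Sum>j<N. weighted (high_fun j) (X i) * ecoeff f (m + j)))\<^sup>2) \<le> ?u * ip.norm_sq f" .
      qed
      have "(\<lambda>N. \<Sum>j<N. weighted (high_fun j) (X i) * ecoeff f (m + j)) \<longlonglongrightarrow> weighted (f - partial f (m - 1)) (X i)"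
        if i: "i < n" for i
      proof (cases "\<rho> (X i) = 0")
        case True
        then show ?thesis by (simp add: weighted_def)
      next
        case False
        have "(\<lambda>N. partial f (N + (m - 1)) (X i) - partial f (m - 1) (X i)) \<longlonglongrightarrow> f (X i) - partial f (m - 1) (X i)"
          by (intro tendsto_diff tendsto_const LIMSEQ_ignore_initial_segment partial_tendsto f van i)
        then have sum_lim: "(\<lambda>N. \<Sum>j<N. ecoeff f (m + j) * high_fun j (X i)) \<longlonglongrightarrow> f (X i) - partial f (m - 1) (X i)"
          by (simp only: partial_shift)
        have "(\<lambda>N. (\<Sum>j<N. ecoeff f (m + j) * high_fun j (X i)) / of_real (sqrt (\<rho> (X i))))
            \<longlonglongrightarrow> (f (X i) - partial f (m - 1) (X i)) / of_real (sqrt (\<rho> (X i)))"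
        proof (intro tendsto_divide tendsto_const sum_lim)
          show "complex_of_real (sqrt (\<rho> (X i))) \<noteq> 0" using False by simp
        qed
        moreover have "(\<Sum>j<N. weighted (high_fun j) (X i) * ecoeff f (m + j))
            = (\<Sum>j<N. ecoeff f (m + j) * high_fun j (X i)) / of_real (sqrt (\<rho> (X i)))" for N
          using False by (simp add: weighted_def sum_divide_distrib mult.commute)
        ultimately show ?thesis using False by (simp add: weighted_def)
      qed
      then show "(\<lambda>N. \<Sum>i<n. (cmod (\<Sum>j<N. weighted (high_fun j) (X i) * ecoeff f (m + j)))\<^sup>2)
          \<longlonglongrightarrow> (\<Sum>i<n. (cmod (weighted (f - partial f (m - 1)) (X i)))\<^sup>2)"
        by (intro tendsto_sum tendsto_power tendsto_norm) auto
    qed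
  qed
qed

end

section \<open>Least squares\<close>

lemma mult_mat_vec_entry:
  assumes "A \<in> carrier_mat n d" "v \<in> carrier_vec d" "i < n"
  shows "vec_index (A *\<^sub>v v) i = (\<Sum>j<d. A $$ (i, j) * vec_index v j)"
  using assms by (auto simp: scalar_prod_def atLeast0LessThan intro!: sum.cong)

lemma mult_mat_entry:
  assumes "A \<in> carrier_mat n d" "B \<in> carrier_mat d k" "i < n" "j < k"
  shows "(A * B) $$ (i, j) = (\<Sum>l<d. A $$ (i, l) * B $$ (l, j))"
  using assms by (auto simp: scalar_prod_def atLeast0LessThan intro!: sum.cong)

lemma mat_adjoint_carrier: "A \<in> carrier_mat n d \<Longrightarrow> mat_adjoint A \<in> carrier_mat d n"
  by (auto simp: mat_adjoint_def mat_of_rows_def)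

lemma mat_adjoint_entry:
  fixes A :: "complex Matrix.mat"
  assumes "A \<in> carrier_mat n d" "i < d" "j < n"
  shows "mat_adjoint A $$ (i, j) = cnj (A $$ (j, i))"
  using assms by (simp add: mat_adjoint_def mat_of_rows_index)

context
  fixes A :: "complex Matrix.mat" and n d :: nat
  assumes A: "A \<in> carrier_mat n d"
begin

abbreviation gram :: "complex Matrix.mat" where "gram \<equiv> mat_adjoint A * A"

lemma gram_carrier: "gram \<in> carrier_mat d d"
  using mat_adjoint_carrier[OF A] A by (rule mult_carrier_mat)

lemma gram_entry: "i < d \<Longrightarrow> j < d \<Longrightarrow> gram $$ (i, j) = (\<Sum>k<n. cnj (A $$ (k, i)) * A $$ (k, j))"
  using mult_mat_entry[OF mat_adjoint_carrier[OF A] A, of i j] mat_adjoint_entry[OF A, of i] by simp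

text \<open>\<open>\<langle>A\<^sup>* A v, v\<rangle> = |A v|\<^sup>2\<close>.\<close>
lemma gram_kernel:
  assumes v: "v \<in> carrier_vec d" and z: "gram *\<^sub>v v = 0\<^sub>v d"
  shows "A *\<^sub>v v = 0\<^sub>v n"
proof -
  define w where "w k = (\<Sum>j<d. A $$ (k, j) * vec_index v j)" for k
  have "(\<Sum>k<n. cnj (w k) * w k) = (\<Sum>k<n. \<Sum>i<d. cnj (A $$ (k, i)) * cnj (vec_index v i) * w k)"
    unfolding w_def by (simp add: sum_distrib_right)
  also have "\<dots> = (\<Sum>i<d. \<Sum>k<n. cnj (A $$ (k, i)) * cnj (vec_index v i) * w k)" by (rule sum.swap)
  also have "\<dots> = (\<Sum>i<d. cnj (vec_index v i) * vec_index (gram *\<^sub>v v) i)"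
  proof (rule sum.cong[OF refl])
    fix i assume "i \<in> {..<d}"
    then have i: "i < d" by simp
    have "vec_index (gram *\<^sub>v v) i = (\<Sum>j<d. \<Sum>k<n. cnj (A $$ (k, i)) * A $$ (k, j) * vec_index v j)"
      unfolding mult_mat_vec_entry[OF gram_carrier v i] using i
      by (intro sum.cong refl) (simp add: gram_entry sum_distrib_right)
    also have "\<dots> = (\<Sum>k<n. \<Sum>j<d. cnj (A $$ (k, i)) * A $$ (k, j) * vec_index v j)" by (rule sum.swap)
    also have "\<dots> = (\<Sum>k<n. cnj (A $$ (k, i)) * w k)"
      unfolding w_def by (simp add: sum_distrib_left mult.assoc)
    finally show "(\<Sum>k<n. cnj (A $$ (k, i)) * cnj (vec_index v i) * w k) = cnj (vec_index v i) * vec_index (gram *\<^sub>v v) i"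
      by (simp add: sum_distrib_left mult_ac)
  qed
  also have "\<dots> = 0" unfolding z by simp
  finally have "(\<Sum>k<n. cnj (w k) * w k) = 0" .
  then have "complex_of_real (\<Sum>k<n. (cmod (w k))\<^sup>2) = 0"
    by (simp only: of_real_sum complex_norm_square mult.commute)
  then have "(\<Sum>k<n. (cmod (w k))\<^sup>2) = 0" by (simp only: of_real_eq_0_iff)
  then have "\<forall>k\<in>{..<n}. (cmod (w k))\<^sup>2 = 0" by (subst (asm) sum_nonneg_eq_0_iff) auto
  then have "w k = 0" if "k < n" for k using that by simp
  then show ?thesis
    using A v mult_mat_vec_entry[OF A v] by (intro eq_vecI) (auto simp: w_def)
qed

lemma injective_iff_det_gram:
  "Determinant.det gram \<noteq> 0 \<longleftrightarrow> (\<forall>v\<in>carrier_vec d. A *\<^sub>v v = 0\<^sub>v n \<longrightarrow> v = 0\<^sub>v d)"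
proof -
  have "gram *\<^sub>v v = 0\<^sub>v d \<longleftrightarrow> A *\<^sub>v v = 0\<^sub>v n" if v: "v \<in> carrier_vec d" for v
  proof
    assume "A *\<^sub>v v = 0\<^sub>v n"
    then have "mat_adjoint A *\<^sub>v (A *\<^sub>v v) = 0\<^sub>v d"
      using mat_adjoint_carrier[OF A] by (intro eq_vecI) (auto simp: scalar_prod_def)
    then show "gram *\<^sub>v v = 0\<^sub>v d"
      using assoc_mult_mat_vec[OF mat_adjoint_carrier[OF A] A v] by simp
  qed (rule gram_kernel[OF v])
  then show ?thesis using det_0_iff_vec_prod_zero_field[OF gram_carrier] by auto
qed

lemma injective_imp_distinct_cols:
  assumes inj: "\<forall>v\<in>carrier_vec d. A *\<^sub>v v = 0\<^sub>v n \<longrightarrow> v = 0\<^sub>v d"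
  shows "distinct (cols A)"
  unfolding distinct_conv_nth
proof (intro allI impI)
  fix i j assume ij: "i < length (cols A)" "j < length (cols A)" "i \<noteq> j"
  then have i: "i < d" and j: "j < d" using A by auto
  show "cols A ! i \<noteq> cols A ! j"
  proof
    assume "cols A ! i = cols A ! j"
    then have eq: "col A i = col A j" using ij by simp
    have "A $$ (k, i) = A $$ (k, j)" if "k < n" for k
      using arg_cong[OF eq, of "\<lambda>c. vec_index c k"] A i j that by simp
    define v :: "complex Matrix.vec" where "v = Matrix.vec d (\<lambda>l. if l = i then 1 else if l = j then - 1 else 0)"
    have v: "v \<in> carrier_vec d" by (simp add: v_def)
    have "vec_index (A *\<^sub>v v) k = 0" if k: "k < n" for k
    proof -
      have "vec_index (A *\<^sub>v v) k = (\<Sum>l<d. (if l = i then A $$ (k, i) else 0) - (if l = j then A $$ (k, j) else 0))"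
        unfolding mult_mat_vec_entry[OF A v k] using ij(3) by (intro sum.cong refl) (auto simp: v_def)
      also have "\<dots> = A $$ (k, i) - A $$ (k, j)" using i j by (simp add: sum_subtractf)
      finally show ?thesis using arg_cong[OF eq, of "\<lambda>c. vec_index c k"] A i j k by simp
    qed
    then have "A *\<^sub>v v = 0\<^sub>v n" using A by (intro eq_vecI) auto
    then have "v = 0\<^sub>v d" using inj v by blast
    then have "vec_index v i = 0" using i by simp
    then show False using i by (simp add: v_def)
  qed
qed

text \<open>Both conditions say that \<open>A\<close> is injective. A column that occurs twice has to be excluded separately,
  because linear independence is a property of the set of columns.\<close>
lemma full_column_rank_iff_det_gram: "full_column_rank A \<longleftrightarrow> Determinant.det gram \<noteq> 0"
proof -
  interpret V: vec_space "TYPE(complex)" n .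
  have fcr: "full_column_rank A \<longleftrightarrow> V.rank A = d" using A by (simp add: full_column_rank_def)
  show ?thesis
  proof
    assume "full_column_rank A"
    then have rank: "V.rank A = d" using fcr by simp
    have dist: "distinct (cols A)"
    proof (rule ccontr)
      assume nd: "\<not> distinct (cols A)"
      obtain S where S: "maximal S (\<lambda>T. T \<subseteq> set (cols A) \<and> V.lin_indpt T)"
        using maximal_exists[of "(\<lambda>T. T \<subseteq> set (cols A) \<and> V.lin_indpt T)" "card (set (cols A))" "{}"]
        by (meson List.finite_set card_mono empty_iff empty_subsetI V.finite_lin_indpt2 rev_finite_subset)
      then have "card S \<le> card (set (cols A))" by (simp add: card_mono maximal_def)
      also have "\<dots> < length (cols A)" using nd card_distinct card_length le_neq_implies_less by blast
      finally show False using V.rank_card_indpt[OF A S] rank A by simp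
    qed
    have "V.lin_indpt (set (cols A))" by (rule V.full_rank_lin_indpt[OF A rank dist])
    then show "Determinant.det gram \<noteq> 0"
      unfolding injective_iff_det_gram using V.lin_depI[OF A _ _ _ dist] by blast
  next
    assume "Determinant.det gram \<noteq> 0"
    then have inj: "\<forall>v\<in>carrier_vec d. A *\<^sub>v v = 0\<^sub>v n \<longrightarrow> v = 0\<^sub>v d" by (simp only: injective_iff_det_gram)
    note dist = injective_imp_distinct_cols[OF inj]
    have "V.lin_indpt (set (cols A))"
    proof
      assume "V.lin_dep (set (cols A))"
      then show False using V.lin_depE[OF A _ dist] inj by metis
    qed
    then show "full_column_rank A" unfolding fcr by (rule V.lin_indpt_full_rank[OF A dist])
  qed
qed

definition ls_solution :: "complex Matrix.vec \<Rightarrow> complex Matrix.vec" where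
  "ls_solution g = (the (mat_inverse gram) * mat_adjoint A) *\<^sub>v g"

text \<open>The adjugate shows that the inverse is a rational function of the entries, from which its
  measurability follows.\<close>
lemma mat_inverse_gram:
  assumes "Determinant.det gram \<noteq> 0"
  shows "the (mat_inverse gram) \<in> carrier_mat d d" "gram * the (mat_inverse gram) = 1\<^sub>m d"
    "the (mat_inverse gram) = (1 / Determinant.det gram) \<cdot>\<^sub>m adj_mat gram"
proof -
  have "mat_inverse gram \<noteq> None"
    using mat_inverse(1)[OF gram_carrier, of "()"] det_non_zero_imp_unit[OF gram_carrier assms, of "()"] by blast
  then obtain B where B: "mat_inverse gram = Some B" by blast
  from mat_inverse(2)[OF gram_carrier B] have inv: "gram * B = 1\<^sub>m d" "B * gram = 1\<^sub>m d" and Bc: "B \<in> carrier_mat d d" by auto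
  show "the (mat_inverse gram) \<in> carrier_mat d d" "gram * the (mat_inverse gram) = 1\<^sub>m d"
    using B inv Bc by auto
  note adj = adj_mat[OF gram_carrier]
  have "B = B * (gram * ((1 / Determinant.det gram) \<cdot>\<^sub>m adj_mat gram))"
  proof -
    have "gram * ((1 / Determinant.det gram) \<cdot>\<^sub>m adj_mat gram) = (1 / Determinant.det gram) \<cdot>\<^sub>m (Determinant.det gram \<cdot>\<^sub>m 1\<^sub>m d)"
      using mult_smult_distrib[OF gram_carrier adj(1)] adj(2) by simp
    also have "\<dots> = 1\<^sub>m d" using assms by (intro eq_matI) auto
    finally show ?thesis using Bc by simp
  qed
  also have "\<dots> = (1 / Determinant.det gram) \<cdot>\<^sub>m adj_mat gram"
    using inv(2) assoc_mult_mat[OF Bc gram_carrier smult_carrier_mat[OF adj(1)], symmetric] adj(1)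
      left_mult_one_mat[OF smult_carrier_mat[OF adj(1)]] by simp
  finally show "the (mat_inverse gram) = (1 / Determinant.det gram) \<cdot>\<^sub>m adj_mat gram" using B by simp
qed

lemma ls_solution_carrier:
  assumes "Determinant.det gram \<noteq> 0" "g \<in> carrier_vec n"
  shows "ls_solution g \<in> carrier_vec d"
  unfolding ls_solution_def using mat_inverse_gram(1)[OF assms(1)] mat_adjoint_carrier[OF A] assms(2)
  by (intro mult_mat_vec_carrier) (auto intro: mult_carrier_mat)

lemma normal_equations:
  assumes det: "Determinant.det gram \<noteq> 0" and g: "g \<in> carrier_vec n" and i: "i < d"
  shows "(\<Sum>k<n. cnj (A $$ (k, i)) * (\<Sum>j<d. A $$ (k, j) * vec_index (ls_solution g) j))
    = (\<Sum>k<n. cnj (A $$ (k, i)) * vec_index g k)"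
proof -
  note inv = mat_inverse_gram[OF det] and adj = mat_adjoint_carrier[OF A]
  note c = ls_solution_carrier[OF det g]
  have "gram *\<^sub>v ls_solution g = gram *\<^sub>v (the (mat_inverse gram) *\<^sub>v (mat_adjoint A *\<^sub>v g))"
    unfolding ls_solution_def using assoc_mult_mat_vec[OF inv(1) adj g] by simp
  also have "\<dots> = (gram * the (mat_inverse gram)) *\<^sub>v (mat_adjoint A *\<^sub>v g)"
    using assoc_mult_mat_vec[OF gram_carrier inv(1) mult_mat_vec_carrier[OF adj g]] by simp
  also have "\<dots> = mat_adjoint A *\<^sub>v g" unfolding inv(2) using mult_mat_vec_carrier[OF adj g] by simp
  finally have eq: "vec_index (gram *\<^sub>v ls_solution g) i = vec_index (mat_adjoint A *\<^sub>v g) i" by simp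
  have "vec_index (gram *\<^sub>v ls_solution g) i = (\<Sum>j<d. \<Sum>k<n. cnj (A $$ (k, i)) * A $$ (k, j) * vec_index (ls_solution g) j)"
    unfolding mult_mat_vec_entry[OF gram_carrier c i] using i
    by (intro sum.cong refl) (simp add: gram_entry sum_distrib_right)
  also have "\<dots> = (\<Sum>k<n. \<Sum>j<d. cnj (A $$ (k, i)) * A $$ (k, j) * vec_index (ls_solution g) j)" by (rule sum.swap)
  also have "\<dots> = (\<Sum>k<n. cnj (A $$ (k, i)) * (\<Sum>j<d. A $$ (k, j) * vec_index (ls_solution g) j))"
    by (simp add: sum_distrib_left mult.assoc)
  finally show ?thesis
    using eq unfolding mult_mat_vec_entry[OF adj g i] by (simp add: mat_adjoint_entry[OF A i])
qed

end

text \<open>By the normal equations \<open>L (c - a)\<close> is the orthogonal projection of \<open>g - L a\<close> to the range of \<open>L\<close>, so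
  its norm is at most that of \<open>g - L a\<close>.\<close>
lemma least_squares_stability:
  fixes L :: "nat \<Rightarrow> nat \<Rightarrow> complex" and c a g :: "nat \<Rightarrow> complex"
  assumes normal: "\<And>i. i < d \<Longrightarrow> (\<Sum>k<n. cnj (L k i) * (\<Sum>j<d. L k j * c j)) = (\<Sum>k<n. cnj (L k i) * g k)"
    and frame: "\<tau> * (\<Sum>j<d. (cmod (c j - a j))\<^sup>2) \<le> (\<Sum>k<n. (cmod (\<Sum>j<d. L k j * (c j - a j)))\<^sup>2)"
  shows "\<tau> * (\<Sum>j<d. (cmod (c j - a j))\<^sup>2) \<le> (\<Sum>k<n. (cmod (g k - (\<Sum>j<d. L k j * a j)))\<^sup>2)"
proof -
  define w b where "w k = (\<Sum>j<d. L k j * (c j - a j))" and "b k = g k - (\<Sum>j<d. L k j * a j)" for k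
  have cw: "cnj (w k) = (\<Sum>i<d. cnj (c i - a i) * cnj (L k i))" for k
    by (simp add: w_def mult.commute)
  have "(\<Sum>k<n. cnj (w k) * (w k - b k)) = (\<Sum>k<n. \<Sum>i<d. cnj (c i - a i) * (cnj (L k i) * (w k - b k)))"
    unfolding cw sum_distrib_right by (simp only: mult.assoc)
  also have "\<dots> = (\<Sum>i<d. \<Sum>k<n. cnj (c i - a i) * (cnj (L k i) * (w k - b k)))" by (rule sum.swap)
  also have "\<dots> = (\<Sum>i<d. cnj (c i - a i) * (\<Sum>k<n. cnj (L k i) * (w k - b k)))"
    by (simp add: sum_distrib_left)
  also have "\<dots> = 0"
  proof (intro sum.neutral ballI)
    fix i assume "i \<in> {..<d}"
    then have "(\<Sum>k<n. cnj (L k i) * ((\<Sum>j<d. L k j * c j) - g k)) = 0"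
      using normal[of i] by (simp add: right_diff_distrib sum_subtractf)
    moreover have "w k - b k = (\<Sum>j<d. L k j * c j) - g k" for k
      by (simp add: w_def b_def right_diff_distrib sum_subtractf)
    ultimately show "cnj (c i - a i) * (\<Sum>k<n. cnj (L k i) * (w k - b k)) = 0" by simp
  qed
  finally have orth: "(\<Sum>k<n. cnj (w k) * (w k - b k)) = 0" .
  have "(cmod (b k))\<^sup>2 = (cmod (w k))\<^sup>2 + (cmod (w k - b k))\<^sup>2 - 2 * Re (cnj (w k) * (w k - b k))" for k
    unfolding cmod_power2 by (simp add: power2_eq_square algebra_simps)
  then have "(\<Sum>k<n. (cmod (b k))\<^sup>2) = (\<Sum>k<n. (cmod (w k))\<^sup>2) + (\<Sum>k<n. (cmod (w k - b k))\<^sup>2)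
      - 2 * Re (\<Sum>k<n. cnj (w k) * (w k - b k))"
    by (simp add: sum.distrib sum_subtractf sum_distrib_left)
  then have "(\<Sum>k<n. (cmod (w k))\<^sup>2) \<le> (\<Sum>k<n. (cmod (b k))\<^sup>2)"
    unfolding orth by (simp add: sum_nonneg)
  then show ?thesis using frame unfolding w_def b_def by (rule order_trans[rotated])
qed

lemma borel_measurable_det:
  fixes A :: "'b \<Rightarrow> complex Matrix.mat"
  assumes "\<And>\<omega>. A \<omega> \<in> carrier_mat d d"
    and "\<And>i j. i < d \<Longrightarrow> j < d \<Longrightarrow> (\<lambda>\<omega>. A \<omega> $$ (i, j)) \<in> borel_measurable P"
  shows "(\<lambda>\<omega>. Determinant.det (A \<omega>)) \<in> borel_measurable P"
  unfolding det_def'[OF assms(1)]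
proof (intro borel_measurable_sum borel_measurable_times borel_measurable_const borel_measurable_prod assms(2))
  fix p i assume "p \<in> {p. p permutes {0..<d}}" "i \<in> {0..<d}"
  then show "i < d" "p i < d" using permutes_in_image[of p "{0..<d}" i] by auto
qed

lemma borel_measurable_adj_mat:
  fixes A :: "'b \<Rightarrow> complex Matrix.mat"
  assumes A: "\<And>\<omega>. A \<omega> \<in> carrier_mat d d"
    and meas: "\<And>i j. i < d \<Longrightarrow> j < d \<Longrightarrow> (\<lambda>\<omega>. A \<omega> $$ (i, j)) \<in> borel_measurable P"
    and ij: "i < d" "j < d"
  shows "(\<lambda>\<omega>. adj_mat (A \<omega>) $$ (i, j)) \<in> borel_measurable P"
proof -
  have dims: "dim_row (A \<omega>) = d" "dim_col (A \<omega>) = d" for \<omega> using A[of \<omega>] by auto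
  have eq: "adj_mat (A \<omega>) $$ (i, j) = (- 1) ^ (j + i) * Determinant.det (mat_delete (A \<omega>) j i)" for \<omega>
    using ij by (simp add: adj_mat_def dims cofactor_def)
  have "(\<lambda>\<omega>. Determinant.det (mat_delete (A \<omega>) j i)) \<in> borel_measurable P"
  proof (rule borel_measurable_det)
    show "mat_delete (A \<omega>) j i \<in> carrier_mat (d - 1) (d - 1)" for \<omega>
      by (rule mat_delete_carrier[OF A])
    show "(\<lambda>\<omega>. mat_delete (A \<omega>) j i $$ (a, b)) \<in> borel_measurable P" if ab: "a < d - 1" "b < d - 1" for a b
    proof -
      have "mat_delete (A \<omega>) j i $$ (a, b) = A \<omega> $$ (if a < j then a else Suc a, if b < i then b else Suc b)" for \<omega>
        using ab dims by (simp add: mat_delete_def)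
      then show ?thesis using ab by (simp only:) (intro meas; auto)
    qed
  qed
  then show ?thesis unfolding eq by (intro borel_measurable_times borel_measurable_const)
qed

section \<open>The reconstruction error\<close>

context sampling_setup
begin

abbreviation design :: "nat \<Rightarrow> (nat \<Rightarrow> 'a) \<Rightarrow> complex Matrix.mat" where
  "design n X \<equiv> wls_matrix \<rho> (eta lam e) n m X"
abbreviation reconstruct :: "nat \<Rightarrow> (nat \<Rightarrow> 'a) \<Rightarrow> ('a \<Rightarrow> complex) \<Rightarrow> 'a \<Rightarrow> complex" where
  "reconstruct n X f \<equiv> wls_operator \<rho> (eta lam e) n m X f"

lemma design_carrier: "design n X \<in> carrier_mat n (m - 1)" by (simp add: wls_matrix_def)
lemma design_entry: "k < n \<Longrightarrow> j < m - 1 \<Longrightarrow> design n X $$ (k, j) = weighted (low_fun j) (X k)"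
  by (simp add: wls_matrix_def weighted_def low_fun_def)
lemma data_carrier: "wls_data \<rho> n X f \<in> carrier_vec n" by (simp add: wls_data_def)
lemma data_entry: "k < n \<Longrightarrow> vec_index (wls_data \<rho> n X f) k = weighted f (X k)"
  by (simp add: wls_data_def weighted_def)
lemma coeffs_eq: "wls_coeffs \<rho> (eta lam e) n m X f = ls_solution (design n X) (wls_data \<rho> n X f)"
  by (simp add: wls_coeffs_def ls_solution_def[OF design_carrier] Let_def)

definition coefficient :: "nat \<Rightarrow> (nat \<Rightarrow> 'a) \<Rightarrow> ('a \<Rightarrow> complex) \<Rightarrow> nat \<Rightarrow> complex" where
  "coefficient n X f j = vec_index (wls_coeffs \<rho> (eta lam e) n m X f) j"

definition low_comb :: "(nat \<Rightarrow> complex) \<Rightarrow> 'a \<Rightarrow> complex" where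
  "low_comb c = lincomb {1..m-1} (\<lambda>k. c (k - 1) * of_real (1 / sqrt (lam k)))"

lemma low_comb_apply: "low_comb c x = (\<Sum>j<m-1. c j * low_fun j x)"
  unfolding low_comb_def lincomb_apply low_fun_def
  by (rule sum.reindex_bij_witness[where i=Suc and j="\<lambda>k. k - 1"]) (auto simp: eta_def fscale_apply)

lemma low_comb_mem: "low_comb c \<in> H" unfolding low_comb_def by (rule lincomb_mem) auto

lemma l2_norm_sq_low_comb: "l2.norm_sq (low_comb c) = (\<Sum>j<m-1. (cmod (c j))\<^sup>2)"
proof -
  have "l2.norm_sq (low_comb c) = (\<Sum>k=1..m-1. (cmod (c (k - 1) * of_real (1 / sqrt (lam k))))\<^sup>2 * lam k)"
    unfolding low_comb_def by (rule l2_norm_sq_lincomb) auto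
  also have "\<dots> = (\<Sum>k=1..m-1. (cmod (c (k - 1)))\<^sup>2)"
  proof (rule sum.cong[OF refl])
    fix k assume "k \<in> {1..m-1}"
    then have "0 < lam k" by (intro lam_pos) simp
    then show "(cmod (c (k - 1) * of_real (1 / sqrt (lam k))))\<^sup>2 * lam k = (cmod (c (k - 1)))\<^sup>2"
      by (simp add: norm_mult norm_divide power_mult_distrib power_divide)
  qed
  also have "\<dots> = (\<Sum>j<m-1. (cmod (c j))\<^sup>2)"
    by (rule sum.reindex_bij_witness[where i=Suc and j="\<lambda>k. k - 1"]) auto
  finally show ?thesis .
qed

lemma reconstruct_eq: "reconstruct n X f = low_comb (coefficient n X f)"
  by (rule ext) (simp add: wls_operator_def low_comb_apply coefficient_def low_fun_def)

lemma partial_eq_low_comb: "partial f (m - 1) = low_comb (\<lambda>j. ecoeff f (Suc j) * of_real (sqrt (lam (Suc j))))"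
proof -
  have "lincomb {1..m-1} (ecoeff f)
      = lincomb {1..m-1} (\<lambda>k. (ecoeff f (Suc (k - 1)) * of_real (sqrt (lam (Suc (k - 1))))) * of_real (1 / sqrt (lam k)))"
    unfolding lincomb_def
  proof (rule sum.cong[OF refl])
    fix k assume k: "k \<in> {1..m-1}"
    then have "0 < lam k" by (intro lam_pos) simp
    then have "complex_of_real (sqrt (lam k)) * of_real (1 / sqrt (lam k)) = 1" by (simp flip: of_real_mult)
    moreover have "Suc (k - 1) = k" using k by simp
    ultimately show "fscale (ecoeff f k) (e k)
        = fscale ((ecoeff f (Suc (k - 1)) * of_real (sqrt (lam (Suc (k - 1))))) * of_real (1 / sqrt (lam k))) (e k)"
      by (simp only: mult.assoc mult_1_right)
  qed
  then show ?thesis by (simp only: partial_def low_comb_def)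
qed

lemma low_comb_diff: "low_comb c - low_comb a = low_comb (\<lambda>j. c j - a j)"
  by (rule ext) (simp add: low_comb_apply left_diff_distrib sum_subtractf)

lemma weighted_diff: "weighted (f - g) x = weighted f x - weighted g x"
  by (simp add: weighted_def diff_divide_distrib)

lemma weighted_low_comb: "weighted (low_comb c) x = (\<Sum>j<m-1. weighted (low_fun j) x * c j)"
  by (simp add: weighted_def low_comb_apply sum_divide_distrib mult.commute)

lemma frame_imp_full_rank:
  assumes n: "0 < n"
    and frame: "\<And>c. real n / 4 * (\<Sum>j<m-1. (cmod (c j))\<^sup>2) \<le> (\<Sum>i<n. (cmod (\<Sum>j<m-1. weighted (low_fun j) (X i) * c j))\<^sup>2)"
  shows "Determinant.det (mat_adjoint (design n X) * design n X) \<noteq> 0"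
  unfolding injective_iff_det_gram[OF design_carrier]
proof (intro ballI impI)
  fix v assume v: "v \<in> carrier_vec (m - 1)" and z: "design n X *\<^sub>v v = 0\<^sub>v n"
  have "(\<Sum>j<m-1. weighted (low_fun j) (X i) * vec_index v j) = 0" if "i < n" for i
    using mult_mat_vec_entry[OF design_carrier v that, of X] z that by (simp add: design_entry)
  then have "real n / 4 * (\<Sum>j<m-1. (cmod (vec_index v j))\<^sup>2) \<le> 0"
    using frame[of "vec_index v"] by simp
  then have "(\<Sum>j<m-1. (cmod (vec_index v j))\<^sup>2) \<le> 0" using n by (simp add: mult_le_0_iff)
  then have "(\<Sum>j<m-1. (cmod (vec_index v j))\<^sup>2) = 0" by (intro order_antisym sum_nonneg) auto
  then have "\<forall>j\<in>{..<m-1}. (cmod (vec_index v j))\<^sup>2 = 0" by (subst (asm) sum_nonneg_eq_0_iff) auto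
  then show "v = 0\<^sub>v (m - 1)" using v by (intro eq_vecI) auto
qed

lemma norm_sq_diff_le:
  "f \<in> H \<Longrightarrow> g \<in> H \<Longrightarrow> l2.norm_sq (f - g) \<le> 2 * l2.norm_sq f + 2 * l2.norm_sq g"
  using l2.norm_sq_nonneg[OF l2.mem_add, of f g] by (simp add: l2.norm_sq_add l2.norm_sq_diff)

text \<open>The first term bounds the part of \<open>f\<close> that the eigenfunctions before \<open>e m\<close> miss. The second one comes
  from the coefficients: the least squares solution differs from the exact coefficients of
  \<open>partial f (m - 1)\<close> only because the data contain the residual, and the frame bound \<open>n/4\<close> turns the size
  of the residual in the data into \<open>4 u / n\<close> for the coefficients.\<close>
theorem reconstruction_error_le:
  assumes n: "0 < n" and f: "f \<in> H"
    and frame: "\<And>c. real n / 4 * (\<Sum>j<m-1. (cmod (c j))\<^sup>2) \<le> (\<Sum>i<n. (cmod (\<Sum>j<m-1. weighted (low_fun j) (X i) * c j))\<^sup>2)"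
    and residual: "(\<Sum>i<n. (cmod (weighted (f - partial f (m - 1)) (X i)))\<^sup>2) \<le> u"
  shows "l2.norm_sq (f - reconstruct n X f) \<le> 2 * (lam m * ip.norm_sq f) + 8 / real n * u"
proof -
  define c where "c = coefficient n X f"
  define a where "a j = ecoeff f (Suc j) * of_real (sqrt (lam (Suc j)))" for j
  have pa: "partial f (m - 1) = low_comb a" unfolding a_def[abs_def] by (rule partial_eq_low_comb)
  note det = frame_imp_full_rank[OF n frame]
  have "real n / 4 * (\<Sum>j<m-1. (cmod (c j - a j))\<^sup>2)
      \<le> (\<Sum>k<n. (cmod (weighted f (X k) - (\<Sum>j<m-1. weighted (low_fun j) (X k) * a j)))\<^sup>2)"
  proof (rule least_squares_stability)
    fix i assume i: "i < m - 1"
    show "(\<Sum>k<n. cnj (weighted (low_fun i) (X k)) * (\<Sum>j<m-1. weighted (low_fun j) (X k) * c j))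
        = (\<Sum>k<n. cnj (weighted (low_fun i) (X k)) * weighted f (X k))"
      using normal_equations[OF design_carrier det data_carrier[of n X f] i] i
      by (simp add: design_entry data_entry c_def coefficient_def coeffs_eq)
  qed (rule frame)
  also have "\<dots> = (\<Sum>k<n. (cmod (weighted (f - partial f (m - 1)) (X k)))\<^sup>2)"
    unfolding pa weighted_diff weighted_low_comb ..
  also have "\<dots> \<le> u" by (rule residual)
  finally have "(\<Sum>j<m-1. (cmod (c j - a j))\<^sup>2) \<le> 4 / real n * u" using n by (simp add: field_simps)
  then have h: "l2.norm_sq (low_comb (\<lambda>j. c j - a j)) \<le> 4 / real n * u" by (simp only: l2_norm_sq_low_comb)
  have eq: "f - reconstruct n X f = (f - partial f (m - 1)) - low_comb (\<lambda>j. c j - a j)"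
    unfolding reconstruct_eq c_def[symmetric] pa low_comb_diff[symmetric] by simp
  have "l2.norm_sq (f - reconstruct n X f) \<le> 2 * l2.norm_sq (f - partial f (m - 1)) + 2 * l2.norm_sq (low_comb (\<lambda>j. c j - a j))"
    unfolding eq by (rule norm_sq_diff_le[OF ip.mem_diff[OF f partial_mem] low_comb_mem])
  also have "\<dots> \<le> 2 * (lam m * ip.norm_sq f) + 2 * (4 / real n * u)"
    using residual_l2_le[OF f, of m] m_ge h by (intro add_mono mult_left_mono) auto
  finally show ?thesis by simp
qed

section \<open>Measurability of the success event\<close>

definition ball :: "('a \<Rightarrow> complex) set" where "ball = {f \<in> H. hnorm ip f \<le> 1}"

text \<open>Subsets of separable metric spaces are separable: for every member of a dense sequence of \<open>H\<close> and
  every radius \<open>1/(k + 1)\<close>, an element of the subset within this radius is chosen if there is one. Norm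
  convergence in \<open>H\<close> implies pointwise convergence.\<close>
lemma countable_pointwise_dense_ball:
  "\<exists>b :: nat \<Rightarrow> 'a \<Rightarrow> complex. (\<forall>i. b i \<in> ball) \<and> (\<forall>f\<in>ball. \<exists>r. \<forall>x. (\<lambda>i. b (r i) x) \<longlonglongrightarrow> f x)"
proof -
  obtain c where dense: "dense_sequence c" using dense_sequence_ex by blast
  note c = dense_sequence_mem[OF dense]
  define pick where "pick i k = (if \<exists>g\<in>ball. hnorm ip (g - c i) < inverse (real (Suc k))
      then SOME g. g \<in> ball \<and> hnorm ip (g - c i) < inverse (real (Suc k)) else 0)" for i k
  have zero: "0 \<in> ball" using ip.mem_zero by (simp add: ball_def hnorm_eq ip.norm_sq_def ip.zero_left)
  have pick: "hnorm ip (pick i k - c i) < inverse (real (Suc k))" "pick i k \<in> ball"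
    if "\<exists>g\<in>ball. hnorm ip (g - c i) < inverse (real (Suc k))" for i k
  proof -
    have "\<exists>g. g \<in> ball \<and> hnorm ip (g - c i) < inverse (real (Suc k))" using that by (simp add: Bex_def)
    from someI_ex[OF this] show "hnorm ip (pick i k - c i) < inverse (real (Suc k))" "pick i k \<in> ball"
      using that by (simp_all add: pick_def)
  qed
  have pick_ball: "pick i k \<in> ball" for i k
    using pick(2) zero by (cases "\<exists>g\<in>ball. hnorm ip (g - c i) < inverse (real (Suc k))") (auto simp: pick_def)
  define b where "b t = (case prod_decode t of (i, k) \<Rightarrow> pick i k)" for t
  have "\<exists>r. \<forall>x. (\<lambda>i. b (r i) x) \<longlonglongrightarrow> f x" if f: "f \<in> ball" for f
  proof -
    have fH: "f \<in> H" using f by (simp add: ball_def)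
    have "\<exists>i. hnorm ip (f - c i) < inverse (real (Suc k))" for k
      using dense[unfolded dense_sequence_def, THEN conjunct2, THEN bspec, OF fH, THEN spec, THEN mp,
          of "inverse (real (Suc k))"] by simp
    then have "\<forall>k. \<exists>i. hnorm ip (f - c i) < inverse (real (Suc k))" by blast
    from choice[OF this] obtain s where s: "\<forall>k. hnorm ip (f - c (s k)) < inverse (real (Suc k))" ..
    define r where "r k = prod_encode (s k, k)" for k
    have br: "b (r k) = pick (s k) k" for k by (simp add: b_def r_def)
    have near: "hnorm ip (b (r k) - f) \<le> 2 * inverse (real (Suc k))" for k
    proof -
      have bH: "b (r k) \<in> H" using pick_ball by (simp add: br ball_def)
      have "hnorm ip (b (r k) - c (s k)) < inverse (real (Suc k))"
        unfolding br using s f by (intro pick(1)) blast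
      moreover have "hnorm ip (c (s k) - f) < inverse (real (Suc k))"
        using s[THEN spec, of k] unfolding hnorm_eq ip.norm_sq_diff_commute[OF fH c] .
      moreover have "hnorm ip (b (r k) - f) \<le> hnorm ip (b (r k) - c (s k)) + hnorm ip (c (s k) - f)"
        using ip.sqrt_norm_sq_triangle[OF ip.mem_diff[OF bH c] ip.mem_diff[OF c fH], of "s k" "s k"]
        by (simp add: hnorm_eq)
      ultimately show ?thesis by simp
    qed
    have lim0: "(\<lambda>k. 2 * inverse (real (Suc k))) \<longlonglongrightarrow> 0"
      using tendsto_mult[OF tendsto_const LIMSEQ_inverse_real_of_nat, of 2] by simp
    have "(\<lambda>k. hnorm ip (b (r k) - f)) \<longlonglongrightarrow> 0"
    proof (rule Lim_null_comparison[OF _ lim0], intro always_eventually allI)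
      fix k
      have "b (r k) - f \<in> H" using pick_ball fH by (intro ip.mem_diff) (simp_all add: br ball_def)
      from hnorm_nonneg[OF this] near[of k] show "norm (hnorm ip (b (r k) - f)) \<le> 2 * inverse (real (Suc k))" by simp
    qed
    then have "(\<lambda>i. b (r i) x) \<longlonglongrightarrow> f x" for x
      using pick_ball fH by (intro tendsto_eval) (simp_all add: br ball_def)
    then show ?thesis by blast
  qed
  moreover have "b i \<in> ball" for i by (simp add: b_def pick_ball split: prod.split)
  ultimately show ?thesis by blast
qed

definition gram_det :: "nat \<Rightarrow> (nat \<Rightarrow> 'a) \<Rightarrow> complex" where
  "gram_det n X = Determinant.det (mat_adjoint (design n X) * design n X)"

text \<open>The entries of \<open>(L\<^sup>* L)\<^sup>-\<^sup>1 L\<^sup>*\<close> by Cramer's rule. The formula is total and measurable also where the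
  determinant vanishes.\<close>
definition solution_entry :: "nat \<Rightarrow> (nat \<Rightarrow> 'a) \<Rightarrow> nat \<Rightarrow> nat \<Rightarrow> complex" where
  "solution_entry n X j k = (1 / gram_det n X) *
     (\<Sum>i<m-1. adj_mat (mat_adjoint (design n X) * design n X) $$ (j, i) * cnj (weighted (low_fun i) (X k)))"

lemma coefficient_eq:
  assumes det: "gram_det n X \<noteq> 0" and j: "j < m - 1"
  shows "coefficient n X f j = (\<Sum>k<n. solution_entry n X j k * weighted f (X k))"
proof -
  let ?A = "design n X"
  let ?G = "mat_adjoint ?A * ?A"
  note inv = mat_inverse_gram[OF design_carrier det[unfolded gram_det_def]]
  note adj = mat_adjoint_carrier[OF design_carrier, of n X]
  have adjm: "adj_mat ?G \<in> carrier_mat (m - 1) (m - 1)" by (rule adj_mat(1)[OF gram_carrier[OF design_carrier]])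
  have B: "the (mat_inverse ?G) * mat_adjoint ?A \<in> carrier_mat (m - 1) n" using inv(1) adj by (rule mult_carrier_mat)
  have entry: "(the (mat_inverse ?G) * mat_adjoint ?A) $$ (j, k) = solution_entry n X j k" if k: "k < n" for k
  proof -
    have "(the (mat_inverse ?G) * mat_adjoint ?A) $$ (j, k)
        = (\<Sum>i<m-1. the (mat_inverse ?G) $$ (j, i) * mat_adjoint ?A $$ (i, k))"
      by (rule mult_mat_entry[OF inv(1) adj j k])
    also have "\<dots> = (\<Sum>i<m-1. (1 / gram_det n X) * (adj_mat ?G $$ (j, i) * cnj (weighted (low_fun i) (X k))))"
    proof (rule sum.cong[OF refl])
      fix i assume "i \<in> {..<m-1}"
      then have i: "i < m - 1" by simp
      have "the (mat_inverse ?G) $$ (j, i) = (1 / gram_det n X) * adj_mat ?G $$ (j, i)"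
        unfolding inv(3) gram_det_def using i j adjm by (intro index_smult_mat(1)) auto
      moreover have "mat_adjoint ?A $$ (i, k) = cnj (weighted (low_fun i) (X k))"
        using mat_adjoint_entry[OF design_carrier i k] design_entry[OF k i] by simp
      ultimately show "the (mat_inverse ?G) $$ (j, i) * mat_adjoint ?A $$ (i, k)
          = (1 / gram_det n X) * (adj_mat ?G $$ (j, i) * cnj (weighted (low_fun i) (X k)))" by (simp only: mult.assoc)
    qed
    finally show ?thesis unfolding solution_entry_def by (simp only: sum_distrib_left)
  qed
  have "coefficient n X f j = (\<Sum>k<n. (the (mat_inverse ?G) * mat_adjoint ?A) $$ (j, k) * vec_index (wls_data \<rho> n X f) k)"
    unfolding coefficient_def coeffs_eq ls_solution_def[OF design_carrier] by (rule mult_mat_vec_entry[OF B data_carrier j])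
  then show ?thesis by (simp add: entry data_entry)
qed

lemma weighted_measurable: "f \<in> H \<Longrightarrow> weighted f \<in> borel_measurable M"
proof -
  assume "f \<in> H"
  then have [measurable]: "f \<in> borel_measurable M" by (rule measurable_mem)
  note density_measurable [measurable]
  show ?thesis unfolding weighted_def[abs_def] by measurable
qed

lemma node_weighted_measurable:
  assumes "f \<in> H" "k < n" shows "(\<lambda>X. weighted f (X k)) \<in> borel_measurable (nodes n)"
proof -
  have "(\<lambda>X. X k) \<in> measurable (nodes n) \<mu>" using assms(2) by (intro measurable_component_singleton) simp
  moreover have "weighted f \<in> borel_measurable \<mu>"
    using weighted_measurable[OF assms(1)] by (simp only: measurable_cong_sets[OF sets_\<mu> refl])
  ultimately show ?thesis by (rule measurable_compose)
qed

lemma gram_entry_measurable: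
  assumes "i < m - 1" "j < m - 1"
  shows "(\<lambda>X. (mat_adjoint (design n X) * design n X) $$ (i, j)) \<in> borel_measurable (nodes n)"
proof -
  have "(mat_adjoint (design n X) * design n X) $$ (i, j)
      = (\<Sum>k<n. cnj (weighted (low_fun i) (X k)) * weighted (low_fun j) (X k))" for X
    using gram_entry[OF design_carrier assms, of n X] assms by (simp add: design_entry)
  then show ?thesis
    by (simp only:) (intro borel_measurable_sum borel_measurable_times borel_measurable_cnj node_weighted_measurable low_fun_mem, auto)
qed

lemma gram_det_measurable: "gram_det n \<in> borel_measurable (nodes n)"
  unfolding gram_det_def[abs_def]
  by (rule borel_measurable_det[OF gram_carrier[OF design_carrier] gram_entry_measurable])

lemma solution_entry_measurable:
  assumes "j < m - 1" "k < n" shows "(\<lambda>X. solution_entry n X j k) \<in> borel_measurable (nodes n)"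
  unfolding solution_entry_def
proof (intro borel_measurable_times borel_measurable_divide borel_measurable_const gram_det_measurable
    borel_measurable_sum borel_measurable_cnj node_weighted_measurable low_fun_mem assms(2))
  fix i assume "i \<in> {..<m-1}"
  then show "(\<lambda>X. adj_mat (mat_adjoint (design n X) * design n X) $$ (j, i)) \<in> borel_measurable (nodes n)"
    using assms(1) by (intro borel_measurable_adj_mat[OF gram_carrier[OF design_carrier] gram_entry_measurable]) simp_all
qed

lemma error_measurable:
  assumes f: "f \<in> H"
  shows "(\<lambda>X. \<integral>\<^sup>+x. ennreal ((cmod (f x - (\<Sum>j<m-1. (\<Sum>k<n. solution_entry n X j k * weighted f (X k)) * low_fun j x)))\<^sup>2) \<partial>M)
    \<in> borel_measurable (nodes n)"
proof (rule sigma_finite_measure.borel_measurable_nn_integral[OF sigma_finite])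
  have "(\<lambda>X. \<Sum>k<n. solution_entry n X j k * weighted f (X k)) \<in> borel_measurable (nodes n)" if "j < m - 1" for j
    using that by (intro borel_measurable_sum borel_measurable_times solution_entry_measurable node_weighted_measurable f) auto
  then have c: "(\<lambda>p. \<Sum>k<n. solution_entry n (fst p) j k * weighted f (fst p k)) \<in> borel_measurable (nodes n \<Otimes>\<^sub>M M)" if "j < m - 1" for j
    using measurable_compose[OF measurable_fst] that by blast
  have g: "(\<lambda>p. g (snd p)) \<in> borel_measurable (nodes n \<Otimes>\<^sub>M M)" if "g \<in> H" for g
    by (rule measurable_compose[OF measurable_snd measurable_mem[OF that]])
  have "(\<lambda>p. f (snd p) - (\<Sum>j<m-1. (\<Sum>k<n. solution_entry n (fst p) j k * weighted f (fst p k)) * low_fun j (snd p)))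
      \<in> borel_measurable (nodes n \<Otimes>\<^sub>M M)"
    by (intro borel_measurable_diff borel_measurable_sum borel_measurable_times c g f low_fun_mem) simp
  then show "(\<lambda>(X, x). ennreal ((cmod (f x - (\<Sum>j<m-1. (\<Sum>k<n. solution_entry n X j k * weighted f (X k)) * low_fun j x)))\<^sup>2))
      \<in> borel_measurable (nodes n \<Otimes>\<^sub>M M)"
    unfolding case_prod_beta by measurable
qed

lemma error_eq:
  assumes "gram_det n X \<noteq> 0"
  shows "L2_norm_sq M (f - reconstruct n X f)
    = (\<integral>\<^sup>+x. ennreal ((cmod (f x - (\<Sum>j<m-1. (\<Sum>k<n. solution_entry n X j k * weighted f (X k)) * low_fun j x)))\<^sup>2) \<partial>M)"
  unfolding L2_norm_sq_def reconstruct_eq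
  by (intro nn_integral_cong) (simp add: low_comb_apply coefficient_eq[OF assms])

text \<open>The reconstruction depends linearly on finitely many function values, so that pointwise convergence of the
  functions implies pointwise convergence of the errors, and Fatou's lemma applies.\<close>
lemma error_lower_semicontinuous:
  assumes det: "gram_det n X \<noteq> 0" and b: "\<And>i::nat. b i \<in> H" and f: "f \<in> H"
    and lim: "\<And>x. (\<lambda>i. b i x) \<longlonglongrightarrow> f x"
    and le: "\<And>i. L2_norm_sq M (b i - reconstruct n X (b i)) \<le> C"
  shows "L2_norm_sq M (f - reconstruct n X f) \<le> C"
proof -
  let ?g = "\<lambda>h. h - reconstruct n X h"
  have w: "(\<lambda>i. weighted (b i) x) \<longlonglongrightarrow> weighted f x" for x
  proof (cases "\<rho> x = 0")
    case False
    then show ?thesis unfolding weighted_def by (auto intro!: tendsto_divide lim)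
  qed (simp add: weighted_def)
  have glim: "(\<lambda>i. ?g (b i) x) \<longlonglongrightarrow> ?g f x" for x
  proof -
    have "(\<lambda>i. coefficient n X (b i) j) \<longlonglongrightarrow> coefficient n X f j" if "j < m - 1" for j
      unfolding coefficient_eq[OF det that] by (intro tendsto_sum tendsto_mult tendsto_const w)
    then have "(\<lambda>i. b i x - (\<Sum>j<m-1. coefficient n X (b i) j * low_fun j x)) \<longlonglongrightarrow> f x - (\<Sum>j<m-1. coefficient n X f j * low_fun j x)"
      by (intro tendsto_diff tendsto_sum tendsto_mult tendsto_const lim) simp
    then show ?thesis by (simp add: reconstruct_eq low_comb_apply)
  qed
  have mem: "?g h \<in> H" if "h \<in> H" for h unfolding reconstruct_eq by (intro ip.mem_diff that low_comb_mem)
  have "L2_norm_sq M (?g f) = (\<integral>\<^sup>+x. liminf (\<lambda>i. ennreal ((cmod (?g (b i) x))\<^sup>2)) \<partial>M)"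
    unfolding L2_norm_sq_def
  proof (rule nn_integral_cong)
    fix x
    have "(\<lambda>i. ennreal ((cmod (?g (b i) x))\<^sup>2)) \<longlonglongrightarrow> ennreal ((cmod (?g f x))\<^sup>2)"
      by (intro tendsto_ennrealI tendsto_power tendsto_norm glim)
    then show "ennreal ((cmod (?g f x))\<^sup>2) = liminf (\<lambda>i. ennreal ((cmod (?g (b i) x))\<^sup>2))"
      by (intro lim_imp_Liminf[symmetric]) simp_all
  qed
  also have "\<dots> \<le> liminf (\<lambda>i. \<integral>\<^sup>+x. ennreal ((cmod (?g (b i) x))\<^sup>2) \<partial>M)"
  proof (rule nn_integral_liminf)
    fix i
    have "?g (b i) \<in> borel_measurable M" by (rule measurable_mem[OF mem[OF b]])
    then show "(\<lambda>x. ennreal ((cmod (?g (b i) x))\<^sup>2)) \<in> borel_measurable M" by measurable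
  qed
  also have "\<dots> \<le> liminf (\<lambda>i. C)"
    using le unfolding L2_norm_sq_def by (intro Liminf_mono always_eventually) simp
  also have "\<dots> = C" by (simp add: Liminf_const)
  finally show ?thesis .
qed

text \<open>Full rank says that the Gram determinant does not vanish. Given this, lower semicontinuity reduces the
  supremum over the unit ball to one over a countable set of functions, each with a measurable error.\<close>
lemma success_event_measurable:
  "{X \<in> space (nodes n). full_column_rank (design n X) \<and>
      (SUP f\<in>{f \<in> H. hnorm ip f \<le> 1}. L2_norm_sq M (f - reconstruct n X f)) \<le> C} \<in> sets (nodes n)"
proof -
  obtain b :: "nat \<Rightarrow> 'a \<Rightarrow> complex" where bb: "(\<forall>i. b i \<in> ball) \<and> (\<forall>f\<in>ball. \<exists>r. \<forall>x. (\<lambda>i. b (r i) x) \<longlonglongrightarrow> f x)"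
    using countable_pointwise_dense_ball by (rule exE)
  then have b: "b i \<in> H" "b i \<in> ball" for i by (simp_all add: ball_def)
  define F where "F i X = (\<integral>\<^sup>+x. ennreal ((cmod (b i x - (\<Sum>j<m-1. (\<Sum>k<n. solution_entry n X j k * weighted (b i) (X k)) * low_fun j x)))\<^sup>2) \<partial>M)" for i X
  have F: "F i \<in> borel_measurable (nodes n)" for i unfolding F_def[abs_def] by (rule error_measurable[OF b(1)])
  have "full_column_rank (design n X) \<and> (SUP f\<in>{f \<in> H. hnorm ip f \<le> 1}. L2_norm_sq M (f - reconstruct n X f)) \<le> C
      \<longleftrightarrow> gram_det n X \<noteq> 0 \<and> (\<forall>i. F i X \<le> C)" for X
  proof (cases "gram_det n X = 0")
    case True
    then show ?thesis using full_column_rank_iff_det_gram[OF design_carrier, of n X] by (simp add: gram_det_def)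
  next
    case False
    have Fi: "F i X = L2_norm_sq M (b i - reconstruct n X (b i))" for i unfolding F_def by (rule error_eq[OF False, symmetric])
    have "(SUP f\<in>ball. L2_norm_sq M (f - reconstruct n X f)) \<le> C \<longleftrightarrow> (\<forall>i. F i X \<le> C)"
    proof
      assume "(SUP f\<in>ball. L2_norm_sq M (f - reconstruct n X f)) \<le> C"
      then show "\<forall>i. F i X \<le> C" unfolding Fi using b(2) by (simp add: SUP_le_iff)
    next
      assume le: "\<forall>i. F i X \<le> C"
      show "(SUP f\<in>ball. L2_norm_sq M (f - reconstruct n X f)) \<le> C"
      proof (rule SUP_least)
        fix f assume f: "f \<in> ball"
        from bb[THEN conjunct2, THEN bspec, OF f] obtain r where r: "\<forall>x. (\<lambda>i. b (r i) x) \<longlonglongrightarrow> f x" ..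
        show "L2_norm_sq M (f - reconstruct n X f) \<le> C"
        proof (rule error_lower_semicontinuous[OF False, of "\<lambda>i. b (r i)"])
          show "f \<in> H" using f by (simp add: ball_def)
          show "L2_norm_sq M (b (r i) - reconstruct n X (b (r i))) \<le> C" for i using le by (simp flip: Fi)
        qed (use b r in auto)
      qed
    qed
    then show ?thesis
      using False full_column_rank_iff_det_gram[OF design_carrier, of n X] by (simp add: gram_det_def ball_def)
  qed
  then have eq: "{X \<in> space (nodes n). full_column_rank (design n X) \<and>
      (SUP f\<in>{f \<in> H. hnorm ip f \<le> 1}. L2_norm_sq M (f - reconstruct n X f)) \<le> C}
    = {X \<in> space (nodes n). gram_det n X \<noteq> 0 \<and> (\<forall>i. F i X \<le> C)}" by blast
  note F [measurable] gram_det_measurable [measurable]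
  show ?thesis unfolding eq by measurable
qed

end

section \<open>The success probability\<close>

text \<open>Let \<open>L\<close> be the denominator of \<open>m\<close> divided by 96, and \<open>p\<close> be \<open>L\<close> rounded up. As \<open>1/\<delta> > 3\<close>
  exceeds Euler's number, \<open>L \<ge> 1\<close> and \<open>p \<le> 2 L\<close>, which gives \<open>40 p (m - 1) \<le> 96 L m \<le> n\<close>. Moreover
  \<open>L \<ge> ln (2n / \<delta>)\<close>, so that \<open>exp (- p)\<close> is at most \<open>\<delta> / (2n)\<close>.\<close>
lemma oversampling_parameter:
  fixes n m :: nat and \<delta> :: real
  assumes m_eq: "m = nat \<lfloor>real n / (96 * (sqrt 2 * ln (2 * real n) - ln \<delta>))\<rfloor>"
    and m: "2 \<le> m" and \<delta>: "0 < \<delta>" "\<delta> < 1 / 3"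
  shows "192 \<le> n"
    and "\<exists>p\<ge>1. 40 * real p * (real m - 1) \<le> real n \<and> real (m - 1) * exp (- real p) \<le> \<delta>"
proof -
  define L where "L = sqrt 2 * ln (2 * real n) - ln \<delta>"
  have n: "1 \<le> n" using m unfolding m_eq by (cases n) auto
  have ln_n: "0 \<le> ln (2 * real n)" using n by simp
  have "1 * ln (2 * real n) \<le> sqrt 2 * ln (2 * real n)" using ln_n by (intro mult_right_mono) auto
  then have L_ge: "ln (2 * real n) - ln \<delta> \<le> L" by (simp add: L_def)
  have "exp 1 \<le> (3::real)" by (rule exp_le)
  also have "\<dots> \<le> exp (- ln \<delta>)" using \<delta> by (simp add: exp_minus field_simps)
  finally have "1 \<le> - ln \<delta>" by simp
  then have L1: "1 \<le> L" using L_ge ln_n by simp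
  have "real m \<le> real n / (96 * L)" unfolding m_eq L_def[symmetric] using L1 by (intro of_nat_floor) simp
  then have mL: "96 * L * real m \<le> real n" using L1 by (simp add: field_simps)
  have "96 * 1 * 2 \<le> 96 * L * real m" using L1 m by (intro mult_mono) auto
  then have "192 \<le> real n" using mL by simp
  then show "192 \<le> n" by simp
  have "1 * real m \<le> (96 * L) * real m" using L1 by (intro mult_right_mono) auto
  then have mn: "real m \<le> real n" using mL by simp
  define p where "p = nat \<lceil>L\<rceil>"
  have p: "L \<le> real p" "real p \<le> 2 * L" "1 \<le> p" unfolding p_def using L1 by linarith+
  have "40 * real p * (real m - 1) \<le> (96 * L) * real m"
  proof (rule mult_mono)
    show "40 * real p \<le> 96 * L" using p L1 by simp
  qed (use L1 m in auto)
  then have "40 * real p * (real m - 1) \<le> real n" using mL by simp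
  moreover have "real (m - 1) * exp (- real p) \<le> \<delta>"
  proof -
    have "exp (- real p) \<le> exp (ln \<delta> - ln (2 * real n))" using p(1) L_ge by simp
    also have "\<dots> = \<delta> / (2 * real n)" using \<delta> n by (simp add: exp_diff)
    finally have "real (m - 1) * exp (- real p) \<le> real n * (\<delta> / (2 * real n))"
      using mn by (intro mult_mono) auto
    also have "\<dots> \<le> \<delta>" using n \<delta> by simp
    finally show ?thesis .
  qed
  ultimately show "\<exists>p\<ge>1. 40 * real p * (real m - 1) \<le> real n \<and> real (m - 1) * exp (- real p) \<le> \<delta>"
    using p(3) by blast
qed

text \<open>\<open>8n\<close> exceeds the fourth power of \<open>3\<close>, hence \<open>ln (8n) \<ge> 4\<close> and rounding up costs at most a factor \<open>5/4\<close>.\<close>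
lemma logarithmic_order:
  fixes n :: nat
  assumes "192 \<le> n"
  shows "\<exists>q\<ge>1. real n \<le> exp (real q) \<and> 4 * real q \<le> 5 * ln (8 * real n)"
proof -
  define l where "l = ln (8 * real n)"
  have "exp 4 = (exp 1 :: real) ^ 4" using exp_of_nat_mult[of 4 "1::real"] by simp
  also have "\<dots> \<le> (3::real) ^ 4" using exp_le by (rule power_mono) simp
  also have "\<dots> \<le> 8 * real n" using assms by simp
  finally have l: "4 \<le> l" unfolding l_def using assms by (simp add: ln_ge_iff)
  define q where "q = nat \<lceil>l\<rceil>"
  have q: "l \<le> real q" "real q \<le> l + 1" "1 \<le> q" unfolding q_def using l by linarith+
  have "real n \<le> exp l" unfolding l_def using assms by simp
  also have "\<dots> \<le> exp (real q)" using q(1) by simp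
  finally show ?thesis using q l unfolding l_def by (intro exI[of _ q]) auto
qed

context sampling_setup
begin

text \<open>With \<open>b\<close> for the maximum, the residual contributes at most \<open>8 (1 + 5) b / \<delta>\<close> and the projection error at
  most \<open>2 b\<close>, which is below \<open>2 b / \<delta>\<close>.\<close>
lemma error_constant:
  assumes n: "0 < n" and \<delta>: "0 < \<delta>" "\<delta> < 1 / 3" and q: "4 * real q \<le> 5 * ln (8 * real n)"
  shows "2 * lam m + 8 / real n * ((real n * lam m + 4 * real q * tail_trace) / \<delta>)
    \<le> 50 / \<delta> * max (lam m) (ln (8 * real n) / real n * tail_trace)"
proof -
  define b where "b = max (lam m) (ln (8 * real n) / real n * tail_trace)"
  have lam: "lam m \<le> b" and tail: "ln (8 * real n) / real n * tail_trace \<le> b" by (simp_all add: b_def)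
  have b: "0 \<le> b" using lam lam_pos[of m] m_ge by simp
  have "4 * real q * tail_trace \<le> 5 * ln (8 * real n) * tail_trace"
    using q tail_trace_pos by (intro mult_right_mono) auto
  also have "\<dots> = 5 * real n * (ln (8 * real n) / real n * tail_trace)" using n by simp
  also have "\<dots> \<le> 5 * real n * b" using tail by (intro mult_left_mono) auto
  finally have "real n * lam m + 4 * real q * tail_trace \<le> real n * b + 5 * real n * b"
    using lam by (intro add_mono mult_left_mono) auto
  then have "8 / real n * ((real n * lam m + 4 * real q * tail_trace) / \<delta>) \<le> 8 / real n * ((real n * b + 5 * real n * b) / \<delta>)"
    using \<delta> by (intro mult_left_mono divide_right_mono) auto
  also have "\<dots> = 48 / \<delta> * b" using n \<delta> by (simp add: field_simps)
  finally have "8 / real n * ((real n * lam m + 4 * real q * tail_trace) / \<delta>) \<le> 48 / \<delta> * b" .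
  moreover have "2 * lam m \<le> 2 / \<delta> * b"
  proof -
    have "2 * lam m \<le> 2 * b" using lam by simp
    also have "\<dots> \<le> 2 / \<delta> * b" using \<delta> b by (intro mult_right_mono) (auto simp: field_simps)
    finally show ?thesis .
  qed
  ultimately have "2 * lam m + 8 / real n * ((real n * lam m + 4 * real q * tail_trace) / \<delta>) \<le> 2 / \<delta> * b + 48 / \<delta> * b"
    by (rule add_mono[rotated])
  also have "\<dots> = 50 / \<delta> * b" by (simp add: field_simps)
  finally show ?thesis unfolding b_def .
qed

text \<open>Outside the union of the two exceptional events both hypotheses of the deterministic error bound
  hold, for all functions at once.\<close>
theorem success_probability:
  fixes n p q :: nat
  assumes n: "0 < n" and \<delta>: "0 < \<delta>" "\<delta> < 1 / 3"
    and p: "1 \<le> p" "40 * real p * (real m - 1) \<le> real n" "real (m - 1) * exp (- real p) \<le> \<delta>"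
    and q: "1 \<le> q" "real n \<le> exp (real q)" "4 * real q \<le> 5 * ln (8 * real n)"
  shows "1 - 2 * \<delta> \<le> measure (nodes n) {X \<in> space (nodes n). full_column_rank (design n X) \<and>
      (SUP f\<in>{f \<in> H. hnorm ip f \<le> 1}. L2_norm_sq M (f - reconstruct n X f))
        \<le> ennreal (50 / \<delta> * max (lam m) (ln (8 * real n) / real n * tail_trace))}"
    (is "_ \<le> measure _ ?good")
proof -
  let ?u = "(real n * lam m + 4 * real q * tail_trace) / \<delta>"
  interpret Q: prob_space "nodes n" by (rule prob_space_nodes)
  from low_frame_event[OF p(1,2)] obtain A where A: "A \<in> sets (nodes n)"
      "measure (nodes n) A \<le> real (m - 1) * exp (- real p)"
    and frame: "\<forall>X\<in>space (nodes n) - A. \<forall>c. real n / 4 * (\<Sum>j<m-1. (cmod (c j))\<^sup>2)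
       \<le> (\<Sum>i<n. (cmod (\<Sum>j<m-1. weighted (low_fun j) (X i) * c j))\<^sup>2)" by (elim bexE conjE)
  from residual_event[OF q(1,2) \<delta>] obtain B where B: "B \<in> sets (nodes n)" "measure (nodes n) B \<le> \<delta>"
    and residual: "\<forall>X\<in>space (nodes n) - B. \<forall>f\<in>H. (\<Sum>i<n. (cmod (weighted (f - partial f (m - 1)) (X i)))\<^sup>2)
       \<le> ?u * ip.norm_sq f" by (elim bexE conjE)
  have u: "0 \<le> ?u" using \<delta> lam_pos[of m] m_ge tail_trace_pos by (intro divide_nonneg_pos add_nonneg_nonneg) auto
  have "space (nodes n) - (A \<union> B) \<subseteq> ?good"
  proof
    fix X assume X: "X \<in> space (nodes n) - (A \<union> B)"
    then have fr: "\<And>c. real n / 4 * (\<Sum>j<m-1. (cmod (c j))\<^sup>2) \<le> (\<Sum>i<n. (cmod (\<Sum>j<m-1. weighted (low_fun j) (X i) * c j))\<^sup>2)"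
      using frame by blast
    have rank: "full_column_rank (design n X)"
      unfolding full_column_rank_iff_det_gram[OF design_carrier] by (rule frame_imp_full_rank[OF n fr])
    have "(SUP f\<in>{f \<in> H. hnorm ip f \<le> 1}. L2_norm_sq M (f - reconstruct n X f))
        \<le> ennreal (50 / \<delta> * max (lam m) (ln (8 * real n) / real n * tail_trace))"
    proof (rule SUP_least)
      fix f assume "f \<in> {f \<in> H. hnorm ip f \<le> 1}"
      then have f: "f \<in> H" and "sqrt (ip.norm_sq f) \<le> 1" by (simp_all add: hnorm_eq)
      then have norm: "ip.norm_sq f \<le> 1" by simp
      have "(\<Sum>i<n. (cmod (weighted (f - partial f (m - 1)) (X i)))\<^sup>2) \<le> ?u * ip.norm_sq f"
        using residual X f by blast
      also have "\<dots> \<le> ?u * 1" using u norm by (intro mult_left_mono)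
      finally have res: "(\<Sum>i<n. (cmod (weighted (f - partial f (m - 1)) (X i)))\<^sup>2) \<le> ?u" by simp
      have "l2.norm_sq (f - reconstruct n X f) \<le> 2 * (lam m * ip.norm_sq f) + 8 / real n * ?u"
        by (rule reconstruction_error_le[OF n f fr res])
      also have "\<dots> \<le> 2 * (lam m * 1) + 8 / real n * ?u"
        using norm lam_pos[of m] m_ge by (intro add_right_mono mult_left_mono) auto
      also have "\<dots> = 2 * lam m + 8 / real n * ?u" by simp
      also have "\<dots> \<le> 50 / \<delta> * max (lam m) (ln (8 * real n) / real n * tail_trace)"
        by (rule error_constant[OF n \<delta> q(3)])
      finally have le: "l2.norm_sq (f - reconstruct n X f) \<le> 50 / \<delta> * max (lam m) (ln (8 * real n) / real n * tail_trace)" .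
      have "f - reconstruct n X f \<in> H" unfolding reconstruct_eq by (intro ip.mem_diff f low_comb_mem)
      then show "L2_norm_sq M (f - reconstruct n X f) \<le> ennreal (50 / \<delta> * max (lam m) (ln (8 * real n) / real n * tail_trace))"
        using le by (simp only: L2_norm_sq_eq ennreal_leI)
    qed
    then show "X \<in> ?good" using rank X by simp
  qed
  then have "measure (nodes n) (space (nodes n) - (A \<union> B)) \<le> measure (nodes n) ?good"
    by (rule Q.finite_measure_mono[OF _ success_event_measurable])
  moreover have "measure (nodes n) (space (nodes n) - (A \<union> B)) = 1 - measure (nodes n) (A \<union> B)"
    using A(1) B(1) by (intro Q.prob_compl) auto
  moreover have "measure (nodes n) (A \<union> B) \<le> measure (nodes n) A + measure (nodes n) B"
    by (rule measure_Un_le[OF A(1) B(1)])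
  ultimately show ?thesis using A(2) B(2) p(3) by linarith
qed

end

theorem theorem1p2:
  fixes D :: "(real ^ 'd) set"
    and M :: "(real ^ 'd) measure"
    and K :: "real ^ 'd \<Rightarrow> real ^ 'd \<Rightarrow> complex"
    and H :: "(real ^ 'd \<Rightarrow> complex) set"
    and ip :: "(real ^ 'd \<Rightarrow> complex) \<Rightarrow> (real ^ 'd \<Rightarrow> complex) \<Rightarrow> complex"
    and lam :: "nat \<Rightarrow> real"
    and e :: "nat \<Rightarrow> real ^ 'd \<Rightarrow> complex"
    and n m :: nat
    and \<delta> :: real
  assumes "positive_semidefinite_kernel D K"
    and "reproducing_kernel_hilbert_space D K H ip"
    and "separable_hilbert H ip"
    and "infinite_dimensional H"
    and "sigma_finite_measure M"
    and "space M = D"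
    and "emeasure M D \<noteq> 0"
    and "H \<subseteq> borel_measurable M"
    and "(\<integral>\<^sup>+x. ennreal (Re (K x x)) \<partial>M) < \<infinity>"
    and "positive_eigensystem M H ip lam e"
    and "0 < \<delta>" and "\<delta> < 1 / 3"
    and "m = nat \<lfloor>real n / (96 * (sqrt 2 * ln (2 * real n) - ln \<delta>))\<rfloor>"
    and "m \<ge> 2"
  defines "\<rho> \<equiv> sampling_density K lam e m"
    and "P \<equiv> Pi\<^sub>M {..<n} (\<lambda>_. sampling_measure M K lam e m)"
  shows "measure P {X \<in> space P.
      full_column_rank (wls_matrix \<rho> (eta lam e) n m X) \<and>
      (SUP f\<in>{f \<in> H. hnorm ip f \<le> 1}. L2_norm_sq M (f - wls_operator \<rho> (eta lam e) n m X f))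
        \<le> ennreal (50 / \<delta> * max ((sing_num lam m)\<^sup>2)
             (ln (8 * real n) / real n * (\<Sum>j. (sing_num lam (m + j))\<^sup>2)))}
    \<ge> 1 - 3 * \<delta>"
proof -
  interpret S: sampling_setup D K H ip M lam e m
    by (intro sampling_setup.intro embedded_rkhs_spectrum.intro embedded_rkhs.intro
        embedded_rkhs_axioms.intro embedded_rkhs_spectrum_axioms.intro sampling_setup_axioms.intro assms)
  note params = oversampling_parameter[OF assms(13,14,11,12)]
  from params(2) obtain p where p: "p \<ge> 1" "40 * real p * (real m - 1) \<le> real n" "real (m - 1) * exp (- real p) \<le> \<delta>"
    by blast
  from logarithmic_order[OF params(1)] obtain q where q: "q \<ge> 1" "real n \<le> exp (real q)" "4 * real q \<le> 5 * ln (8 * real n)"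
    by blast
  have n: "0 < n" using params(1) by simp
  have sq: "(sing_num lam k)\<^sup>2 = lam k" if "1 \<le> k" for k
    using S.lam_pos[OF that] by (simp add: sing_num_def)
  have main: "(sing_num lam m)\<^sup>2 = lam m"
    by (rule sq) (use assms(14) in linarith)
  have "(sing_num lam (m + j))\<^sup>2 = lam (m + j)" for j
    by (rule sq) (use assms(14) in linarith)
  then have tail: "(\<Sum>j. (sing_num lam (m + j))\<^sup>2) = S.tail_trace"
    by (simp only: S.tail_trace_def)
  have "1 - 2 * \<delta> \<le> measure P {X \<in> space P.
      full_column_rank (wls_matrix \<rho> (eta lam e) n m X) \<and>
      (SUP f\<in>{f \<in> H. hnorm ip f \<le> 1}. L2_norm_sq M (f - wls_operator \<rho> (eta lam e) n m X f))
        \<le> ennreal (50 / \<delta> * max ((sing_num lam m)\<^sup>2)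
             (ln (8 * real n) / real n * (\<Sum>j. (sing_num lam (m + j))\<^sup>2)))}"
    unfolding main tail \<rho>_def P_def by (rule S.success_probability[OF n assms(11,12) p q])
  moreover have "1 - 3 * \<delta> \<le> 1 - 2 * \<delta>" using assms(11) by simp
  ultimately show ?thesis by (rule order_trans[rotated])
qed

end
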